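(* Any two isospectral $\mathbb Z_2$-symmetric metrics in $\mathcal G$ coincide.
   Context: Let $S^1=\mathbb R/2\pi\mathbb Z$ act on the unit sphere $S^2\subset\mathbb R^3$ by rotations about the $z$-axis. $\mathcal G$ is the set of $S^1$-invariant smooth Riemannian metrics on $S^2$ possessing a unique equator, i.e. a single $S^1$-invariant unoriented closed geodesic. Away from the two poles, $g\in\mathcal G$ is uniquely written as $g=d\sigma^2+r(\sigma)^2d\theta^2$, where $\theta\in S^1$ is the longitude, $\sigma\in(0,m)$ is the $g$-distance from the south pole along meridians, $m$ is the length of the meridian arc between the poles, and $r:[0,m]\to\mathbb R$ is called the profile function of $g$. A metric $g\in\mathcal G$ is $\mathbb Z_2$-symmetric if it is symmetric with respect to the reflection $(x,y,z)\mapsto(x,y,-z)$; equivalently, its profile function satisfies $r(m-\sigma)=r(\sigma)$ for all $\sigma\in[0,m]$. As is implicit in describing metrics by their profile functions, metrics are identified when they have the same expression in these coordinates, i.e. the same profile function. Marked length spectrum: a meridian is a closed geodesic through the two poles. Any unoriented closed geodesic that is neither the equator nor a meridian is of type $(p,q)$, where $p\in\{1,2,\dots\}$ is (the absolute value of) its winding number around the $z$-axis and $2q$, $q\in\{1,2,\dots\}$, is the number of its (transverse) intersections with the equator; one has $\gcd(p,q)=1$. For coprime $p,q\ge1$, $\mathcal L_g(p,q)\subset(0,+\infty)$ is the (possibly empty) set of lengths of all closed geodesics of type $(p,q)$. The marked length spectrum of $g$ is the datum of the length of the equator and of the set-valued function $\mathcal L_g$. Two metrics in $\mathcal G$ are isospectral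 if they have the same marked length spectrum. *)

theory Defs
  imports "HOL-Analysis.Analysis" "HOL-Complex_Analysis.Winding_Numbers"
begin

section \<open>The sphere and its symmetries\<close>

abbreviation S2 :: "(real^3) set" where
  "S2 \<equiv> sphere 0 1"

definition tangent :: "real^3 \<Rightarrow> (real^3) set" where
  "tangent x = {v. v \<bullet> x = 0}"

definition south :: "real^3" where "south = vector [0, 0, -1]"
definition north :: "real^3" where "north = vector [0, 0, 1]"

definition rot :: "real \<Rightarrow> real^3 \<Rightarrow> real^3" where
  "rot a x = vector [cos a * x$1 - sin a * x$2, sin a * x$1 + cos a * x$2, x$3]"

definition refl_z :: "real^3 \<Rightarrow> real^3" where
  "refl_z x = vector [x$1, x$2, - (x$3)]"

text \<open>The infinitesimal generator of \<open>rot\<close>, i.e. the coordinate field of the longitude.\<close>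

definition rot_field :: "real^3 \<Rightarrow> real^3" where
  "rot_field x = vector [- (x$2), x$1, 0]"


section \<open>Smooth Riemannian metrics on the sphere\<close>

fun Ck_on :: "nat \<Rightarrow> ('a::euclidean_space \<Rightarrow> real) \<Rightarrow> 'a set \<Rightarrow> bool" where
  "Ck_on 0 f U \<longleftrightarrow> continuous_on U f"
| "Ck_on (Suc k) f U \<longleftrightarrow> (\<forall>x\<in>U. f differentiable (at x)) \<and>
     (\<forall>b\<in>Basis. Ck_on k (\<lambda>x. frechet_derivative f (at x) b) U)"

text \<open>Meaningful for open \<open>U\<close> only.\<close>

definition smooth_on_open :: "('a::euclidean_space \<Rightarrow> real) \<Rightarrow> 'a set \<Rightarrow> bool" where
  "smooth_on_open f U \<longleftrightarrow> open U \<and> (\<forall>k. Ck_on k f U)"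

text \<open>A covariant 2-tensor on the sphere is represented by a function \<open>g\<close> for which only the
  values \<open>g x v w\<close> with \<open>x \<in> S2\<close> and \<open>v, w \<in> tangent x\<close> are meaningful; all notions below
  depend on these values only.\<close>

type_synonym tensor = "real^3 \<Rightarrow> real^3 \<Rightarrow> real^3 \<Rightarrow> real"

text \<open>Derivative at \<open>x \<noteq> 0\<close> of the radial retraction \<open>x \<mapsto> x / \<parallel>x\<parallel> = sgn x\<close> onto the sphere,
  and the pullback of \<open>g\<close> along this retraction. As the retraction is a smooth submersion that is
  the identity on the sphere, \<open>g\<close> is smooth iff its pullback is.\<close>

definition dsgn :: "real^3 \<Rightarrow> real^3 \<Rightarrow> real^3" where
  "dsgn x v = (v - (v \<bullet> sgn x) *\<^sub>R sgn x) /\<^sub>R norm x"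

definition pull :: "tensor \<Rightarrow> tensor" where
  "pull g x v w = g (sgn x) (dsgn x v) (dsgn x w)"

definition riemannian_metric :: "tensor \<Rightarrow> bool" where
  "riemannian_metric g \<longleftrightarrow>
     (\<forall>x\<in>S2. \<forall>u\<in>tangent x. \<forall>v\<in>tangent x. \<forall>w\<in>tangent x. \<forall>a.
        g x (a *\<^sub>R u + v) w = a * g x u w + g x v w) \<and>
     (\<forall>x\<in>S2. \<forall>v\<in>tangent x. \<forall>w\<in>tangent x. g x v w = g x w v) \<and>
     (\<forall>x\<in>S2. \<forall>v\<in>tangent x. v \<noteq> 0 \<longrightarrow> g x v v > 0) \<and>
     (\<forall>v w. smooth_on_open (\<lambda>x. pull g x v w) (- {0}))"

definition S1_invariant :: "tensor \<Rightarrow> bool" where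
  "S1_invariant g \<longleftrightarrow> (\<forall>a. \<forall>x\<in>S2. \<forall>v\<in>tangent x. \<forall>w\<in>tangent x.
     g (rot a x) (rot a v) (rot a w) = g x v w)"

definition Z2_symmetric :: "tensor \<Rightarrow> bool" where
  "Z2_symmetric g \<longleftrightarrow> (\<forall>x\<in>S2. \<forall>v\<in>tangent x. \<forall>w\<in>tangent x.
     g (refl_z x) (refl_z v) (refl_z w) = g x v w)"


section \<open>Closed geodesics\<close>

abbreviation velocity :: "(real \<Rightarrow> real^3) \<Rightarrow> real \<Rightarrow> real^3" where
  "velocity \<gamma> t \<equiv> vector_derivative \<gamma> (at t)"

text \<open>The last conjunct is the geodesic equation
  \<open>d/dt (g\<^sub>i\<^sub>j \<gamma>'\<^sup>j) = 1/2 (\<partial>\<^sub>i g\<^sub>j\<^sub>k) \<gamma>'\<^sup>j \<gamma>'\<^sup>k\<close>, that is the Euler-Lagrange equation of the energy. It is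
  written for the pullback of \<open>g\<close>, with \<open>e\<close> ranging over all of the ambient space: since the energy
  of a curve for \<open>pull g\<close> is the energy of its radial projection for \<open>g\<close>, a curve on the sphere is
  critical for the former iff it is critical for the latter (for radial \<open>e\<close> the equation holds
  identically). Geodesics are parametrized on the whole line with constant speed.\<close>

definition geodesic :: "tensor \<Rightarrow> (real \<Rightarrow> real^3) \<Rightarrow> bool" where
  "geodesic g \<gamma> \<longleftrightarrow>
     (\<forall>t. \<gamma> t \<in> S2) \<and>
     (\<forall>t. \<gamma> differentiable (at t)) \<and>
     (\<forall>t. velocity \<gamma> differentiable (at t)) \<and>
     (\<forall>t e. ((\<lambda>s. pull g (\<gamma> s) (velocity \<gamma> s) e) has_real_derivative
        1/2 * frechet_derivative (\<lambda>x. pull g x (velocity \<gamma> t) (velocity \<gamma> t)) (at (\<gamma> t)) e) (at t))"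

text \<open>\<open>T\<close> is the minimal period of \<open>\<gamma>\<close>; in particular \<open>\<gamma>\<close> is not constant.\<close>

definition closed_geodesic :: "tensor \<Rightarrow> (real \<Rightarrow> real^3) \<Rightarrow> real \<Rightarrow> bool" where
  "closed_geodesic g \<gamma> T \<longleftrightarrow> geodesic g \<gamma> \<and> T > 0 \<and> (\<forall>t. \<gamma> (t + T) = \<gamma> t) \<and>
     (\<forall>s. 0 < s \<and> s < T \<longrightarrow> (\<exists>t. \<gamma> (t + s) \<noteq> \<gamma> t))"

definition curve_length :: "tensor \<Rightarrow> (real \<Rightarrow> real^3) \<Rightarrow> real \<Rightarrow> real" where
  "curve_length g \<gamma> T = integral {0..T} (\<lambda>t. sqrt (g (\<gamma> t) (velocity \<gamma> t) (velocity \<gamma> t)))"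

text \<open>Unoriented closed geodesics are identified with their images.\<close>

definition is_equator :: "tensor \<Rightarrow> (real^3) set \<Rightarrow> bool" where
  "is_equator g C \<longleftrightarrow> (\<exists>\<gamma> T. closed_geodesic g \<gamma> T \<and> C = range \<gamma>) \<and> (\<forall>a. rot a ` C = C)"

definition unique_equator_metrics :: "tensor set" where
  "unique_equator_metrics = {g. riemannian_metric g \<and> S1_invariant g \<and> (\<exists>!C. is_equator g C)}"

definition equator :: "tensor \<Rightarrow> (real^3) set" where
  "equator g = (THE C. is_equator g C)"

definition is_meridian :: "tensor \<Rightarrow> (real \<Rightarrow> real^3) \<Rightarrow> real \<Rightarrow> bool" where
  "is_meridian g \<gamma> T \<longleftrightarrow> closed_geodesic g \<gamma> T \<and> south \<in> range \<gamma> \<and> north \<in> range \<gamma>"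


section \<open>The marked length spectrum\<close>

text \<open>The projection of \<open>\<gamma>\<close> along the \<open>z\<close>-axis, traversed once over the unit interval.\<close>

definition shadow :: "(real \<Rightarrow> real^3) \<Rightarrow> real \<Rightarrow> real \<Rightarrow> complex" where
  "shadow \<gamma> T s = Complex (\<gamma> (s * T) $ 1) (\<gamma> (s * T) $ 2)"

text \<open>Intersections with the equator are counted by parameter values, so that an intersection
  point passed several times is counted with multiplicity. Intersections are automatically
  transverse, by uniqueness of geodesics.\<close>

definition of_type :: "tensor \<Rightarrow> nat \<Rightarrow> nat \<Rightarrow> (real \<Rightarrow> real^3) \<Rightarrow> real \<Rightarrow> bool" where
  "of_type g p q \<gamma> T \<longleftrightarrow>
     closed_geodesic g \<gamma> T \<and> range \<gamma> \<noteq> equator g \<and> \<not> is_meridian g \<gamma> T \<and>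
     norm (winding_number (shadow \<gamma> T) 0) = real p \<and>
     card {t\<in>{0..<T}. \<gamma> t \<in> equator g} = 2 * q"

definition length_set :: "tensor \<Rightarrow> nat \<Rightarrow> nat \<Rightarrow> real set" where
  "length_set g p q = {curve_length g \<gamma> T |\<gamma> T. of_type g p q \<gamma> T}"

definition equator_length :: "tensor \<Rightarrow> real" where
  "equator_length g =
     (THE l. \<exists>\<gamma> T. closed_geodesic g \<gamma> T \<and> range \<gamma> = equator g \<and> l = curve_length g \<gamma> T)"

definition isospectral :: "tensor \<Rightarrow> tensor \<Rightarrow> bool" where
  "isospectral g h \<longleftrightarrow> equator_length g = equator_length h \<and>
     (\<forall>p\<ge>1. \<forall>q\<ge>1. coprime p q \<longrightarrow> length_set g p q = length_set h p q)"


section \<open>Profile functions\<close>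

text \<open>\<open>is_profile g m r\<close> says that \<open>g = d\<sigma>\<^sup>2 + r(\<sigma>)\<^sup>2 d\<theta>\<^sup>2\<close> away from the poles, in the coordinates
  \<open>(\<sigma>, \<theta>) \<mapsto> rot \<theta> (c \<sigma>)\<close> with \<open>0 < \<sigma> < m\<close>: by \<open>S\<^sup>1\<close>-invariance it suffices to evaluate \<open>g\<close> along
  \<open>\<theta> = 0\<close>, where the coordinate fields are \<open>velocity c \<sigma>\<close> and \<open>rot_field (c \<sigma>)\<close>. The curve \<open>c\<close> is a
  unit speed meridian arc between the poles; it need not lie in a half-plane bounded by the
  \<open>z\<close>-axis, since invariance under rotations alone does not force the meridians to be planar.
  The pair of \<open>m\<close> and the restriction of \<open>r\<close> to \<open>{0..m}\<close> is uniquely determined by \<open>g\<close>;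
  the values of \<open>r\<close> elsewhere are irrelevant.\<close>

definition is_profile :: "tensor \<Rightarrow> real \<Rightarrow> (real \<Rightarrow> real) \<Rightarrow> bool" where
  "is_profile g m r \<longleftrightarrow> m > 0 \<and> (\<exists>c.
     continuous_on {0..m} c \<and> c 0 = south \<and> c m = north \<and>
     (\<forall>\<sigma>\<in>{0<..<m}. c \<sigma> \<in> S2 - {south, north} \<and> c differentiable (at \<sigma>) \<and>
        g (c \<sigma>) (velocity c \<sigma>) (velocity c \<sigma>) = 1 \<and>
        g (c \<sigma>) (velocity c \<sigma>) (rot_field (c \<sigma>)) = 0) \<and>
     (\<forall>\<sigma>\<in>{0..m}. r \<sigma> = sqrt (g (c \<sigma>) (rot_field (c \<sigma>)) (rot_field (c \<sigma>)))))"

end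

theory Submission
  imports Defs
begin

text \<open>By Clairaut's relation every geodesic other than the equator and the meridians oscillates about the
  equator, and up to rotation, reflection and speed it is determined by the Clairaut constant
  \<open>h \<in> (0, R)\<close>, where \<open>R\<close> is the radius of the equator. If one oscillation takes length \<open>T h\<close> and
  advances the longitude by \<open>\<Theta> h\<close>, then closed geodesics of type \<open>(p, q)\<close> correspond to solutions of
  \<open>q * \<Theta> h = 2 * pi * p\<close> and have length \<open>q * T h\<close>. So the marked length spectrum consists of \<open>R\<close> and the points
  of the curve \<open>(\<Theta>, T)\<close> with rational first coordinate \<open>\<Theta> / (2 * pi)\<close>.

  Since \<open>S = T - h * \<Theta>\<close> satisfies \<open>S' = - \<Theta>\<close>, this curve is a front whose slope at the parameter \<open>h\<close> is \<open>h\<close>.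
  At regular points the slope, and hence \<open>h\<close>, is recovered from the rational points nearby; critical
  values are negligible by Sard's theorem. Hence two such fronts with the same rational points have the
  same function \<open>\<Theta>\<close>, unless both \<open>\<Theta>\<close> are constant. Abel inversion of \<open>\<Theta>\<close> yields the arc
  length of the meridian as a function of the radius on one hemisphere, up to a factor in the constant
  case, which is fixed by the behaviour at the pole. By reflection this is the whole profile.\<close>

section \<open>Functions determined by a front\<close>

text \<open>Two obstacles shape the comparison of fronts. The advance \<open>Theta\<close> need be
  neither monotone nor immersed, so a point of one front can be matched to a far away parameter of
  the other, or to parameters running into an end of the interval; the limits of the action at both
  ends serve to exclude the latter. And a constant \<open>Theta\<close> shows at most one vertical
  piece of the spectrum, or nothing at all if the constant is irrational, so that the two constants
  cannot be compared directly.

  On the geometric side the turning points are the obstacle. Energy and momentum alone also admit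
  curves that rest for a while on a turning parallel, and the first order equation for the latitude
  degenerates there. The phase removes the degeneracy, and the component of the geodesic equation
  along the axis excludes resting. Curves are therefore known off the turning times first, and the
  formulas pass to the turning times by limits of derivatives.\<close>

lemma negligible_critical_values:
  fixes f :: "real \<Rightarrow> real"
  assumes "\<And>x. x \<in> S \<Longrightarrow> (f has_real_derivative 0) (at x)"
  shows "negligible (f ` S)"
proof -
  \<comment> \<open>In \<open>real^1\<close> a vanishing derivative has matrix 0, whose rank is
    below the dimension, which is the form of Sard's theorem that \<open>baby_Sard\<close>
    provides.\<close>
  define F :: "real^1 \<Rightarrow> real^1" where "F = (\<lambda>v. vec (f (v $ 1)))"
  have der: "(F has_derivative (\<lambda>v. 0)) (at v within vec ` S)" if v: "v \<in> vec ` S" for v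
  proof -
    have "(f has_real_derivative 0) (at (v $ 1))"
      using assms v by auto
    then have f: "(f has_derivative (\<lambda>h. 0)) (at (v $ 1))"
      by (simp add: has_field_derivative_def lambda_zero)
    have p: "((\<lambda>v::real^1. v $ 1) has_derivative (\<lambda>v. v $ 1)) (at v)"
      by (intro bounded_linear_imp_has_derivative bounded_linear_vec_nth)
    have *: "((\<lambda>v. f (v $ 1)) has_derivative (\<lambda>v. 0)) (at v)"
      using has_derivative_compose[OF p f] .
    have "bounded_linear (vec :: real \<Rightarrow> real^1)"
      by (simp add: linear_conv_bounded_linear[symmetric])
    from bounded_linear.has_derivative[OF this *]
    have "((\<lambda>v. vec (f (v $ 1)) :: real^1) has_derivative (\<lambda>v. vec 0)) (at v)" .
    then show ?thesis
      unfolding F_def by (auto intro: has_derivative_at_withinI simp: vec_0)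
  qed
  have "negligible (F ` vec ` S)"
  proof (rule baby_Sard[OF _ der])
    have "matrix (\<lambda>v::real^1. 0 :: real^1) = 0"
      by (simp add: matrix_def vec_eq_iff)
    then show "rank (matrix (\<lambda>v::real^1. 0 :: real^1)) < CARD(1)"
      by simp
  qed auto
  then have "negligible ((\<lambda>v::real^1. v $ 1) ` (F ` vec ` S))"
    by (rule negligible_differentiable_image_negligible[rotated])
      (auto intro!: linear_imp_differentiable_on linearI)
  then show ?thesis
    by (simp add: F_def image_image)
qed

text \<open>Near a point of the level set with nonzero derivative the difference quotient stays away
  from 0, so the point is isolated; a set of reals all of whose points are isolated is
  countable.\<close>

lemma countable_simple_zeros:
  fixes f :: "real \<Rightarrow> real"
  shows "countable {x. f x = c \<and> (\<exists>d. d \<noteq> 0 \<and> (f has_real_derivative d) (at x))}" (is "countable ?Z")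
proof -
  have "\<not> x islimpt ?Z" if x: "x \<in> ?Z" for x
  proof -
    from x obtain d where d: "d \<noteq> 0" "(f has_real_derivative d) (at x)" "f x = c" by auto
  have "((\<lambda>y. (f y - f x) / (y - x)) \<longlongrightarrow> d) (at x)"
    using d(2) by (simp add: has_field_derivative_iff)
  then have "\<forall>\<^sub>F y in at x. (f y - f x) / (y - x) \<noteq> 0"
    using d(1) by (rule tendsto_imp_eventually_ne)
  then have "\<forall>\<^sub>F y in at x. y \<notin> ?Z"
    by eventually_elim (use d in auto)
  then show ?thesis
    by (simp add: islimpt_iff_eventually)
  qed
  then have sub: "- {x. x islimpt ?Z} \<inter> ?Z = ?Z" by auto
  \<comment> \<open>The complement of the derived set is open and contains all of \<open>?Z\<close>,
    and there \<open>?Z\<close> has no limit point.\<close>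
  define D where "D = - {x. x islimpt ?Z}"
  have "open D"
    using closed_limpts unfolding D_def by (rule open_Compl)
  moreover have "?Z sparse_in D"
    unfolding sparse_in_def
  proof
    fix x assume "x \<in> D"
    then show "\<exists>B. x \<in> B \<and> open B \<and> (\<forall>y\<in>B. \<not> y islimpt ?Z)"
      using \<open>open D\<close> by (intro exI[of _ D]) (simp add: D_def)
  qed
  ultimately have "countable (D \<inter> ?Z)"
    by (rule sparse_imp_countable)
  then show ?thesis using sub by (simp only: D_def)
qed

text \<open>The map \<open>h \<mapsto> (\<Theta> h, S h + h * \<Theta> h)\<close> is a planar front whose tangent at the parameter \<open>h\<close>
  has slope \<open>h\<close>; hence the parameter can be recovered from the image at regular points.\<close>

lemma front_slope_unique:
  fixes R h0 d1 l2 :: real and S1 S2 \<Theta>1 \<Theta>2 :: "real \<Rightarrow> real"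
  assumes S1: "\<And>h. h \<in> {0<..<R} \<Longrightarrow> (S1 has_real_derivative - \<Theta>1 h) (at h)"
    and S2: "\<And>h. h \<in> {0<..<R} \<Longrightarrow> (S2 has_real_derivative - \<Theta>2 h) (at h)"
    and D1: "\<And>h. h \<in> {0<..<R} \<Longrightarrow> \<Theta>1 differentiable (at h)"
    and D2: "\<And>h. h \<in> {0<..<R} \<Longrightarrow> \<Theta>2 differentiable (at h)"
    and S20: "(S2 \<longlongrightarrow> l2) (at_right 0)" and S2R: "(S2 \<longlongrightarrow> 0) (at_left R)"
    and spec: "\<And>h. h \<in> {0<..<R} \<Longrightarrow> \<Theta>1 h / (2 * pi) \<in> \<rat> \<Longrightarrow>
      \<exists>k\<in>{0<..<R}. \<Theta>2 k = \<Theta>1 h \<and> S2 k + k * \<Theta>2 k = S1 h + h * \<Theta>1 h"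
    and h0: "h0 \<in> {0<..<R}" and d1: "(\<Theta>1 has_real_derivative d1) (at h0)" "d1 \<noteq> 0"
    and nl: "S1 h0 + h0 * \<Theta>1 h0 \<noteq> l2"
    and nR: "S1 h0 + h0 * \<Theta>1 h0 - R * \<Theta>1 h0 \<noteq> 0"
    and reg: "\<And>k. k \<in> {0<..<R} \<Longrightarrow> \<Theta>2 k = \<Theta>1 h0 \<Longrightarrow> \<not> (\<Theta>2 has_real_derivative 0) (at k)"
  shows "\<Theta>2 h0 = \<Theta>1 h0"
proof -
  define T1 where "T1 = (\<lambda>h. S1 h + h * \<Theta>1 h)"
  define T2 where "T2 = (\<lambda>h. S2 h + h * \<Theta>2 h)"
  have c1: "isCont \<Theta>1 h" if "h \<in> {0<..<R}" for h
    using D1[OF that] by (simp add: differentiable_imp_continuous_within)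
  have c2: "isCont \<Theta>2 h" if "h \<in> {0<..<R}" for h
    using D2[OF that] by (simp add: differentiable_imp_continuous_within)
  have T1': "(T1 has_real_derivative h0 * d1) (at h0)"
    unfolding T1_def using S1[OF h0] d1(1) by (auto intro!: derivative_eq_intros)
  \<comment> \<open>A nonzero derivative makes \<open>\<Theta>1\<close> leave its value at
    \<open>h0\<close>, so by the intermediate value theorem it passes through rational multiples of
    \<open>2 * pi\<close> different from that value, arbitrarily close to \<open>h0\<close>.\<close>
  have "\<exists>x. x \<in> {0<..<R} \<and> \<bar>x - h0\<bar> < 1 / Suc n \<and> \<Theta>1 x / (2 * pi) \<in> \<rat> \<and> \<Theta>1 x \<noteq> \<Theta>1 h0" for n :: nat
  proof -
    have "((\<lambda>y. (\<Theta>1 y - \<Theta>1 h0) / (y - h0)) \<longlongrightarrow> d1) (at h0)"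
      using d1(1) by (simp add: has_field_derivative_iff)
    then have "\<forall>\<^sub>F y in at h0. (\<Theta>1 y - \<Theta>1 h0) / (y - h0) \<noteq> 0"
      using d1(2) by (rule tendsto_imp_eventually_ne)
    then obtain e where e: "e > 0" "\<And>y. y \<noteq> h0 \<Longrightarrow> \<bar>y - h0\<bar> < e \<Longrightarrow> \<Theta>1 y \<noteq> \<Theta>1 h0"
      by (auto simp: eventually_at dist_real_def)
    obtain y where y: "h0 < y" "y < h0 + e" "y < h0 + 1 / Suc n" "y < R"
    proof -
      have "h0 < min (h0 + e) (min (h0 + 1 / Suc n) R)" using e h0 by auto
      then obtain y where "h0 < y" "y < min (h0 + e) (min (h0 + 1 / Suc n) R)" using dense by blast
      then show ?thesis using that[of y] by linarith
    qed
    have ne: "\<Theta>1 y \<noteq> \<Theta>1 h0" using e(2)[of y] y by auto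
    have cont: "continuous_on {h0..y} \<Theta>1"
      using c1 h0 y by (intro continuous_at_imp_continuous_on) auto
    obtain v where v: "v \<in> \<rat>" "min (\<Theta>1 h0) (\<Theta>1 y) / (2*pi) < v" "v < max (\<Theta>1 h0) (\<Theta>1 y) / (2*pi)"
      using Rats_dense_in_real[of "min (\<Theta>1 h0) (\<Theta>1 y) / (2*pi)" "max (\<Theta>1 h0) (\<Theta>1 y) / (2*pi)"] ne
      by (auto simp: divide_strict_right_mono min_def max_def)
    have v': "min (\<Theta>1 h0) (\<Theta>1 y) < v * (2*pi)" "v * (2*pi) < max (\<Theta>1 h0) (\<Theta>1 y)"
      using v(2,3) by (simp_all add: field_simps)
    have "\<exists>x. h0 \<le> x \<and> x \<le> y \<and> \<Theta>1 x = v * (2*pi)"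
    proof (cases "\<Theta>1 h0 \<le> \<Theta>1 y")
      case True
      then show ?thesis using IVT'[of "\<Theta>1" h0 "v * (2 * pi)" y] cont v' y by auto
    next
      case False
      then show ?thesis using IVT2'[of "\<Theta>1" y "v * (2 * pi)" h0] cont v' y by auto
    qed
    then obtain x where x: "h0 \<le> x" "x \<le> y" "\<Theta>1 x = v * (2*pi)" by auto
    have "\<Theta>1 x \<noteq> \<Theta>1 h0" using x v' by auto
    then show ?thesis
      using x y h0 v(1) by (intro exI[of _ x]) auto
  qed
  then obtain x where x: "\<And>n. x n \<in> {0<..<R}" "\<And>n. \<bar>x n - h0\<bar> < 1 / Suc n"
    "\<And>n. \<Theta>1 (x n) / (2 * pi) \<in> \<rat>" "\<And>n. \<Theta>1 (x n) \<noteq> \<Theta>1 h0"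
    by metis
  have xlim: "x \<longlonglongrightarrow> h0"
  proof (rule LIM_zero_cancel, rule Lim_null_comparison)
    show "\<forall>\<^sub>F n in sequentially. norm (x n - h0) \<le> 1 / Suc n"
      using x(2) by (auto intro!: always_eventually less_imp_le)
    show "(\<lambda>n. 1 / real (Suc n)) \<longlonglongrightarrow> 0"
      using LIMSEQ_inverse_real_of_nat by (simp add: inverse_eq_divide)
  qed
  have "\<exists>k. k \<in> {0<..<R} \<and> \<Theta>2 k = \<Theta>1 (x n) \<and> T2 k = T1 (x n)" for n
    using spec[OF x(1) x(3)] unfolding T1_def T2_def by blast
  then obtain y where y: "\<And>n. y n \<in> {0<..<R}" "\<And>n. \<Theta>2 (y n) = \<Theta>1 (x n)" "\<And>n. T2 (y n) = T1 (x n)"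
    by metis
  \<comment> \<open>The partners on the second front may jump about in the open interval; along a
    subsequence they converge in the closed one, and both ends have to be ruled out.\<close>
  have "seq_compact {0..R}" using compact_Icc compact_imp_seq_compact by blast
  moreover have "\<forall>n. y n \<in> {0..R}" using y(1) by (auto simp: less_imp_le)
  ultimately obtain l \<sigma> where l: "l \<in> {0..R}" "strict_mono \<sigma>" "(y \<circ> \<sigma>) \<longlonglongrightarrow> l"
    unfolding seq_compact_def by blast
  define X where "X = x \<circ> \<sigma>"
  define Y where "Y = y \<circ> \<sigma>"
  have X: "\<And>n. X n \<in> {0<..<R}" "\<And>n. \<Theta>1 (X n) \<noteq> \<Theta>1 h0" "X \<longlonglongrightarrow> h0"
    using x xlim l(2) by (auto simp: X_def intro: LIMSEQ_subseq_LIMSEQ)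
  have Y: "\<And>n. Y n \<in> {0<..<R}" "\<And>n. \<Theta>2 (Y n) = \<Theta>1 (X n)" "\<And>n. T2 (Y n) = T1 (X n)" "Y \<longlonglongrightarrow> l"
    using y l(3) by (auto simp: X_def Y_def)
  have \<Theta>lim: "(\<lambda>n. \<Theta>1 (X n)) \<longlonglongrightarrow> \<Theta>1 h0"
    using isCont_tendsto_compose[OF c1[OF h0] X(3)] .
  have Tlim: "(\<lambda>n. T1 (X n)) \<longlonglongrightarrow> T1 h0"
    using isCont_tendsto_compose[OF DERIV_isCont[OF T1'] X(3)] .
  \<comment> \<open>At the parameter 0 the term \<open>h * \<Theta>2 h\<close> dies out because
    \<open>\<Theta>2\<close> at the partners equals \<open>\<Theta>1 (X n)\<close>, which converges;
    only \<open>l2\<close> is left, against \<open>nl\<close>.\<close>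
  have "l \<noteq> 0"
  proof
    assume "l = 0"
    then have "filterlim Y (at_right 0) sequentially"
      using Y(1,4) by (auto simp: filterlim_at intro!: always_eventually less_imp_neq[THEN not_sym])
    then have "(\<lambda>n. S2 (Y n)) \<longlonglongrightarrow> l2" by (rule filterlim_compose[OF S20])
    then have "(\<lambda>n. S2 (Y n) + Y n * \<Theta>1 (X n)) \<longlonglongrightarrow> l2 + 0 * \<Theta>1 h0"
      using Y(4) \<open>l = 0\<close> \<Theta>lim by (intro tendsto_intros) auto
    then have "(\<lambda>n. T1 (X n)) \<longlonglongrightarrow> l2"
      using Y(2,3) by (simp add: T2_def)
    with Tlim have "T1 h0 = l2" by (rule LIMSEQ_unique)
    with nl show False by (simp add: T1_def)
  qed
  \<comment> \<open>At \<open>R\<close> the action tends to 0, so the second coordinate would tend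
    to \<open>R * \<Theta>1 h0\<close>, against \<open>nR\<close>.\<close>
  moreover have "l \<noteq> R"
  proof
    assume "l = R"
    then have "filterlim Y (at_left R) sequentially"
      using Y(1,4) by (auto simp: filterlim_at intro!: always_eventually less_imp_neq)
    then have "(\<lambda>n. S2 (Y n)) \<longlonglongrightarrow> 0" by (rule filterlim_compose[OF S2R])
    then have "(\<lambda>n. S2 (Y n) + Y n * \<Theta>1 (X n)) \<longlonglongrightarrow> 0 + R * \<Theta>1 h0"
      using Y(4) \<open>l = R\<close> \<Theta>lim by (intro tendsto_intros) auto
    then have "(\<lambda>n. T1 (X n)) \<longlonglongrightarrow> R * \<Theta>1 h0"
      using Y(2,3) by (simp add: T2_def)
    with Tlim have "T1 h0 = R * \<Theta>1 h0" by (rule LIMSEQ_unique)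
    with nR show False by (simp add: T1_def)
  qed
  ultimately have lI: "l \<in> {0<..<R}" using l(1) by auto
  have "(\<lambda>n. \<Theta>2 (Y n)) \<longlonglongrightarrow> \<Theta>2 l"
    using isCont_tendsto_compose[OF c2[OF lI] Y(4)] .
  with \<Theta>lim Y(2) have \<Theta>2l: "\<Theta>2 l = \<Theta>1 h0"
    using LIMSEQ_unique by (metis (no_types, lifting) ext)
  obtain d2 where d2: "(\<Theta>2 has_real_derivative d2) (at l)"
    using D2[OF lI] real_differentiable_def by blast
  then have "d2 \<noteq> 0" using reg[OF lI \<Theta>2l] by auto
  have T2': "(T2 has_real_derivative l * d2) (at l)"
    unfolding T2_def using S2[OF lI] d2 by (auto intro!: derivative_eq_intros)
  have T2l: "T2 l = T1 h0"
    using isCont_tendsto_compose[OF DERIV_isCont[OF T2'] Y(4)] Tlim Y(3) LIMSEQ_unique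
    by (metis (no_types, lifting) ext)
  have Xne: "X n \<noteq> h0" and Yne: "Y n \<noteq> l" for n
    using X(2)[of n] Y(2)[of n] \<Theta>2l by auto
  have Xat: "filterlim X (at h0) sequentially" using X(3) Xne by (simp add: filterlim_at)
  have Yat: "filterlim Y (at l) sequentially"
    using Y(4) Yne by (simp add: filterlim_at)
  \<comment> \<open>Both fronts have the same chords along the sequence. As
    \<open>T' = h * \<Theta>'\<close>, the slopes of these chords tend to \<open>h0\<close> on the
    first front and to \<open>l\<close> on the second, whence \<open>h0 = l\<close>.\<close>
  have q1: "(\<lambda>n. ((T1 (X n) - T1 h0) / (X n - h0)) / ((\<Theta>1 (X n) - \<Theta>1 h0) / (X n - h0))) \<longlonglongrightarrow> h0 * d1 / d1"
    using T1' d1 by (intro tendsto_divide filterlim_compose[OF _ Xat, of "\<lambda>y. (T1 y - T1 h0) / (y - h0)"]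
        filterlim_compose[OF _ Xat, of "\<lambda>y. (\<Theta>1 y - \<Theta>1 h0) / (y - h0)"]) (auto simp: has_field_derivative_iff)
  have q2: "(\<lambda>n. ((T2 (Y n) - T2 l) / (Y n - l)) / ((\<Theta>2 (Y n) - \<Theta>2 l) / (Y n - l))) \<longlonglongrightarrow> l * d2 / d2"
    using T2' d2 \<open>d2 \<noteq> 0\<close> by (intro tendsto_divide filterlim_compose[OF _ Yat, of "\<lambda>y. (T2 y - T2 l) / (y - l)"]
        filterlim_compose[OF _ Yat, of "\<lambda>y. (\<Theta>2 y - \<Theta>2 l) / (y - l)"]) (auto simp: has_field_derivative_iff)
  have "((T1 (X n) - T1 h0) / (X n - h0)) / ((\<Theta>1 (X n) - \<Theta>1 h0) / (X n - h0)) =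
    ((T2 (Y n) - T2 l) / (Y n - l)) / ((\<Theta>2 (Y n) - \<Theta>2 l) / (Y n - l))" for n
    using Y(2)[of n] Y(3)[of n] T2l \<Theta>2l Xne[of n] Yne[of n] by simp
  with q1 q2 have "h0 * d1 / d1 = l * d2 / d2"
    using LIMSEQ_unique by (metis (no_types, lifting) ext)
  with d1(2) \<open>d2 \<noteq> 0\<close> have "h0 = l" by simp
  with \<Theta>2l show ?thesis by simp
qed

text \<open>Two different values of \<open>\<Theta>1\<close> would give a whole interval of values,
  and almost every one of them meets the assumptions of \<open>front_slope_unique\<close>, which
  makes \<open>\<Theta>1\<close> and \<open>\<Theta>2\<close> agree at some parameter of the
  interval.\<close>

lemma front_constant_where_different:
  fixes R l2 :: real and S1 S2 \<Theta>1 \<Theta>2 :: "real \<Rightarrow> real"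
  assumes S1: "\<And>h. h \<in> {0<..<R} \<Longrightarrow> (S1 has_real_derivative - \<Theta>1 h) (at h)"
    and S2: "\<And>h. h \<in> {0<..<R} \<Longrightarrow> (S2 has_real_derivative - \<Theta>2 h) (at h)"
    and D1: "\<And>h. h \<in> {0<..<R} \<Longrightarrow> \<Theta>1 differentiable (at h)"
    and D2: "\<And>h. h \<in> {0<..<R} \<Longrightarrow> \<Theta>2 differentiable (at h)"
    and S20: "(S2 \<longlongrightarrow> l2) (at_right 0)" and S2R: "(S2 \<longlongrightarrow> 0) (at_left R)"
    and spec: "\<And>h. h \<in> {0<..<R} \<Longrightarrow> \<Theta>1 h / (2 * pi) \<in> \<rat> \<Longrightarrow>
      \<exists>k\<in>{0<..<R}. \<Theta>2 k = \<Theta>1 h \<and> S2 k + k * \<Theta>2 k = S1 h + h * \<Theta>1 h"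
    and I: "{x..y} \<subseteq> {0<..<R}" "x \<le> y"
    and ne: "\<And>h. h \<in> {x..y} \<Longrightarrow> \<Theta>1 h \<noteq> \<Theta>2 h"
  shows "\<Theta>1 x = \<Theta>1 y"
proof (rule ccontr)
  assume xy: "\<Theta>1 x \<noteq> \<Theta>1 y"
  \<comment> \<open>The exceptional values: critical values of either function, and values attained
    where \<open>T1\<close> meets \<open>l2\<close> or \<open>U\<close> meets 0. The latter two are
    countable, because at regular parameters \<open>T1' = h * \<Theta>1'\<close> and
    \<open>U' = (h - R) * \<Theta>1'\<close> do not vanish.\<close>
  define N1 where "N1 = \<Theta>1 ` {h. (\<Theta>1 has_real_derivative 0) (at h)}"
  define N2 where "N2 = \<Theta>2 ` {h. (\<Theta>2 has_real_derivative 0) (at h)}"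
  define T1 where "T1 = (\<lambda>h. S1 h + h * \<Theta>1 h)"
  define N3 where "N3 = \<Theta>1 ` {h. T1 h = l2 \<and> (\<exists>d. d \<noteq> 0 \<and> (T1 has_real_derivative d) (at h))}"
  define U where "U = (\<lambda>h. T1 h - R * \<Theta>1 h)"
  define N4 where "N4 = \<Theta>1 ` {h. U h = 0 \<and> (\<exists>d. d \<noteq> 0 \<and> (U has_real_derivative d) (at h))}"
  have "negligible N1" "negligible N2"
    unfolding N1_def N2_def by (rule negligible_critical_values; simp)+
  moreover have "countable N3" "countable N4"
    unfolding N3_def N4_def by (intro countable_image countable_simple_zeros)+
  ultimately have neg: "negligible (N1 \<union> N2 \<union> N3 \<union> N4)"
    by (intro negligible_Un) (auto simp: negligible_iff_null_sets null_sets_completionI countable_imp_null_set_lborel)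
  have sub: "{min (\<Theta>1 x) (\<Theta>1 y) .. max (\<Theta>1 x) (\<Theta>1 y)} \<subseteq> N1 \<union> N2 \<union> N3 \<union> N4"
  proof
    fix v assume v: "v \<in> {min (\<Theta>1 x) (\<Theta>1 y) .. max (\<Theta>1 x) (\<Theta>1 y)}"
    have cont: "continuous_on {x..y} \<Theta>1"
      using D1 I by (intro continuous_at_imp_continuous_on ballI differentiable_imp_continuous_within) auto
    have "\<exists>h. x \<le> h \<and> h \<le> y \<and> \<Theta>1 h = v"
    proof (cases "\<Theta>1 x \<le> \<Theta>1 y")
      case True
      then show ?thesis using IVT'[of "\<Theta>1" x v y] cont v I by auto
    next
      case False
      then show ?thesis using IVT2'[of "\<Theta>1" y v x] cont v I by auto
    qed
    then obtain h where h: "h \<in> {x..y}" "\<Theta>1 h = v" by auto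
    have hR: "h \<in> {0<..<R}" using h I by blast
    obtain d where d: "(\<Theta>1 has_real_derivative d) (at h)"
      using D1[OF hR] real_differentiable_def by blast
    show "v \<in> N1 \<union> N2 \<union> N3 \<union> N4"
    proof (rule ccontr)
      assume nv: "v \<notin> N1 \<union> N2 \<union> N3 \<union> N4"
      have d0: "d \<noteq> 0" using nv h d unfolding N1_def by auto
      have T1': "(T1 has_real_derivative h * d) (at h)"
        unfolding T1_def using S1[OF hR] d by (auto intro!: derivative_eq_intros)
      have U': "(U has_real_derivative h * d - R * d) (at h)"
        unfolding U_def using T1' d by (auto intro!: derivative_eq_intros)
      have "T1 h \<noteq> l2"
      proof
        assume "T1 h = l2"
        moreover have "h * d \<noteq> 0" using hR d0 by auto
        ultimately have "v \<in> N3" using T1' h unfolding N3_def by blast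
        with nv show False by simp
      qed
      moreover have "U h \<noteq> 0"
      proof
        assume "U h = 0"
        moreover have "h * d - R * d \<noteq> 0" using hR d0 by auto
        ultimately have "v \<in> N4" using U' h unfolding N4_def by blast
        with nv show False by simp
      qed
      moreover have "\<not> (\<Theta>2 has_real_derivative 0) (at k)" if "\<Theta>2 k = \<Theta>1 h" for k
        using nv h that unfolding N2_def by (metis (mono_tags, lifting) UnI1 UnI2 imageI mem_Collect_eq)
      ultimately have "\<Theta>2 h = \<Theta>1 h"
        unfolding T1_def U_def
        by (intro front_slope_unique[OF S1 S2 D1 D2 S20 S2R spec hR d d0]) auto
      with ne h(1) show False by force
    qed
  qed
  have "negligible {min (\<Theta>1 x) (\<Theta>1 y) .. max (\<Theta>1 x) (\<Theta>1 y)}"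
    using negligible_subset[OF neg sub] .
  then show False
    using xy negligible_interval(1)[of "min (\<Theta>1 x) (\<Theta>1 y)" "max (\<Theta>1 x) (\<Theta>1 y)"]
    by (auto simp: min_def max_def split: if_splits)
qed

text \<open>Where the two functions differ they are locally constant, by
  \<open>front_constant_where_different\<close> applied in both directions. So the set on which they
  take one given pair of distinct values is open and closed in a connected interval: it is empty or
  everything.\<close>

theorem front_determined:
  fixes R l1 l2 :: real and S1 S2 \<Theta>1 \<Theta>2 :: "real \<Rightarrow> real"
  assumes S1: "\<And>h. h \<in> {0<..<R} \<Longrightarrow> (S1 has_real_derivative - \<Theta>1 h) (at h)"
    and S2: "\<And>h. h \<in> {0<..<R} \<Longrightarrow> (S2 has_real_derivative - \<Theta>2 h) (at h)"
    and D1: "\<And>h. h \<in> {0<..<R} \<Longrightarrow> \<Theta>1 differentiable (at h)"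
    and D2: "\<And>h. h \<in> {0<..<R} \<Longrightarrow> \<Theta>2 differentiable (at h)"
    and lim1: "(S1 \<longlongrightarrow> l1) (at_right 0)" "(S1 \<longlongrightarrow> 0) (at_left R)"
    and lim2: "(S2 \<longlongrightarrow> l2) (at_right 0)" "(S2 \<longlongrightarrow> 0) (at_left R)"
    and spec12: "\<And>h. h \<in> {0<..<R} \<Longrightarrow> \<Theta>1 h / (2 * pi) \<in> \<rat> \<Longrightarrow>
      \<exists>k\<in>{0<..<R}. \<Theta>2 k = \<Theta>1 h \<and> S2 k + k * \<Theta>2 k = S1 h + h * \<Theta>1 h"
    and spec21: "\<And>h. h \<in> {0<..<R} \<Longrightarrow> \<Theta>2 h / (2 * pi) \<in> \<rat> \<Longrightarrow>
      \<exists>k\<in>{0<..<R}. \<Theta>1 k = \<Theta>2 h \<and> S1 k + k * \<Theta>1 k = S2 h + h * \<Theta>2 h"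
  shows "(\<forall>h\<in>{0<..<R}. \<Theta>1 h = \<Theta>2 h) \<or> (\<exists>c1 c2. \<forall>h\<in>{0<..<R}. \<Theta>1 h = c1 \<and> \<Theta>2 h = c2)"
proof (rule disjCI)
  assume "\<not> (\<exists>c1 c2. \<forall>h\<in>{0<..<R}. \<Theta>1 h = c1 \<and> \<Theta>2 h = c2)"
  show "\<forall>h\<in>{0<..<R}. \<Theta>1 h = \<Theta>2 h"
  proof (rule ccontr)
  assume "\<not> (\<forall>h\<in>{0<..<R}. \<Theta>1 h = \<Theta>2 h)"
  then obtain h0 where h0: "h0 \<in> {0<..<R}" "\<Theta>1 h0 \<noteq> \<Theta>2 h0" by blast
  have cont: "continuous_on {0<..<R} \<Theta>1" "continuous_on {0<..<R} \<Theta>2"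
    using D1 D2 by (auto intro!: continuous_at_imp_continuous_on differentiable_imp_continuous_within)
  define f where "f = (\<lambda>h. (\<Theta>1 h, \<Theta>2 h))"
  have contf: "continuous_on {0<..<R} f" unfolding f_def by (intro continuous_intros cont)
  have const: "f h = f k" if hk: "h \<le> k" "{h..k} \<subseteq> {0<..<R}" "\<And>x. x \<in> {h..k} \<Longrightarrow> \<Theta>1 x \<noteq> \<Theta>2 x" for h k
    using front_constant_where_different[OF S1 S2 D1 D2 lim2 spec12, of h k]
      front_constant_where_different[OF S2 S1 D2 D1 lim1 spec21, of h k] hk
    by (force simp: f_def)
  define V where "V = {0<..<R} \<inter> f -` {f h0}"
  have "openin (top_of_set {0<..<R}) V"
  proof -
    show ?thesis
    proof (subst openin_contains_ball, intro conjI ballI)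
      fix h assume h: "h \<in> V"
      then have hR: "h \<in> {0<..<R}" and hne: "\<Theta>1 h \<noteq> \<Theta>2 h" using h0 by (auto simp: V_def f_def)
      have "open ({0<..<R} \<inter> (\<lambda>h. \<Theta>1 h - \<Theta>2 h) -` (- {0}))"
        by (rule continuous_open_preimage) (auto intro!: continuous_intros cont)
      moreover have "h \<in> {0<..<R} \<inter> (\<lambda>h. \<Theta>1 h - \<Theta>2 h) -` (- {0})" using hR hne by auto
      ultimately obtain e where e: "e > 0" "ball h e \<subseteq> {0<..<R} \<inter> (\<lambda>h. \<Theta>1 h - \<Theta>2 h) -` (- {0})"
        by (meson open_contains_ball)
      have "k \<in> V" if k: "k \<in> ball h e" for k
      proof -
        have sub: "{min h k..max h k} \<subseteq> ball h e" using k e(1) by (auto simp: dist_real_def)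
        have sub': "{min h k..max h k} \<subseteq> {0<..<R}" using sub e(2) by blast
        have "f (min h k) = f (max h k)"
        proof (rule const)
          show "\<Theta>1 x \<noteq> \<Theta>2 x" if "x \<in> {min h k..max h k}" for x
            using subsetD[OF sub that] e(2) by auto
        qed (use sub' in auto)
        then have "f k = f h" by (auto simp: min_def max_def split: if_splits)
        then show ?thesis using h k e(2) by (auto simp: V_def)
      qed
      then show "\<exists>e>0. ball h e \<inter> {0<..<R} \<subseteq> V" using e(1) by blast
    qed (auto simp: V_def)
  qed
  moreover have "closedin (top_of_set {0<..<R}) V"
    unfolding V_def by (rule continuous_closedin_preimage[OF contf]) auto
  moreover have "connected {0<..<R}" by simp
  moreover have "V \<noteq> {}" using h0 by (auto simp: V_def)
  ultimately have "V = {0<..<R}" by (metis connected_clopen)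
  then have "\<forall>h\<in>{0<..<R}. \<Theta>1 h = \<Theta>1 h0 \<and> \<Theta>2 h = \<Theta>2 h0"
    by (auto simp: V_def f_def)
  with \<open>\<not> (\<exists>c1 c2. \<forall>h\<in>{0<..<R}. \<Theta>1 h = c1 \<and> \<Theta>2 h = c2)\<close> show False by blast
  qed
qed

section \<open>Profile functions and their period integrals\<close>

lemma continuous_antiderivative:
  fixes f :: "real \<Rightarrow> real"
  assumes "continuous_on UNIV f"
  obtains F where "\<And>x. (F has_real_derivative f x) (at x)" "F 0 = 0"
proof
  show "((\<lambda>u. LBINT y=ereal 0..ereal u. f y) has_real_derivative f x) (at x)" for x
  proof -
    define a where "a = min 0 x - 1"
    define b where "b = max 0 x + 1"
    have "((\<lambda>u. LBINT y=ereal 0..ereal u. f y) has_vector_derivative f x) (at x within {a..b})"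
      by (rule interval_integral_FTC2)
        (auto simp: a_def b_def min_def max_def intro: continuous_on_subset[OF assms])
    moreover have "a < x" "x < b" by (auto simp: a_def b_def)
    ultimately show ?thesis
      by (simp add: at_within_Icc_at has_real_derivative_iff_has_vector_derivative)
  qed
qed (simp add: zero_ereal_def[symmetric])

text \<open>Needed for integrands such as the Abel kernel, which blow up at the ends of the interval
  while their primitive remains continuous there.\<close>

lemma nn_integral_FTC_interior:
  fixes f F :: "real \<Rightarrow> real"
  assumes "a \<le> b" and f: "f \<in> borel_measurable borel" and nonneg: "\<And>x. x \<in> {a..b} \<Longrightarrow> 0 \<le> f x"
    and cont: "continuous_on {a..b} F"
    and der: "\<And>x. x \<in> {a<..<b} \<Longrightarrow> (F has_real_derivative f x) (at x)"
  shows "(\<integral>\<^sup>+x. ennreal (f x) * indicator {a..b} x \<partial>lborel) = ennreal (F b - F a)"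
proof -
  have "(f has_integral F b - F a) {a..b}"
    using assms by (intro fundamental_theorem_of_calculus_interior)
      (auto simp: has_real_derivative_iff_has_vector_derivative)
  then have "((\<lambda>x. if x \<in> {a..b} then f x else 0) has_integral F b - F a) UNIV"
    by (simp only: has_integral_restrict_UNIV)
  then have "integral\<^sup>N lborel (\<lambda>x. ennreal (if x \<in> {a..b} then f x else 0)) = ennreal (F b - F a)"
    using nonneg f by (intro nn_integral_has_integral_lborel) auto
  moreover have "ennreal (if x \<in> {a..b} then f x else 0) = ennreal (f x) * indicator {a..b} x" for x
    by (auto split: split_indicator)
  ultimately show ?thesis by simp
qed

lemma nn_integral_continuous_Icc:
  fixes f :: "real \<Rightarrow> real"
  assumes cont: "continuous_on {a..b} f" and nonneg: "\<And>x. x \<in> {a..b} \<Longrightarrow> 0 \<le> f x"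
  shows "(\<integral>\<^sup>+x. ennreal (f x) * indicator {a..b} x \<partial>lborel) = ennreal (integral {a..b} f)"
proof -
  have "(f has_integral integral {a..b} f) {a..b}"
    using cont integrable_continuous_interval by blast
  then have "((\<lambda>x. if x \<in> {a..b} then f x else 0) has_integral integral {a..b} f) UNIV"
    by (simp only: has_integral_restrict_UNIV)
  moreover have "(\<lambda>x. if x \<in> {a..b} then f x else 0) = (\<lambda>x. indicator {a..b} x *\<^sub>R f x)"
    by (auto split: split_indicator)
  moreover have "(\<lambda>x. indicator {a..b} x *\<^sub>R f x) \<in> borel_measurable borel"
    by (rule borel_measurable_continuous_on_indicator[OF _ cont]) auto
  ultimately have "integral\<^sup>N lborel (\<lambda>x. ennreal (if x \<in> {a..b} then f x else 0)) = ennreal (integral {a..b} f)"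
    using nonneg by (intro nn_integral_has_integral_lborel) auto
  moreover have "ennreal (if x \<in> {a..b} then f x else 0) = ennreal (f x) * indicator {a..b} x" for x
    by (auto split: split_indicator)
  ultimately show ?thesis by simp
qed

lemma constant_if_deriv_zero:
  fixes f :: "real \<Rightarrow> real"
  assumes "\<And>x. (f has_real_derivative 0) (at x)"
  shows "f x = f y"
  using DERIV_isconst_all assms by blast

text \<open>One oscillation consists of four congruent quarters. For the primitive \<open>F\<close>
  with \<open>F 0 = 0\<close>, periodicity makes \<open>F (x + pi) - F x\<close> constant and
  evenness makes \<open>F\<close> odd.\<close>

lemma integral_period_even:
  fixes f :: "real \<Rightarrow> real"
  assumes cont: "continuous_on UNIV f" and per: "\<And>x. f (x + pi) = f x" and even: "\<And>x. f (- x) = f x"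
  shows "integral {0..2 * pi} f = 4 * integral {- (pi / 2)..0} f"
proof -
  obtain F where F: "\<And>x. (F has_real_derivative f x) (at x)" "F 0 = 0"
    using continuous_antiderivative[OF cont] by blast
  have int: "integral {a..b} f = F b - F a" if "a \<le> b" for a b
    using fundamental_theorem_of_calculus[OF that, of F f] F(1)
    by (meson has_vector_derivative_at_within has_real_derivative_iff_has_vector_derivative integral_unique)
  note [derivative_intros] = F(1)[THEN DERIV_chain2]
  have "((\<lambda>x. F (x + pi) - F x) has_real_derivative 0) (at x)" for x
    by (auto intro!: derivative_eq_intros simp: per)
  then have p: "F (x + pi) - F x = F (y + pi) - F y" for x y
    using constant_if_deriv_zero[of "\<lambda>x. F (x + pi) - F x" x y] by blast
  have "((\<lambda>x. F (- x) + F x) has_real_derivative 0) (at x)" for x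
    by (auto intro!: derivative_eq_intros simp: even)
  then have o: "F (- x) + F x = F (- y) + F y" for x y
    using constant_if_deriv_zero[of "\<lambda>x. F (- x) + F x" x y] by blast
  show ?thesis
    using p[of 0 "- (pi/2)"] p[of pi 0] o[of "pi/2" 0] F(2) by (simp add: int)
qed

text \<open>The metric \<open>(s \<phi>)\<^sup>2 d\<phi>\<^sup>2 + (r \<phi>)\<^sup>2 d\<theta>\<^sup>2\<close> in terms of the polar angle \<open>\<phi>\<close>, which is \<open>0\<close> at the south
  pole; \<open>r'\<close>, \<open>r''\<close>, \<open>s'\<close> are derivatives. On the southern hemisphere \<open>iota\<close> inverts \<open>r\<close>.\<close>

locale profile =
  fixes r r' r'' s s' :: "real \<Rightarrow> real"
  assumes dr: "\<And>x. (r has_real_derivative r' x) (at x)"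
    and dr': "\<And>x. (r' has_real_derivative r'' x) (at x)"
    and cr'': "continuous_on UNIV r''"
    and ds: "\<And>x. (s has_real_derivative s' x) (at x)"
    and cs': "continuous_on UNIV s'"
    and s_pos: "\<And>x. s x > 0"
    and r_0: "r 0 = 0"
    and r_pos: "\<And>x. x \<in> {0<..<pi} \<Longrightarrow> r x > 0"
    and r_sym: "\<And>x. r (pi - x) = r x"
    and s_sym: "\<And>x. s (pi - x) = s x"
    and r'_pos: "\<And>x. x \<in> {0..<pi/2} \<Longrightarrow> r' x > 0"
    and r'_0: "r' 0 = s 0"
begin

definition R where "R = r (pi / 2)"
definition iota where "iota \<rho> = (THE \<phi>. \<phi> \<in> {0..pi/2} \<and> r \<phi> = \<rho>)"

lemma cont_r: "continuous_on A r" and cont_r': "continuous_on A r'" and cont_s: "continuous_on A s"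
  using dr dr' ds by (meson DERIV_continuous_on has_field_derivative_at_within)+

lemmas [continuous_intros] = continuous_on_compose2[OF cont_r[of UNIV] _ subset_UNIV]
  continuous_on_compose2[OF cont_r'[of UNIV] _ subset_UNIV]
  continuous_on_compose2[OF cont_s[of UNIV] _ subset_UNIV]

lemma measurable_rs [measurable]: "r \<in> borel_measurable borel" "s \<in> borel_measurable borel"
  by (rule borel_measurable_continuous_onI, rule cont_r cont_s)+

lemma r_less: "0 \<le> x \<Longrightarrow> x < y \<Longrightarrow> y \<le> pi/2 \<Longrightarrow> r x < r y"
  by (rule DERIV_pos_imp_increasing_open[OF _ _ cont_r]) (use dr r'_pos in force)+

lemma r_less_iff: "x \<in> {0..pi/2} \<Longrightarrow> y \<in> {0..pi/2} \<Longrightarrow> r x < r y \<longleftrightarrow> x < y"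
  using r_less[of x y] r_less[of y x] by (cases x y rule: linorder_cases) auto

lemma r_le_iff: "x \<in> {0..pi/2} \<Longrightarrow> y \<in> {0..pi/2} \<Longrightarrow> r x \<le> r y \<longleftrightarrow> x \<le> y"
  using r_less_iff[of y x] by (simp add: not_less[symmetric])

lemma R_pos: "R > 0" unfolding R_def using r_pos by simp

lemma r_le_R: "x \<in> {0..pi} \<Longrightarrow> r x \<le> R"
proof (cases "x \<le> pi/2")
  assume "x \<in> {0..pi}" "x \<le> pi/2" then show ?thesis unfolding R_def by (subst r_le_iff) auto
next
  assume "x \<in> {0..pi}" "\<not> x \<le> pi/2" then show ?thesis
    unfolding R_def by (subst r_sym[symmetric], subst r_le_iff) auto
qed

lemma iota_r: "x \<in> {0..pi/2} \<Longrightarrow> iota (r x) = x"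
  unfolding iota_def by (rule the_equality) (use r_less in \<open>auto, metis linorder_neq_iff\<close>)

lemma iota_bounds: "\<rho> \<in> {0..R} \<Longrightarrow> iota \<rho> \<in> {0..pi/2}"
  and r_iota: "\<rho> \<in> {0..R} \<Longrightarrow> r (iota \<rho>) = \<rho>"
proof -
  assume "\<rho> \<in> {0..R}"
  then have "\<exists>x. 0 \<le> x \<and> x \<le> pi/2 \<and> r x = \<rho>"
    by (intro IVT' cont_r) (auto simp: R_def r_0)
  then show "iota \<rho> \<in> {0..pi/2}" "r (iota \<rho>) = \<rho>" using iota_r by force+
qed

lemma iota_0: "iota 0 = 0" and iota_R: "iota R = pi/2"
  using iota_r[of 0] iota_r[of "pi/2"] by (auto simp: r_0 R_def)

lemma iota_less: "\<rho> \<in> {0..R} \<Longrightarrow> \<rho>' \<in> {0..R} \<Longrightarrow> \<rho> < \<rho>' \<Longrightarrow> iota \<rho> < iota \<rho>'"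
  using r_less_iff[of "iota \<rho>" "iota \<rho>'"] iota_bounds[of \<rho>] iota_bounds[of \<rho>'] r_iota[of \<rho>] r_iota[of \<rho>'] by simp

lemma iota_interior: "\<rho> \<in> {0<..<R} \<Longrightarrow> iota \<rho> \<in> {0<..<pi/2}"
  using iota_less[of 0 \<rho>] iota_less[of \<rho> R] R_pos by (auto simp: iota_0 iota_R)

lemma cont_iota: "continuous_on {0..R} iota"
proof -
  have "r ` {0..pi/2} = {0..R}"
  proof
    show "r ` {0..pi/2} \<subseteq> {0..R}"
    proof safe
      fix x assume x: "x \<in> {0..pi/2}"
      then have "r 0 \<le> r x" by (subst r_le_iff) auto
      then show "r x \<in> {0..R}" using x r_le_R[of x] by (simp add: r_0)
    qed
    show "{0..R} \<subseteq> r ` {0..pi/2}" using iota_bounds r_iota by (metis image_eqI subsetI)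
  qed
  then show ?thesis
    using continuous_on_inv[of "{0..pi/2}" r iota] cont_r iota_r by simp
qed

lemma d_iota: "\<rho> \<in> {0<..<R} \<Longrightarrow> (iota has_real_derivative 1 / r' (iota \<rho>)) (at \<rho>)"
proof -
  assume \<rho>: "\<rho> \<in> {0<..<R}"
  have "isCont iota \<rho>"
    using continuous_on_interior[OF cont_iota] \<rho> by simp
  then have "(iota has_real_derivative inverse (r' (iota \<rho>))) (at \<rho>)"
    using dr \<rho> r'_pos[of "iota \<rho>"] iota_interior[OF \<rho>] r_iota
    by (intro DERIV_inverse_function[of r _ _ _ 0 R]) auto
  then show ?thesis by (simp add: inverse_eq_divide)
qed

text \<open>Along a unit speed geodesic with Clairaut constant \<open>h\<close> one has \<open>\<phi>'\<^sup>2 = N h \<phi>\<close>, so the polar angle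
  oscillates about \<open>pi/2\<close> with amplitude \<open>amp h\<close>. In terms of the phase \<open>x\<close> given by
  \<open>\<phi> = pi/2 + amp h * sin x\<close>, time satisfies \<open>dt = q h x dx\<close>. Dividing \<open>N h\<close> by its simple zero at the
  turning angle \<open>iota h\<close> shows that \<open>q h\<close> is continuous and positive through the turning points.
  \<open>T h\<close> and \<open>Theta h\<close> are the time and the advance in longitude of one full oscillation.\<close>

definition N where "N h \<phi> = (1 - h^2 / (r \<phi>)^2) / (s \<phi>)^2"
definition amp where "amp h = pi/2 - iota h"
definition D where "D h \<phi> = (if \<phi> = iota h then 2 * r' (iota h) / (h * (s (iota h))^2) else N h \<phi> / (\<phi> - iota h))"
definition q where "q h x = sqrt ((amp h + amp h * \<bar>sin x\<bar>) / D h (pi/2 - amp h * \<bar>sin x\<bar>))"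
definition T where "T h = integral {0..2 * pi} (q h)"
definition Theta where "Theta h = integral {0..2 * pi} (\<lambda>x. h * q h x / (r (pi/2 + amp h * sin x))^2)"

context
  fixes h assumes h: "h \<in> {0<..<R}"
begin

lemma iota_h: "iota h \<in> {0<..<pi/2}" "r (iota h) = h"
  using iota_interior[OF h] r_iota h by auto

lemma amp_pos: "amp h > 0" "amp h < pi/2" using iota_h by (auto simp: amp_def)

lemma N_iota: "N h (iota h) = 0" using h by (simp add: N_def iota_h)

lemma N_sym: "N h (pi - x) = N h x" by (simp add: N_def r_sym s_sym)

lemma N_pos: "x \<in> {iota h<..pi/2} \<Longrightarrow> N h x > 0"
proof -
  assume x: "x \<in> {iota h<..pi/2}"
  then have "h < r x" using r_less[of "iota h" x] iota_h by auto
  then have "h^2 < (r x)^2" using h by (simp add: power_strict_mono)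
  then show ?thesis unfolding N_def using s_pos[of x] by (simp add: divide_less_eq_1) 
qed

lemma d_clairaut: "x \<in> {0<..<pi} \<Longrightarrow> ((\<lambda>x. 1 - h^2 / (r x)^2) has_real_derivative 2 * h^2 * r' x / (r x)^3) (at x)"
proof -
  assume "x \<in> {0<..<pi}"
  then have "r x \<noteq> 0" using r_pos[of x] by simp
  moreover from this have "- (0 * (r x)^2 - h^2 * (2 * r x * r' x)) / ((r x)^2 * (r x)^2) = 2 * h^2 * r' x / (r x)^3"
    by (simp add: divide_simps power2_eq_square power3_eq_cube)
  ultimately show ?thesis
    by (auto intro!: derivative_eq_intros dr simp: power2_eq_square)
qed

lemma d_N: "x \<in> {0<..<pi} \<Longrightarrow> (N h has_real_derivative
   (2 * h^2 * r' x / (r x)^3 * (s x)^2 - (1 - h^2 / (r x)^2) * (2 * s x * s' x)) / ((s x)^2 * (s x)^2)) (at x)"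
  unfolding N_def using s_pos[of x]
  by (intro DERIV_divide d_clairaut) (auto intro!: derivative_eq_intros ds)

lemma d_N_iota: "(N h has_real_derivative 2 * r' (iota h) / (h * (s (iota h))^2)) (at (iota h))"
proof -
  have "(2 * h^2 * r' (iota h) / h^3 * (s (iota h))^2 - (1 - h^2 / h^2) * (2 * s (iota h) * s' (iota h))) / ((s (iota h))^2 * (s (iota h))^2) =
        2 * r' (iota h) / (h * (s (iota h))^2)"
    using h s_pos[of "iota h"] by (simp add: divide_simps power2_eq_square power3_eq_cube)
  then show ?thesis using d_N[of "iota h"] iota_h by simp
qed

text \<open>As \<open>N h\<close> vanishes at \<open>iota h\<close>, the quotient there is a
  difference quotient, and the value put into the definition of \<open>D\<close> is the derivative
  of \<open>N h\<close> from \<open>d_N_iota\<close>.\<close>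

lemma cont_D: "continuous_on {0<..<pi} (D h)"
proof (intro continuous_at_imp_continuous_on ballI)
  fix x assume x: "x \<in> {0<..<pi}"
  show "isCont (D h) x"
  proof (cases "x = iota h")
    case True
    have "((\<lambda>y. (N h y - N h x) / (y - x)) \<longlongrightarrow> 2 * r' (iota h) / (h * (s (iota h))^2)) (at x)"
      using d_N_iota True by (simp add: has_field_derivative_iff)
    then have "(D h \<longlongrightarrow> 2 * r' (iota h) / (h * (s (iota h))^2)) (at x)"
      by (rule Lim_transform_eventually) (auto simp: D_def True N_iota eventually_at_filter)
    then show ?thesis by (simp add: isCont_def D_def True)
  next
    case False
    have "isCont (\<lambda>y. N h y / (y - iota h)) x"
      using d_N[OF x, THEN DERIV_isCont] False by (intro continuous_intros) auto
    moreover have "\<forall>\<^sub>F y in nhds x. N h y / (y - iota h) = D h y"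
    proof -
      have "\<forall>\<^sub>F y in nhds x. y \<noteq> iota h" using False t1_space_nhds by blast
      then show ?thesis by eventually_elim (simp add: D_def)
    qed
    ultimately show ?thesis by (subst (asm) isCont_cong) 
  qed
qed

lemma D_pos: "x \<in> {iota h..pi/2} \<Longrightarrow> D h x > 0"
  using N_pos[of x] iota_h h s_pos[of "iota h"] r'_pos[of "iota h"] by (auto simp: D_def)

lemma arg_bounds: "pi/2 - amp h * \<bar>sin x\<bar> \<in> {iota h..pi/2}"
  and arg_bounds': "pi/2 + amp h * sin x \<in> {iota h..pi - iota h}"
proof -
  have "\<bar>sin x\<bar> \<le> 1" by simp
  then have "amp h * \<bar>sin x\<bar> \<le> amp h * 1" using amp_pos by (intro mult_left_mono) auto
  moreover have "amp h * \<bar>sin x\<bar> = \<bar>amp h * sin x\<bar>" using amp_pos by (simp add: abs_mult)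
  moreover have "0 \<le> amp h * \<bar>sin x\<bar>" using amp_pos by simp
  ultimately show "pi/2 - amp h * \<bar>sin x\<bar> \<in> {iota h..pi/2}" "pi/2 + amp h * sin x \<in> {iota h..pi - iota h}"
    by (auto simp: amp_def)
qed

lemma q_pos: "q h x > 0"
  unfolding q_def using D_pos[OF arg_bounds] amp_pos by (auto intro!: divide_pos_pos add_pos_nonneg)

lemma cont_q: "continuous_on A (q h)"
proof -
  have "continuous_on UNIV (\<lambda>x. D h (pi/2 - amp h * \<bar>sin x\<bar>))"
  proof (intro continuous_on_compose2[OF cont_D] continuous_intros subsetI)
    fix y assume "y \<in> range (\<lambda>x. pi / 2 - amp h * \<bar>sin x\<bar>)"
    then obtain x where "y = pi / 2 - amp h * \<bar>sin x\<bar>" by auto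
    then show "y \<in> {0<..<pi}"
      using arg_bounds[of x] iota_h pi_gt_zero
      unfolding atLeastAtMost_iff greaterThanLessThan_iff by linarith
  qed
  moreover have "D h (pi/2 - amp h * \<bar>sin x\<bar>) \<noteq> 0" for x
    using D_pos[OF arg_bounds[of x]] by simp
  ultimately have "continuous_on UNIV (q h)"
    unfolding q_def by (intro continuous_intros) auto
  then show ?thesis by (rule continuous_on_subset) simp
qed

lemma q_periodic: "q h (x + pi) = q h x" and q_even: "q h (- x) = q h x"
  by (simp_all add: q_def)

lemma N_arg: "N h (pi/2 + amp h * sin x) = N h (pi/2 - amp h * \<bar>sin x\<bar>)"
  using N_sym[of "pi/2 - amp h * sin x"] by (auto simp: abs_if algebra_simps)

lemma r_arg: "r (pi/2 + amp h * sin x) = r (pi/2 - amp h * \<bar>sin x\<bar>)"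
  using r_sym[of "pi/2 - amp h * sin x"] by (auto simp: abs_if algebra_simps)

text \<open>This is \<open>\<phi>'^2 = N h \<phi>\<close> rewritten with
  \<open>dt = q h x dx\<close>. By reflection it suffices to look south of the equator, where
  \<open>N = D * (y - iota h)\<close> and the two factors
  \<open>amp h + amp h * \<bar>sin x\<bar>\<close> and
  \<open>amp h - amp h * \<bar>sin x\<bar>\<close> multiply to
  \<open>(amp h * cos x)^2\<close>.\<close>

lemma q_eq: "(amp h * cos x)^2 = (q h x)^2 * N h (pi/2 + amp h * sin x)"
proof -
  define y where "y = pi/2 - amp h * \<bar>sin x\<bar>"
  have D: "D h y > 0" unfolding y_def by (rule D_pos[OF arg_bounds])
  have "(q h x)^2 = (amp h + amp h * \<bar>sin x\<bar>) / D h y"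
    unfolding q_def using D amp_pos by (simp add: y_def)
  moreover have "N h y = D h y * (y - iota h)" using D by (simp add: D_def N_iota)
  moreover have "y - iota h = amp h - amp h * \<bar>sin x\<bar>" by (simp add: y_def amp_def)
  ultimately have "(q h x)^2 * N h y = (amp h + amp h * \<bar>sin x\<bar>) * (amp h - amp h * \<bar>sin x\<bar>)"
    using D by simp
  also have "\<dots> = (amp h)^2 * (1 - (sin x)^2)"
    by (simp add: algebra_simps power2_eq_square)
  also have "\<dots> = (amp h * cos x)^2" by (simp add: cos_squared_eq power_mult_distrib)
  finally show ?thesis by (simp add: N_arg y_def)
qed

lemma r_arg_ge: "h \<le> r (pi/2 + amp h * sin x)"
  unfolding r_arg using r_le_iff[of "iota h" "pi/2 - amp h * \<bar>sin x\<bar>"] arg_bounds[of x] iota_h by auto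

text \<open>The bridge between the regular integrals over the phase, which define \<open>T\<close>
  and \<open>Theta\<close>, and the singular integrals over the latitude, to which Abel inversion
  applies. The weight \<open>k\<close> allows for time, longitude and action at once.\<close>

lemma weighted_quarter_integral:
  assumes k: "continuous_on {0<..<pi} k" and nonneg: "\<And>x. x \<in> {iota h..pi/2} \<Longrightarrow> k x \<ge> 0"
    and sym: "\<And>x. k (pi - x) = k x"
  shows "(\<integral>\<^sup>+x. ennreal (k x * s x * r x / sqrt ((r x)^2 - h^2)) * indicator {iota h..pi/2} x \<partial>lborel)
    = ennreal (integral {0..2 * pi} (\<lambda>x. k (pi/2 + amp h * sin x) * q h x) / 4)"
proof -
  define g where "g = (\<lambda>x. pi/2 + amp h * sin x)"
  define f where "f = (\<lambda>x. k x * s x * r x / sqrt ((r x)^2 - h^2))"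
  have g: "g (- (pi/2)) = iota h" "g 0 = pi/2" by (simp_all add: g_def amp_def)
  have g_in: "g x \<in> {0<..<pi}" for x using arg_bounds'[of x] iota_h by (auto simp: g_def)
  have cont: "continuous_on UNIV (\<lambda>x. k (g x) * q h x)"
    by (intro continuous_intros cont_q continuous_on_compose2[OF k]) (use g_in in \<open>auto simp: g_def intro!: continuous_intros\<close>)
  have keven: "k (g (- x)) = k (g x)" for x
    using sym[of "g x"] by (simp add: g_def algebra_simps)
  have kper: "k (g (x + pi)) = k (g x)" for x
    using sym[of "g x"] by (simp add: g_def algebra_simps)
  have "(\<integral>\<^sup>+x. ennreal (f x) * indicator {iota h..pi/2} x \<partial>lborel) =
     (\<integral>\<^sup>+x. ennreal (f x) * indicator {g (- (pi/2))..g 0} x \<partial>lborel)" by (simp add: g)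
  also have "\<dots> = (\<integral>\<^sup>+x. ennreal (f x * indicator {g (- (pi/2))..g 0} x) \<partial>lborel)"
    by (intro nn_integral_cong) (auto split: split_indicator)
  also have "\<dots> = (\<integral>\<^sup>+x. ennreal (f (g x) * (amp h * cos x) * indicator {- (pi/2)..0} x) \<partial>lborel)"
  proof (rule nn_integral_substitution)
    have "continuous_on {iota h..pi/2} k"
      by (rule continuous_on_subset[OF k]) (use iota_h in auto)
    then have "(\<lambda>x. indicator {iota h..pi/2} x *\<^sub>R k x) \<in> borel_measurable borel"
      by (intro borel_measurable_continuous_on_indicator) auto
    moreover have "(\<lambda>x. s x * r x / sqrt ((r x)^2 - h^2)) \<in> borel_measurable borel"
      by measurable
    ultimately have "(\<lambda>x. (indicator {iota h..pi/2} x *\<^sub>R k x) * (s x * r x / sqrt ((r x)^2 - h^2))) \<in> borel_measurable borel"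
      by measurable
    then show "set_borel_measurable borel {g (- (pi/2))..g 0} f"
      by (simp add: set_borel_measurable_def f_def g mult.assoc)
    show "(g has_real_derivative amp h * cos x) (at x)" for x
      unfolding g_def by (auto intro!: derivative_eq_intros)
    show "0 \<le> amp h * cos x" if "x \<in> {- (pi/2)..0}" for x
      using that amp_pos cos_ge_zero[of x] by (intro mult_nonneg_nonneg) auto
  qed (auto intro!: continuous_intros)
  \<comment> \<open>On the quarter from the southern turning point to the equator
    \<open>cos x\<close> is nonnegative, so \<open>q_eq\<close> can be solved for it. At
    \<open>x = - pi/2\<close> the quotient is 0 divided by 0; this single point is
    discarded.\<close>
  also have "\<dots> = (\<integral>\<^sup>+x. ennreal (k (g x) * q h x) * indicator {- (pi/2)..0} x \<partial>lborel)"
  proof (rule nn_integral_cong_AE)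
    have "f (g x) * (amp h * cos x) = k (g x) * q h x" if x: "x \<in> {- (pi/2)<..0}" for x
    proof -
      have c: "amp h * cos x > 0" using cos_gt_zero_pi[of x] x amp_pos by simp
      have rg: "r (g x) > 0" using r_pos[OF g_in] .
      have "amp h * cos x = sqrt ((q h x)^2 * N h (g x))"
        using q_eq[of x] c by (simp add: g_def real_sqrt_unique)
      also have "\<dots> = q h x * sqrt (N h (g x))"
        using q_pos[of x] by (simp add: real_sqrt_mult)
      also have "N h (g x) = ((r (g x))^2 - h^2) / (r (g x) * s (g x))^2"
        using rg s_pos[of "g x"] by (simp add: N_def field_simps)
      also have "sqrt \<dots> = sqrt ((r (g x))^2 - h^2) / (r (g x) * s (g x))"
        using rg s_pos[of "g x"] by (simp add: real_sqrt_divide)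
      finally have *: "amp h * cos x = q h x * (sqrt ((r (g x))^2 - h^2) / (r (g x) * s (g x)))" .
      then have "sqrt ((r (g x))^2 - h^2) \<noteq> 0" using c by auto
      then show ?thesis unfolding f_def * using rg s_pos[of "g x"] by (simp add: field_simps)
    qed
    then have *: "ennreal (f (g x) * (amp h * cos x) * indicator {- (pi/2)..0} x) =
      ennreal (k (g x) * q h x) * indicator {- (pi/2)..0} x" if "x \<noteq> - (pi/2)" for x
      using that by (auto split: split_indicator)
    have "AE x in lborel. x \<noteq> - (pi/2 :: real)" by (rule AE_lborel_singleton)
    then show "AE x in lborel. ennreal (f (g x) * (amp h * cos x) * indicator {- (pi/2)..0} x) =
      ennreal (k (g x) * q h x) * indicator {- (pi/2)..0} x"
      by eventually_elim (rule *)
  qed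
  also have "\<dots> = ennreal (integral {- (pi/2)..0} (\<lambda>x. k (g x) * q h x))"
  proof (rule nn_integral_continuous_Icc)
    fix x :: real assume x: "x \<in> {- (pi/2)..0}"
    have "g x \<in> {iota h..pi/2}"
    proof -
      have "0 \<le> sin (- x)"
      proof (rule sin_ge_zero)
        show "0 \<le> - x" using x by simp
        show "- x \<le> pi" using x pi_gt_zero unfolding atLeastAtMost_iff by linarith
      qed
      then have "sin x \<le> 0" by simp
      then have "amp h * sin x \<le> 0" using amp_pos by (intro mult_nonneg_nonpos) auto
      then show ?thesis using arg_bounds'[of x] unfolding g_def atLeastAtMost_iff by linarith
    qed
    then show "0 \<le> k (g x) * q h x" using nonneg q_pos[of x] by (simp add: less_imp_le)
  qed (rule continuous_on_subset[OF cont], simp)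
  also have "integral {- (pi/2)..0} (\<lambda>x. k (g x) * q h x) = integral {0..2 * pi} (\<lambda>x. k (g x) * q h x) / 4"
    using integral_period_even[OF cont] by (simp add: keven kper q_periodic q_even)
  finally show ?thesis by (simp add: f_def g_def)
qed

end
end

section \<open>Abel inversion of the advance in longitude\<close>

lemma integral_pos_continuous:
  fixes f :: "real \<Rightarrow> real"
  assumes "a < b" "continuous_on UNIV f" "\<And>x. f x > 0"
  shows "integral {a..b} f > 0"
proof -
  obtain F where F: "\<And>x. (F has_real_derivative f x) (at x)"
    using continuous_antiderivative[OF assms(2)] by blast
  have "(f has_integral F b - F a) {a..b}"
    using F assms(1) by (intro fundamental_theorem_of_calculus)
      (auto simp: has_real_derivative_iff_has_vector_derivative[symmetric] intro: has_field_derivative_at_within)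
  moreover have "F a < F b"
    using F assms(3) by (intro DERIV_pos_imp_increasing[OF assms(1)]) blast
  ultimately show ?thesis by (simp add: integral_unique)
qed

lemma nn_integral_sqrt_kernel:
  assumes "0 < h" "h \<le> \<rho>"
  shows "(\<integral>\<^sup>+x. ennreal (x / sqrt (\<rho>^2 - x^2)) * indicator {h..\<rho>} x \<partial>lborel) = ennreal (sqrt (\<rho>^2 - h^2))"
proof -
  have "(\<integral>\<^sup>+x. ennreal (x / sqrt (\<rho>^2 - x^2)) * indicator {h..\<rho>} x \<partial>lborel) =
     ennreal (- sqrt (\<rho>^2 - \<rho>^2) - - sqrt (\<rho>^2 - h^2))"
  proof (rule nn_integral_FTC_interior)
    fix x assume x: "x \<in> {h<..<\<rho>}"
    then have "x^2 < \<rho>^2" using assms by (intro power_strict_mono) auto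
    then show "((\<lambda>x. - sqrt (\<rho>^2 - x^2)) has_real_derivative x / sqrt (\<rho>^2 - x^2)) (at x)"
      by (auto intro!: derivative_eq_intros simp: field_simps)
  next
    fix x assume x: "x \<in> {h..\<rho>}"
    then have "x^2 \<le> \<rho>^2" using assms by (intro power_mono) auto
    then show "0 \<le> x / sqrt (\<rho>^2 - x^2)" using x assms by simp
  qed (use assms in \<open>auto intro!: continuous_intros\<close>)
  then show ?thesis by simp
qed

text \<open>That the value depends neither on \<open>h\<close> nor on \<open>\<rho>\<close> is what
  makes Abel inversion work.\<close>

lemma nn_integral_abel_kernel:
  assumes "0 < h" "h < \<rho>"
  shows "(\<integral>\<^sup>+x. ennreal (1 / sqrt (x^2 - h^2) * (x / sqrt (\<rho>^2 - x^2))) * indicator {h..\<rho>} x \<partial>lborel) = ennreal (pi / 2)"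
proof -
  \<comment> \<open>The affine function of \<open>x^2\<close> that maps \<open>h^2\<close> to -1 and
    \<open>\<rho>^2\<close> to 1; \<open>arcsin (z x) / 2\<close> is then a primitive, and its total
    increase is \<open>pi / 2\<close>.\<close>
  define z where "z = (\<lambda>x. (2 * x^2 - \<rho>^2 - h^2) / (\<rho>^2 - h^2))"
  have lt: "h^2 < \<rho>^2" using assms by (intro power_strict_mono) auto
  have z: "z h = -1" "z \<rho> = 1" using lt by (auto simp: z_def field_simps)
  have "(\<integral>\<^sup>+x. ennreal (1 / sqrt (x^2 - h^2) * (x / sqrt (\<rho>^2 - x^2))) * indicator {h..\<rho>} x \<partial>lborel) =
     ennreal (arcsin (z \<rho>) / 2 - arcsin (z h) / 2)"
  proof (rule nn_integral_FTC_interior)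
    show "(\<lambda>x. 1 / sqrt (x\<^sup>2 - h\<^sup>2) * (x / sqrt (\<rho>\<^sup>2 - x\<^sup>2))) \<in> borel_measurable borel"
      by measurable
  next
    fix x assume x: "x \<in> {h..\<rho>}"
    then have "x^2 \<le> \<rho>^2" "h^2 \<le> x^2" using assms by (auto intro!: power_mono)
    then show "0 \<le> 1 / sqrt (x\<^sup>2 - h\<^sup>2) * (x / sqrt (\<rho>\<^sup>2 - x\<^sup>2))" using x assms by simp
  next
    have "-1 \<le> z x \<and> z x \<le> 1" if x: "x \<in> {h..\<rho>}" for x
    proof -
      have "x^2 \<le> \<rho>^2" "h^2 \<le> x^2" using assms x by (auto intro!: power_mono)
      then show ?thesis using lt by (auto simp: z_def field_simps)
    qed
    moreover have "continuous_on {h..\<rho>} z" unfolding z_def using lt by (intro continuous_intros) auto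
    ultimately show "continuous_on {h..\<rho>} (\<lambda>x. arcsin (z x) / 2)"
      by (intro continuous_intros) auto
  next
    fix x assume x: "x \<in> {h<..<\<rho>}"
    then have x2: "x^2 < \<rho>^2" "h^2 < x^2" using assms by (auto intro!: power_strict_mono)
    then have zb: "-1 < z x" "z x < 1" using lt by (auto simp: z_def field_simps)
    have "1 - (z x)^2 = (2 / (\<rho>^2 - h^2))^2 * ((\<rho>^2 - x^2) * (x^2 - h^2))"
    proof -
      have "(z x)^2 = (2 * x^2 - \<rho>^2 - h^2)^2 / (\<rho>^2 - h^2)^2"
        by (simp only: z_def power_divide)
      moreover have "(1::real) = (\<rho>^2 - h^2)^2 / (\<rho>^2 - h^2)^2" using lt by simp
      ultimately have "1 - (z x)^2 = ((\<rho>^2 - h^2)^2 - (2 * x^2 - \<rho>^2 - h^2)^2) / (\<rho>^2 - h^2)^2"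
        by (metis diff_divide_distrib)
      also have "(\<rho>^2 - h^2)^2 - (2 * x^2 - \<rho>^2 - h^2)^2 = 4 * ((\<rho>^2 - x^2) * (x^2 - h^2))"
        by (simp add: power2_eq_square algebra_simps)
      finally show ?thesis by (simp add: power_divide)
    qed
    then have sq: "sqrt (1 - (z x)^2) = 2 / (\<rho>^2 - h^2) * (sqrt (\<rho>^2 - x^2) * sqrt (x^2 - h^2))"
      using lt by (simp add: real_sqrt_mult)
    have dz: "(z has_real_derivative 4 * x / (\<rho>^2 - h^2)) (at x)"
      unfolding z_def by (rule DERIV_cdivide) (auto intro!: derivative_eq_intros)
    have "((\<lambda>x. arcsin (z x) / 2) has_real_derivative (inverse (sqrt (1 - (z x)^2)) * (4 * x / (\<rho>^2 - h^2))) / 2) (at x)"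
      by (intro DERIV_cdivide DERIV_chain2[OF DERIV_arcsin dz] zb)
    moreover have "(inverse (sqrt (1 - (z x)^2)) * (4 * x / (\<rho>^2 - h^2))) / 2 = 1 / sqrt (x^2 - h^2) * (x / sqrt (\<rho>^2 - x^2))"
      unfolding sq using lt x2 by (simp add: field_simps)
    ultimately show "((\<lambda>x. arcsin (z x) / 2) has_real_derivative 1 / sqrt (x\<^sup>2 - h\<^sup>2) * (x / sqrt (\<rho>\<^sup>2 - x\<^sup>2))) (at x)"
      by simp
  qed (use assms in auto)
  then show ?thesis by (simp add: z arcsin_minus_1)
qed

context profile
begin

text \<open>The action of the latitude motion, that is the integral of its conjugate momentum
  \<open>s * sqrt (1 - h^2 / r^2)\<close> over one oscillation.\<close>

definition S where "S h = T h - h * Theta h"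
text \<open>Arc length along the meridian is \<open>w \<rho> d\<rho>\<close> in terms of the radius \<open>\<rho>\<close>.\<close>

definition w where "w \<rho> = s (iota \<rho>) / r' (iota \<rho>)"

lemma weight_continuous:
  assumes h: "h \<in> {0<..<R}"
  shows "continuous_on UNIV (\<lambda>x. h * q h x / (r (pi/2 + amp h * sin x))^2)"
proof -
  have "r (pi/2 + amp h * sin x) \<noteq> 0" for x using r_arg_ge[OF h, of x] h by auto
  then show ?thesis by (intro continuous_intros cont_q[OF h]) auto
qed

lemma T_pos: "h \<in> {0<..<R} \<Longrightarrow> T h > 0"
  unfolding T_def by (rule integral_pos_continuous) (auto simp: cont_q q_pos)

lemma Theta_pos: "h \<in> {0<..<R} \<Longrightarrow> Theta h > 0"
proof -
  assume h: "h \<in> {0<..<R}"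
  have "0 < h * q h x / (r (pi/2 + amp h * sin x))^2" for x
    using h q_pos[OF h, of x] r_arg_ge[OF h, of x] by (intro divide_pos_pos mult_pos_pos zero_less_power) auto
  then show ?thesis unfolding Theta_def
    by (intro integral_pos_continuous weight_continuous[OF h]) auto
qed

lemma iota_h_interval: "h \<in> {0<..<R} \<Longrightarrow> x \<in> {iota h..pi/2} \<Longrightarrow> h \<le> r x"
  using r_le_iff[of "iota h" x] iota_h[of h] by auto

lemma Theta_nn:
  assumes h: "h \<in> {0<..<R}"
  shows "ennreal (Theta h / 4) = (\<integral>\<^sup>+x. ennreal (h * s x / (r x * sqrt ((r x)^2 - h^2))) * indicator {iota h..pi/2} x \<partial>lborel)"
proof -
  have "(\<integral>\<^sup>+x. ennreal (h * s x / (r x * sqrt ((r x)^2 - h^2))) * indicator {iota h..pi/2} x \<partial>lborel) =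
    (\<integral>\<^sup>+x. ennreal (h / (r x)^2 * s x * r x / sqrt ((r x)^2 - h^2)) * indicator {iota h..pi/2} x \<partial>lborel)"
  proof (intro nn_integral_cong)
    fix x show "ennreal (h * s x / (r x * sqrt ((r x)^2 - h^2))) * indicator {iota h..pi/2} x =
      ennreal (h / (r x)^2 * s x * r x / sqrt ((r x)^2 - h^2)) * indicator {iota h..pi/2} x"
      using iota_h_interval[OF h, of x] h by (auto simp: power2_eq_square split: split_indicator)
  qed
  also have "\<dots> = ennreal (integral {0..2 * pi} (\<lambda>x. h / (r (pi/2 + amp h * sin x))^2 * q h x) / 4)"
  proof (rule weighted_quarter_integral[OF h])
    show "continuous_on {0<..<pi} (\<lambda>x. h / (r x)^2)"
      using r_pos by (intro continuous_intros) force
  qed (use h in \<open>auto simp: r_sym\<close>)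
  finally show ?thesis by (simp add: Theta_def)
qed

lemma S_integral:
  assumes h: "h \<in> {0<..<R}"
  shows "S h = integral {0..2 * pi} (\<lambda>x. (1 - h^2 / (r (pi/2 + amp h * sin x))^2) * q h x)"
proof -
  have "integral {0..2 * pi} (\<lambda>x. q h x - h * (h * q h x / (r (pi/2 + amp h * sin x))^2)) =
    T h - integral {0..2 * pi} (\<lambda>x. h * (h * q h x / (r (pi/2 + amp h * sin x))^2))"
    unfolding T_def
    by (rule integral_diff; intro integrable_continuous_interval continuous_on_mult_left continuous_on_subset[OF weight_continuous[OF h]] cont_q[OF h]; simp)
  also have "integral {0..2 * pi} (\<lambda>x. h * (h * q h x / (r (pi/2 + amp h * sin x))^2)) = h * Theta h"
    unfolding Theta_def by (rule integral_mult_right)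
  also have "(\<lambda>x. q h x - h * (h * q h x / (r (pi/2 + amp h * sin x))^2)) = (\<lambda>x. (1 - h^2 / (r (pi/2 + amp h * sin x))^2) * q h x)"
    by (simp add: fun_eq_iff algebra_simps power2_eq_square)
  finally show ?thesis by (simp add: S_def)
qed

text \<open>The weight \<open>1 - h^2 / r^2\<close> cancels the singularity of the time integral at
  the turning point; the integrand of the action vanishes there.\<close>

lemma S_nn:
  assumes h: "h \<in> {0<..<R}"
  shows "ennreal (S h / 4) = (\<integral>\<^sup>+x. ennreal (s x / r x * sqrt ((r x)^2 - h^2)) * indicator {iota h..pi/2} x \<partial>lborel)"
proof -
  have "(\<integral>\<^sup>+x. ennreal (s x / r x * sqrt ((r x)^2 - h^2)) * indicator {iota h..pi/2} x \<partial>lborel) =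
    (\<integral>\<^sup>+x. ennreal ((1 - h^2 / (r x)^2) * s x * r x / sqrt ((r x)^2 - h^2)) * indicator {iota h..pi/2} x \<partial>lborel)"
  proof (intro nn_integral_cong)
    fix x
    have "s x / r x * sqrt ((r x)^2 - h^2) = (1 - h^2 / (r x)^2) * s x * r x / sqrt ((r x)^2 - h^2)" if x: "x \<in> {iota h..pi/2}"
    proof -
      have hr: "h \<le> r x" using iota_h_interval[OF h x] .
      then have "0 \<le> (r x)^2 - h^2" using h by (simp add: power_mono)
      then have "sqrt ((r x)^2 - h^2) = ((r x)^2 - h^2) / sqrt ((r x)^2 - h^2)" by (simp add: real_div_sqrt)
      moreover have "s x / r x * ((r x)^2 - h^2) = (1 - h^2 / (r x)^2) * s x * r x"
        using hr h by (simp add: field_simps power2_eq_square)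
      ultimately show ?thesis by (metis times_divide_eq_right)
    qed
    then show "ennreal (s x / r x * sqrt ((r x)^2 - h^2)) * indicator {iota h..pi/2} x =
      ennreal ((1 - h^2 / (r x)^2) * s x * r x / sqrt ((r x)^2 - h^2)) * indicator {iota h..pi/2} x"
      by (auto split: split_indicator)
  qed
  also have "\<dots> = ennreal (integral {0..2 * pi} (\<lambda>x. (1 - h^2 / (r (pi/2 + amp h * sin x))^2) * q h x) / 4)"
  proof (rule weighted_quarter_integral[OF h])
    show "continuous_on {0<..<pi} (\<lambda>x. 1 - h^2 / (r x)^2)"
      using r_pos by (intro continuous_intros) force
    show "0 \<le> 1 - h^2 / (r x)^2" if "x \<in> {iota h..pi/2}" for x
      using iota_h_interval[OF h that] h by (simp add: divide_le_eq_1 power_mono)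
  qed (auto simp: r_sym)
  finally show ?thesis by (simp add: S_integral[OF h])
qed

lemma S_nonneg: assumes h: "h \<in> {0<..<R}" shows "S h \<ge> 0"
  unfolding S_integral[OF h]
proof (rule integral_nonneg)
  have "r (pi/2 + amp h * sin x) \<noteq> 0" for x using r_arg_ge[OF h, of x] h by auto
  then show "(\<lambda>x. (1 - h^2 / (r (pi/2 + amp h * sin x))^2) * q h x) integrable_on {0..2 * pi}"
    by (intro integrable_continuous_interval continuous_intros cont_q[OF h]) auto
  fix x
  have "h^2 \<le> (r (pi/2 + amp h * sin x))^2" using r_arg_ge[OF h] h by (intro power_mono) auto
  moreover have "(r (pi/2 + amp h * sin x))^2 > 0" using \<open>\<And>x. r (pi/2 + amp h * sin x) \<noteq> 0\<close> by simp
  ultimately show "0 \<le> (1 - h^2 / (r (pi/2 + amp h * sin x))^2) * q h x"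
    using q_pos[OF h, of x] by (simp add: divide_le_eq_1)
qed

text \<open>By \<open>Theta_nn\<close> the advance is itself an integral over latitudes with
  \<open>x \<le> r \<phi>\<close>. Exchanging the order leaves an inner integral over the Clairaut
  constant in closed form: with \<open>k = 1\<close> it leads to the action, with the Abel kernel to
  the weight of the meridian.\<close>

lemma Theta_Tonelli:
  assumes h: "h \<in> {0<..<R}" and k: "k \<in> borel_measurable borel" and k0: "\<And>x. x \<in> {h..R} \<Longrightarrow> k x \<ge> 0"
  shows "(\<integral>\<^sup>+x. ennreal (k x * Theta x) * indicator {h..R} x \<partial>lborel) =
    4 * (\<integral>\<^sup>+\<phi>. ennreal (s \<phi> / r \<phi>) * indicator {0..pi/2} \<phi> *
      (\<integral>\<^sup>+x. ennreal (k x * (x / sqrt ((r \<phi>)^2 - x^2))) * indicator {h..r \<phi>} x \<partial>lborel) \<partial>lborel)"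
proof -
  note [measurable] = k
  define f where "f = (\<lambda>x \<phi>. if h \<le> x \<and> x \<le> r \<phi> \<and> 0 \<le> \<phi> \<and> \<phi> \<le> pi/2 then
     ennreal (s \<phi> / r \<phi>) * ennreal (k x * (x / sqrt ((r \<phi>)^2 - x^2))) else 0)"
  have "AE x in lborel. ennreal (k x * Theta x) * indicator {h..R} x = 4 * (\<integral>\<^sup>+\<phi>. f x \<phi> \<partial>lborel)"
  proof -
    \<comment> \<open>At \<open>x = R\<close> no oscillation is left and \<open>Theta\<close> has no
      geometric meaning; the point has measure 0.\<close>
    have "ennreal (k x * Theta x) * indicator {h..R} x = 4 * (\<integral>\<^sup>+\<phi>. f x \<phi> \<partial>lborel)" if "x \<noteq> R" for x
    proof (cases "x \<in> {h..R}")
      case True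
      with h that have x: "x \<in> {0<..<R}" by auto
      have kx: "k x \<ge> 0" using k0 True by auto
      have "f x \<phi> = ennreal (k x) * (ennreal (x * s \<phi> / (r \<phi> * sqrt ((r \<phi>)^2 - x^2))) * indicator {iota x..pi/2} \<phi>)" for \<phi>
      proof (cases "0 \<le> \<phi> \<and> \<phi> \<le> pi/2")
        case True
        have ie: "x \<le> r \<phi> \<longleftrightarrow> iota x \<le> \<phi>" 
          using r_le_iff[of "iota x" \<phi>] True iota_h[OF x] by auto
        show ?thesis
        proof (cases "x \<le> r \<phi>")
          case le: True
          then have "s \<phi> / r \<phi> \<ge> 0" using x s_pos[of \<phi>] by simp
          moreover have "x / sqrt ((r \<phi>)^2 - x^2) \<ge> 0" using le x by (simp add: power_mono)
          ultimately have "ennreal (s \<phi> / r \<phi>) * ennreal (k x * (x / sqrt ((r \<phi>)^2 - x^2))) =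
              ennreal (s \<phi> / r \<phi> * (k x * (x / sqrt ((r \<phi>)^2 - x^2))))"
            using kx by (intro ennreal_mult[symmetric] mult_nonneg_nonneg)
          also have "s \<phi> / r \<phi> * (k x * (x / sqrt ((r \<phi>)^2 - x^2))) = k x * (x * s \<phi> / (r \<phi> * sqrt ((r \<phi>)^2 - x^2)))"
            by (simp add: ac_simps)
          also have "ennreal \<dots> = ennreal (k x) * ennreal (x * s \<phi> / (r \<phi> * sqrt ((r \<phi>)^2 - x^2)))"
            using kx \<open>0 \<le> s \<phi> / r \<phi>\<close> \<open>0 \<le> x / sqrt ((r \<phi>)^2 - x^2)\<close> mult_nonneg_nonneg[of "s \<phi> / r \<phi>" "x / sqrt ((r \<phi>)^2 - x^2)"]
            by (intro ennreal_mult) (auto simp: ac_simps)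
          finally show ?thesis using True le ie \<open>x \<in> {h..R}\<close>
            by (simp add: f_def)
        qed (use ie in \<open>auto simp: f_def\<close>)
      next
        case False
        then show ?thesis using iota_h[OF x] by (auto simp: f_def split: split_indicator)
      qed
      then have "(\<integral>\<^sup>+\<phi>. f x \<phi> \<partial>lborel) = ennreal (k x) * ennreal (Theta x / 4)"
        by (simp add: nn_integral_cmult Theta_nn[OF x])
      then have "4 * (\<integral>\<^sup>+\<phi>. f x \<phi> \<partial>lborel) = ennreal 4 * ennreal (k x * (Theta x / 4))"
        using kx Theta_pos[OF x] by (simp add: ennreal_mult del: times_divide_eq_right)
      also have "\<dots> = ennreal (k x * Theta x)"
        using kx Theta_pos[OF x] by (subst ennreal_mult[symmetric]) auto
      finally show ?thesis using True by simp
    next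
      case False
      then have "f x \<phi> = 0" for \<phi>
        using r_le_R[of \<phi>] by (auto simp: f_def)
      then show ?thesis using False by simp
    qed
    then show ?thesis using AE_lborel_singleton[of R] by (auto elim: eventually_mono)
  qed
  then have "(\<integral>\<^sup>+x. ennreal (k x * Theta x) * indicator {h..R} x \<partial>lborel) = (\<integral>\<^sup>+x. 4 * (\<integral>\<^sup>+\<phi>. f x \<phi> \<partial>lborel) \<partial>lborel)"
    by (rule nn_integral_cong_AE)
  also have "\<dots> = 4 * (\<integral>\<^sup>+x. (\<integral>\<^sup>+\<phi>. f x \<phi> \<partial>lborel) \<partial>lborel)"
    unfolding f_def by (rule nn_integral_cmult) measurable
  also have "(\<integral>\<^sup>+x. (\<integral>\<^sup>+\<phi>. f x \<phi> \<partial>lborel) \<partial>lborel) = (\<integral>\<^sup>+\<phi>. (\<integral>\<^sup>+x. f x \<phi> \<partial>lborel) \<partial>lborel)"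
    unfolding f_def by (rule lborel_pair.Fubini') measurable
  also have "\<dots> = (\<integral>\<^sup>+\<phi>. ennreal (s \<phi> / r \<phi>) * indicator {0..pi/2} \<phi> *
      (\<integral>\<^sup>+x. ennreal (k x * (x / sqrt ((r \<phi>)^2 - x^2))) * indicator {h..r \<phi>} x \<partial>lborel) \<partial>lborel)"
  proof (intro nn_integral_cong)
    fix \<phi>
    have "f x \<phi> = (ennreal (s \<phi> / r \<phi>) * indicator {0..pi/2} \<phi>) * (ennreal (k x * (x / sqrt ((r \<phi>)^2 - x^2))) * indicator {h..r \<phi>} x)" for x
      by (auto simp: f_def split: split_indicator)
    then show "(\<integral>\<^sup>+x. f x \<phi> \<partial>lborel) = ennreal (s \<phi> / r \<phi>) * indicator {0..pi/2} \<phi> *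
      (\<integral>\<^sup>+x. ennreal (k x * (x / sqrt ((r \<phi>)^2 - x^2))) * indicator {h..r \<phi>} x \<partial>lborel)"
      by (simp add: nn_integral_cmult)
  qed
  finally show ?thesis .
qed

text \<open>Integrated form of \<open>S' = - Theta\<close> with \<open>S\<close> vanishing at
  \<open>R\<close>. Exchanging integrals avoids differentiating \<open>S\<close> under an integral
  whose limit and whose singularity move with \<open>h\<close>.\<close>

lemma Theta_integral:
  assumes h: "h \<in> {0<..<R}"
  shows "(\<integral>\<^sup>+x. ennreal (Theta x) * indicator {h..R} x \<partial>lborel) = ennreal (S h)"
proof -
  have "(\<integral>\<^sup>+x. ennreal (1 * Theta x) * indicator {h..R} x \<partial>lborel) =
    4 * (\<integral>\<^sup>+\<phi>. ennreal (s \<phi> / r \<phi>) * indicator {0..pi/2} \<phi> *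
      (\<integral>\<^sup>+x. ennreal (1 * (x / sqrt ((r \<phi>)^2 - x^2))) * indicator {h..r \<phi>} x \<partial>lborel) \<partial>lborel)"
    by (rule Theta_Tonelli[OF h]) auto
  also have "(\<integral>\<^sup>+\<phi>. ennreal (s \<phi> / r \<phi>) * indicator {0..pi/2} \<phi> *
      (\<integral>\<^sup>+x. ennreal (1 * (x / sqrt ((r \<phi>)^2 - x^2))) * indicator {h..r \<phi>} x \<partial>lborel) \<partial>lborel) =
     (\<integral>\<^sup>+x. ennreal (s x / r x * sqrt ((r x)^2 - h^2)) * indicator {iota h..pi/2} x \<partial>lborel)"
  proof (intro nn_integral_cong)
    fix \<phi>
    consider "\<phi> \<in> {0..pi/2}" "h \<le> r \<phi>" | "\<phi> \<in> {0..pi/2}" "r \<phi> < h" | "\<phi> \<notin> {0..pi/2}" by linarith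
    then show "ennreal (s \<phi> / r \<phi>) * indicator {0..pi/2} \<phi> *
      (\<integral>\<^sup>+x. ennreal (1 * (x / sqrt ((r \<phi>)^2 - x^2))) * indicator {h..r \<phi>} x \<partial>lborel) =
      ennreal (s \<phi> / r \<phi> * sqrt ((r \<phi>)^2 - h^2)) * indicator {iota h..pi/2} \<phi>"
    proof cases
      case 1
      moreover have "iota h \<le> \<phi>" using 1 r_le_iff[of "iota h" \<phi>] iota_h[OF h] by auto
      ultimately show ?thesis using h nn_integral_sqrt_kernel[of h "r \<phi>"] s_pos[of \<phi>]
        by (simp add: ennreal_mult[symmetric] power_mono)
    next
      case 2
      moreover have "\<not> iota h \<le> \<phi>" using 2 r_le_iff[of "iota h" \<phi>] iota_h[OF h] by auto
      ultimately show ?thesis by simp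
    next
      case 3
      then show ?thesis using iota_h[OF h] by (auto split: split_indicator)
    qed
  qed
  also have "\<dots> = ennreal (S h / 4)" by (simp add: S_nn[OF h])
  also have "4 * ennreal (S h / 4) = ennreal 4 * ennreal (S h / 4)" by simp
  also have "\<dots> = ennreal (S h)" using S_nonneg[OF h] by (subst ennreal_mult[symmetric]) auto
  finally show ?thesis by simp
qed

text \<open>The inner integral of \<open>Theta_Tonelli\<close> equals \<open>pi / 2\<close> at every
  latitude above the turning point, so what remains is \<open>4 * (pi / 2)\<close> times the
  integral of \<open>s / r\<close>.\<close>

lemma Theta_abel:
  assumes h: "h \<in> {0<..<R}"
  shows "(\<integral>\<^sup>+x. ennreal (1 / sqrt (x^2 - h^2) * Theta x) * indicator {h..R} x \<partial>lborel) =
    ennreal (2 * pi * integral {iota h..pi/2} (\<lambda>x. s x / r x))"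
proof -
  have cont: "continuous_on {iota h..pi/2} (\<lambda>x. s x / r x)"
    using iota_h_interval[OF h] h by (intro continuous_intros) force
  have nonneg: "0 \<le> s x / r x" if "x \<in> {iota h..pi/2}" for x
    using iota_h_interval[OF h that] h s_pos[of x] by simp
  have "(\<integral>\<^sup>+x. ennreal (1 / sqrt (x^2 - h^2) * Theta x) * indicator {h..R} x \<partial>lborel) =
    4 * (\<integral>\<^sup>+\<phi>. ennreal (s \<phi> / r \<phi>) * indicator {0..pi/2} \<phi> *
      (\<integral>\<^sup>+x. ennreal (1 / sqrt (x^2 - h^2) * (x / sqrt ((r \<phi>)^2 - x^2))) * indicator {h..r \<phi>} x \<partial>lborel) \<partial>lborel)"
  proof (rule Theta_Tonelli[OF h])
    show "(\<lambda>x. 1 / sqrt (x\<^sup>2 - h\<^sup>2)) \<in> borel_measurable borel" by measurable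
    show "0 \<le> 1 / sqrt (x\<^sup>2 - h\<^sup>2)" if "x \<in> {h..R}" for x using that h by (simp add: power_mono)
  qed
  also have "(\<integral>\<^sup>+\<phi>. ennreal (s \<phi> / r \<phi>) * indicator {0..pi/2} \<phi> *
      (\<integral>\<^sup>+x. ennreal (1 / sqrt (x^2 - h^2) * (x / sqrt ((r \<phi>)^2 - x^2))) * indicator {h..r \<phi>} x \<partial>lborel) \<partial>lborel) =
     (\<integral>\<^sup>+x. ennreal (pi/2) * (ennreal (s x / r x) * indicator {iota h..pi/2} x) \<partial>lborel)"
  proof (intro nn_integral_cong_AE)
    \<comment> \<open>At the turning latitude itself the inner interval shrinks to a point and the
      inner integral is 0 rather than \<open>pi / 2\<close>.\<close>
    have "ennreal (s \<phi> / r \<phi>) * indicator {0..pi/2} \<phi> *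
      (\<integral>\<^sup>+x. ennreal (1 / sqrt (x^2 - h^2) * (x / sqrt ((r \<phi>)^2 - x^2))) * indicator {h..r \<phi>} x \<partial>lborel) =
      ennreal (pi/2) * (ennreal (s \<phi> / r \<phi>) * indicator {iota h..pi/2} \<phi>)" if ne: "\<phi> \<noteq> iota h" for \<phi>
    proof -
    consider "\<phi> \<in> {0..pi/2}" "h < r \<phi>" | "\<phi> \<in> {0..pi/2}" "r \<phi> = h" | "\<phi> \<in> {0..pi/2}" "r \<phi> < h" | "\<phi> \<notin> {0..pi/2}" by linarith
    then show ?thesis
    proof cases
      case 1
      moreover have "iota h \<le> \<phi>" using 1 r_le_iff[of "iota h" \<phi>] iota_h[OF h] by auto
      ultimately show ?thesis using h nn_integral_abel_kernel[of h "r \<phi>"]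
        by (simp add: mult.commute)
    next
      case 2
      then show ?thesis using iota_r[of \<phi>] ne by auto
    next
      case 3
      moreover have "\<not> iota h \<le> \<phi>" using 3 r_le_iff[of "iota h" \<phi>] iota_h[OF h] by auto
      ultimately show ?thesis by simp
    next
      case 4
      then show ?thesis using iota_h[OF h] by (auto split: split_indicator)
    qed
    qed
    then show "AE \<phi> in lborel. ennreal (s \<phi> / r \<phi>) * indicator {0..pi/2} \<phi> *
      (\<integral>\<^sup>+x. ennreal (1 / sqrt (x^2 - h^2) * (x / sqrt ((r \<phi>)^2 - x^2))) * indicator {h..r \<phi>} x \<partial>lborel) =
      ennreal (pi/2) * (ennreal (s \<phi> / r \<phi>) * indicator {iota h..pi/2} \<phi>)"
      using AE_lborel_singleton[of "iota h"] by (auto elim: eventually_mono)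
  qed
  also have "\<dots> = ennreal (pi/2) * ennreal (integral {iota h..pi/2} (\<lambda>x. s x / r x))"
    using nn_integral_continuous_Icc[OF cont nonneg] by (subst nn_integral_cmult) auto
  also have "4 * (ennreal (pi/2) * ennreal (integral {iota h..pi/2} (\<lambda>x. s x / r x))) =
     ennreal (4 * (pi/2 * integral {iota h..pi/2} (\<lambda>x. s x / r x)))"
  proof -
    have "0 \<le> integral {iota h..pi/2} (\<lambda>x. s x / r x)"
      by (rule integral_nonneg) (auto intro: integrable_continuous_interval cont nonneg)
    then have "ennreal (4 * (pi/2 * integral {iota h..pi/2} (\<lambda>x. s x / r x))) =
       ennreal 4 * (ennreal (pi/2) * ennreal (integral {iota h..pi/2} (\<lambda>x. s x / r x)))"
      by (simp only: ennreal_mult mult_nonneg_nonneg pi_ge_zero zero_le_numeral divide_nonneg_nonneg)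
    then show ?thesis by simp
  qed
  finally show ?thesis by (simp add: mult.assoc)
qed

end

section \<open>Dependence of advance and action on the Clairaut constant\<close>

context profile
begin

text \<open>The squared radius \<open>u\<close> is the variable in which the later substitution is
  affine. \<open>J\<close> inverts \<open>r^2\<close> on the southern hemisphere, \<open>W u\<close>
  is \<open>w (sqrt u) / u\<close>, and \<open>W'\<close> is its derivative.\<close>

definition J where "J u = iota (sqrt u)"
definition W where "W u = s (J u) / r' (J u) / u"
definition W' where "W' u = ((s' (J u) * r' (J u) - s (J u) * r'' (J u)) / (r' (J u) * r' (J u)) * (1 / r' (J u) * (inverse (sqrt u) / 2)) * u
   - s (J u) / r' (J u)) / (u * u)"

lemma sqrt_interval: "u \<in> {0<..<R^2} \<Longrightarrow> sqrt u \<in> {0<..<R}"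
  using R_pos by (auto simp: real_less_lsqrt)

lemma d_J: "u \<in> {0<..<R^2} \<Longrightarrow> (J has_real_derivative 1 / r' (J u) * (inverse (sqrt u) / 2)) (at u)"
  unfolding J_def
  by (rule DERIV_chain2[where f = iota and g = sqrt, OF d_iota[OF sqrt_interval]])
    (auto intro!: derivative_eq_intros simp: inverse_eq_divide)

lemma r_J: "u \<in> {0<..<R^2} \<Longrightarrow> r (J u) = sqrt u"
  and r'_J: "u \<in> {0<..<R^2} \<Longrightarrow> r' (J u) > 0"
  using iota_interior[OF sqrt_interval, of u] r_iota[of "sqrt u"] sqrt_interval[of u] r'_pos[of "J u"] by (auto simp: J_def)

lemma cont_J: "continuous_on {0<..<R^2} J"
  using d_J DERIV_isCont by (intro continuous_at_imp_continuous_on) blast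

lemma cont_W: "continuous_on {0<..<R^2} W"
  unfolding W_def using r'_J by (intro continuous_intros cont_J) force+

lemma cont_W': "continuous_on {0<..<R^2} W'"
  unfolding W'_def using r'_J
  by (intro continuous_intros cont_J continuous_on_compose2[OF cr'' _ subset_UNIV] continuous_on_compose2[OF cs' _ subset_UNIV]) force+

lemma d_W: "u \<in> {0<..<R^2} \<Longrightarrow> (W has_real_derivative W' u) (at u)"
proof -
  assume u: "u \<in> {0<..<R^2}"
  have "((\<lambda>x. s x / r' x) has_real_derivative (s' (J u) * r' (J u) - s (J u) * r'' (J u)) / (r' (J u) * r' (J u))) (at (J u))"
    using r'_J[OF u] by (intro DERIV_divide ds dr') simp
  from DERIV_chain2[OF this d_J[OF u]]
  have "((\<lambda>u. s (J u) / r' (J u)) has_real_derivative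
    (s' (J u) * r' (J u) - s (J u) * r'' (J u)) / (r' (J u) * r' (J u)) * (1 / r' (J u) * (inverse (sqrt u) / 2))) (at u)" .
  from DERIV_divide[OF this DERIV_ident] u
  show ?thesis unfolding W_def W'_def by simp
qed

text \<open>Splitting the rotation integral at a fixed radius \<open>c > h\<close>: on the inner part the substitution
  \<open>r\<^sup>2 = h\<^sup>2 + (c\<^sup>2 - h\<^sup>2) * y\<^sup>2\<close> removes the moving singularity, while the outer part is regular in \<open>h\<close>.\<close>

lemma inner_arg: "h \<in> {0<..<c} \<Longrightarrow> c < R \<Longrightarrow> y \<in> {0..1} \<Longrightarrow> h^2 + (c^2 - h^2) * y^2 \<in> {0<..<R^2}"
proof -
  assume a: "h \<in> {0<..<c}" "c < R" "y \<in> {0..1}"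
  then have lt: "h^2 < c^2" "c^2 < R^2" "0 < h^2" by (auto intro!: power_strict_mono)
  have "0 \<le> y^2" "y^2 \<le> 1" using a by (auto simp: power_le_one)
  then have "0 \<le> (c^2 - h^2) * y^2" "(c^2 - h^2) * y^2 \<le> (c^2 - h^2) * 1"
    using lt by (auto intro!: mult_left_mono)
  moreover define t where "t = (c^2 - h^2) * y^2"
  ultimately have "0 \<le> t" "t \<le> c^2 - h^2" by simp_all
  then show ?thesis using lt unfolding t_def[symmetric] greaterThanLessThan_iff by (intro conjI; linarith)
qed

lemma Theta_split:
  assumes h: "h \<in> {0<..<c}" and c: "c < R"
  shows "Theta h / 4 = h * sqrt (c^2 - h^2) * integral {0..1} (\<lambda>y. W (h^2 + (c^2 - h^2) * y^2)) +
     h * integral {iota c..pi/2} (\<lambda>x. 1 / sqrt ((r x)^2 - h^2) * (s x / r x))"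
proof -
  have hR: "h \<in> {0<..<R}" and cR: "c \<in> {0<..<R}" using h c by auto
  define G where "G = (\<lambda>x. h * s x / (r x * sqrt ((r x)^2 - h^2)))"
  have [measurable]: "G \<in> borel_measurable borel" unfolding G_def by measurable
  define g where "g = (\<lambda>y. J (h^2 + (c^2 - h^2) * y^2))"
  define g' where "g' = (\<lambda>y. 1 / r' (g y) * (inverse (sqrt (h^2 + (c^2 - h^2) * y^2)) / 2) * ((c^2 - h^2) * (2 * y)))"
  have lt: "h^2 < c^2" using h by (auto intro!: power_strict_mono)
  have le: "iota h < iota c" using iota_less[of h c] h c by auto
  have cle: "iota c \<le> pi/2" using iota_h[OF cR] by auto
  have g01: "g 0 = iota h" "g 1 = iota c" using h cR by (auto simp: g_def J_def)
  have arg: "h^2 + (c^2 - h^2) * y^2 \<in> {0<..<R^2}" if "y \<in> {0..1}" for y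
    using inner_arg[OF h c that] .
  have contarg: "continuous_on {0..1} (\<lambda>y. h^2 + (c^2 - h^2) * y^2)" by (intro continuous_intros)
  have contg: "continuous_on {0..1} g"
    unfolding g_def by (rule continuous_on_compose2[OF cont_J contarg]) (use arg in auto)
  have contW: "continuous_on {0..1} (\<lambda>y. W (h^2 + (c^2 - h^2) * y^2))"
    by (rule continuous_on_compose2[OF cont_W contarg]) (use arg in auto)
  have W0: "0 \<le> W (h^2 + (c^2 - h^2) * y^2)" if "y \<in> {0..1}" for y
    using r'_J[OF arg[OF that]] arg[OF that] s_pos[of "J (h^2 + (c^2 - h^2) * y^2)"] by (simp add: W_def)
  have sq: "0 \<le> h * sqrt (c^2 - h^2)" using h lt by simp
  have inner: "(\<integral>\<^sup>+x. ennreal (G x) * indicator {iota h..iota c} x \<partial>lborel) =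
     ennreal (h * sqrt (c^2 - h^2) * integral {0..1} (\<lambda>y. W (h^2 + (c^2 - h^2) * y^2)))"
  proof -
    have "(\<integral>\<^sup>+x. ennreal (G x) * indicator {iota h..iota c} x \<partial>lborel) =
      (\<integral>\<^sup>+x. ennreal (G x * indicator {g 0..g 1} x) \<partial>lborel)"
      by (intro nn_integral_cong) (auto simp: g01 split: split_indicator)
    also have "\<dots> = (\<integral>\<^sup>+x. ennreal (G (g x) * g' x * indicator {0..1} x) \<partial>lborel)"
    proof (rule nn_integral_substitution)
      show "set_borel_measurable borel {g 0..g 1} G" unfolding set_borel_measurable_def by measurable
      fix y :: real assume y: "y \<in> {0..1}"
      show "(g has_real_derivative g' y) (at y)"
        unfolding g_def g'_def by (rule DERIV_chain2[where f = J and g = "\<lambda>y. h^2 + (c^2 - h^2) * y^2", OF d_J[OF arg[OF y]]]) (auto intro!: derivative_eq_intros)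
      show "0 \<le> g' y" using r'_J[OF arg[OF y]] y lt arg[OF y] by (auto simp: g'_def g_def intro!: mult_nonneg_nonneg)
    next
      show "continuous_on {0..1} g'"
        unfolding g'_def
      proof (intro continuous_intros contg ballI)
        fix y :: real assume y: "y \<in> {0..1}"
        show "r' (g y) \<noteq> 0" using r'_J[OF arg[OF y]] by (simp add: g_def)
        show "sqrt (h\<^sup>2 + (c\<^sup>2 - h\<^sup>2) * y\<^sup>2) \<noteq> 0" using arg[OF y] by simp
      qed auto
    qed simp
    also have "\<dots> = (\<integral>\<^sup>+x. ennreal (h * sqrt (c^2 - h^2)) * (ennreal (W (h^2 + (c^2 - h^2) * x^2)) * indicator {0..1} x) \<partial>lborel)"
    proof (rule nn_integral_cong_AE)
      \<comment> \<open>Since \<open>r^2 - h^2\<close> becomes \<open>(c^2 - h^2) * y^2\<close>, the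
        singular factor \<open>y\<close> in the denominator cancels against the \<open>y\<close> in
        the derivative of the substitution.\<close>
      have eq: "G (g y) * g' y = h * sqrt (c^2 - h^2) * W (h^2 + (c^2 - h^2) * y^2)" if y: "y \<in> {0<..1}" for y
      proof -
        define u where "u = h^2 + (c^2 - h^2) * y^2"
        have u: "u \<in> {0<..<R^2}" using arg[of y] y by (auto simp: u_def)
        have ru: "r (g y) = sqrt u" using r_J[OF u] by (simp add: g_def u_def)
        have k: "sqrt ((sqrt u)^2 - h^2) = sqrt (c^2 - h^2) * y"
          using u y by (simp add: u_def real_sqrt_mult)
        have gu: "g y = J u" by (simp add: g_def u_def)
        have d: "c^2 - h^2 = sqrt (c^2 - h^2) * sqrt (c^2 - h^2)" using lt by simp
        have "G (g y) * g' y = h * s (J u) / (sqrt u * (sqrt (c^2 - h^2) * y)) * (1 / r' (J u) * (inverse (sqrt u) / 2) * ((sqrt (c^2 - h^2) * sqrt (c^2 - h^2)) * (2 * y)))"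
          unfolding G_def g'_def ru k d[symmetric] by (simp add: gu u_def)
        also have "\<dots> = h * sqrt (c^2 - h^2) * (s (J u) / r' (J u) / (sqrt u * sqrt u))"
        proof -
          have gen: "h * a / (v * (K * y)) * (1 / b * (inverse v / 2) * ((K * K) * (2 * y))) = h * K * (a / b / (v * v))"
            if "v \<noteq> 0" "K \<noteq> 0" "y \<noteq> 0" "b \<noteq> 0" for a b v K :: real
            using that by (simp add: field_simps)
          show ?thesis by (rule gen) (use y lt u r'_J[OF u] in auto)
        qed
        also have "sqrt u * sqrt u = u" using u by simp
        finally show ?thesis by (simp add: W_def u_def)
      qed
      have "ennreal (G (g y) * g' y * indicator {0..1} y) =
        ennreal (h * sqrt (c^2 - h^2)) * (ennreal (W (h^2 + (c^2 - h^2) * y^2)) * indicator {0..1} y)" if "y \<noteq> 0" for y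
        using that eq[of y] W0[of y] sq by (auto simp: ennreal_mult split: split_indicator)
      then show "AE y in lborel. ennreal (G (g y) * g' y * indicator {0..1} y) =
        ennreal (h * sqrt (c^2 - h^2)) * (ennreal (W (h^2 + (c^2 - h^2) * y^2)) * indicator {0..1} y)"
        using AE_lborel_singleton[of "0::real"] by (auto elim: eventually_mono)
    qed
    also have "\<dots> = ennreal (h * sqrt (c^2 - h^2)) * (\<integral>\<^sup>+x. ennreal (W (h^2 + (c^2 - h^2) * x^2)) * indicator {0..1} x \<partial>lborel)"
    proof (rule nn_integral_cmult)
      have "(\<lambda>x. ennreal (W (h^2 + (c^2 - h^2) * x^2)) * indicator {0..1} x) =
        (\<lambda>x. ennreal (indicator {0..1} x *\<^sub>R W (h^2 + (c^2 - h^2) * x^2)))"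
        by (auto split: split_indicator)
      moreover have "(\<lambda>x. indicator {0..1} x *\<^sub>R W (h^2 + (c^2 - h^2) * x^2)) \<in> borel_measurable borel"
        by (rule borel_measurable_continuous_on_indicator[OF _ contW]) auto
      ultimately show "(\<lambda>x. ennreal (W (h^2 + (c^2 - h^2) * x^2)) * indicator {0..1} x) \<in> borel_measurable lborel"
        by simp
    qed
    also have "\<dots> = ennreal (h * sqrt (c^2 - h^2)) * ennreal (integral {0..1} (\<lambda>y. W (h^2 + (c^2 - h^2) * y^2)))"
      by (subst nn_integral_continuous_Icc[OF contW W0]) auto
    also have "\<dots> = ennreal (h * sqrt (c^2 - h^2) * integral {0..1} (\<lambda>y. W (h^2 + (c^2 - h^2) * y^2)))"
      by (rule ennreal_mult[symmetric, OF sq])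
        (auto intro!: integral_nonneg integrable_continuous_interval contW W0)
    finally show ?thesis .
  qed
  have rc: "h < r x" if "x \<in> {iota c..pi/2}" for x using iota_h_interval[OF cR that] h by simp
  have pos: "0 < (r x)^2 - h^2" if "x \<in> {iota c..pi/2}" for x
    using rc[OF that] h by (simp add: power_strict_mono)
  have contG: "continuous_on {iota c..pi/2} G"
    unfolding G_def
  proof (intro continuous_intros ballI)
    fix x assume x: "x \<in> {iota c..pi/2}"
    show "r x * sqrt ((r x)\<^sup>2 - h\<^sup>2) \<noteq> 0" using rc[OF x] pos[OF x] h by simp
  qed
  have G0: "0 \<le> G x" if "x \<in> {iota c..pi/2}" for x
    unfolding G_def using rc[OF that] pos[OF that] h s_pos[of x] by simp
  have "ennreal (Theta h / 4) = (\<integral>\<^sup>+x. ennreal (G x) * indicator {iota h..pi/2} x \<partial>lborel)"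
    unfolding G_def by (rule Theta_nn[OF hR])
  also have "\<dots> = (\<integral>\<^sup>+x. ennreal (G x) * indicator {iota h..iota c} x + ennreal (G x) * indicator {iota c..pi/2} x \<partial>lborel)"
  proof (rule nn_integral_cong_AE)
    have "ennreal (G x) * indicator {iota h..pi/2} x = ennreal (G x) * indicator {iota h..iota c} x + ennreal (G x) * indicator {iota c..pi/2} x"
      if "x \<noteq> iota c" for x using that le cle by (auto split: split_indicator)
    then show "AE x in lborel. ennreal (G x) * indicator {iota h..pi/2} x = ennreal (G x) * indicator {iota h..iota c} x + ennreal (G x) * indicator {iota c..pi/2} x"
      using AE_lborel_singleton[of "iota c"] by (auto elim: eventually_mono)
  qed
  also have "\<dots> = (\<integral>\<^sup>+x. ennreal (G x) * indicator {iota h..iota c} x \<partial>lborel) + (\<integral>\<^sup>+x. ennreal (G x) * indicator {iota c..pi/2} x \<partial>lborel)"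
    by (rule nn_integral_add) auto
  also have "\<dots> = ennreal (h * sqrt (c^2 - h^2) * integral {0..1} (\<lambda>y. W (h^2 + (c^2 - h^2) * y^2))) + ennreal (integral {iota c..pi/2} G)"
    unfolding inner by (subst nn_integral_continuous_Icc[OF contG G0]) auto
  also have "\<dots> = ennreal (h * sqrt (c^2 - h^2) * integral {0..1} (\<lambda>y. W (h^2 + (c^2 - h^2) * y^2)) + integral {iota c..pi/2} G)"
    by (rule ennreal_plus[symmetric]; intro mult_nonneg_nonneg sq integral_nonneg integrable_continuous_interval contW W0 contG G0)
  finally have "Theta h / 4 = h * sqrt (c^2 - h^2) * integral {0..1} (\<lambda>y. W (h^2 + (c^2 - h^2) * y^2)) + integral {iota c..pi/2} G"
    using Theta_pos[OF hR]
    by (subst (asm) ennreal_inj) (auto intro!: add_nonneg_nonneg mult_nonneg_nonneg sq integral_nonneg integrable_continuous_interval contW W0 contG G0)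
  moreover have "integral {iota c..pi/2} G = h * integral {iota c..pi/2} (\<lambda>x. 1 / sqrt ((r x)^2 - h^2) * (s x / r x))"
  proof -
    have "G = (\<lambda>x. h * (1 / sqrt ((r x)^2 - h^2) * (s x / r x)))" by (simp add: G_def fun_eq_iff)
    then show ?thesis by (simp only: integral_mult_right)
  qed
  ultimately show ?thesis by simp
qed

text \<open>Both parts of \<open>Theta_split\<close> are integrals over fixed intervals of
  integrands that are continuously differentiable in \<open>h\<close>, so the Leibniz rule applies.
  Continuity of \<open>r''\<close> and \<open>s'\<close> enters through \<open>W'\<close>.\<close>

lemma Theta_differentiable:
  assumes h0: "h0 \<in> {0<..<R}"
  shows "Theta differentiable (at h0)"
proof -
  \<comment> \<open>Any radius strictly between \<open>h0\<close> and \<open>R\<close> would do; the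
    splitting is then valid on the neighbourhood \<open>{0<..<c}\<close> of
    \<open>h0\<close>.\<close>
  define c where "c = (h0 + R) / 2"
  have c: "h0 < c" "c < R" "0 < c" "c \<in> {0<..<R}" using h0 by (auto simp: c_def)
  let ?U = "{0<..<c}"
  have U: "h0 \<in> ?U" "convex ?U" "open ?U" using h0 c by auto
  define I1 where "I1 = (\<lambda>h. integral (cbox 0 1) (\<lambda>y. W (h^2 + (c^2 - h^2) * y^2)))"
  define I2 where "I2 = (\<lambda>h. integral (cbox (iota c) (pi/2)) (\<lambda>x. 1 / sqrt ((r x)^2 - h^2) * (s x / r x)))"
  have d1: "(I1 has_real_derivative integral (cbox 0 1) (\<lambda>y. W' (h0^2 + (c^2 - h0^2) * y^2) * (2 * h0 - 2 * h0 * y^2))) (at h0 within ?U)"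
    unfolding I1_def
  proof (rule leibniz_rule_field_derivative[OF _ _ _ U(1,2)])
    fix h y :: real assume h: "h \<in> ?U" and y: "y \<in> cbox 0 1"
    have a: "((\<lambda>h. h^2 + (c^2 - h^2) * y^2) has_real_derivative 2 * h - 2 * h * y^2) (at h)"
      by (rule DERIV_cong, (rule derivative_intros)+) simp
    have "((\<lambda>h. W (h^2 + (c^2 - h^2) * y^2)) has_real_derivative W' (h^2 + (c^2 - h^2) * y^2) * (2 * h - 2 * h * y^2)) (at h)"
      using DERIV_chain2[where f = W, OF d_W[OF inner_arg[OF h c(2), of y]] a] y by simp
    then show "((\<lambda>h. W (h^2 + (c^2 - h^2) * y^2)) has_real_derivative W' (h^2 + (c^2 - h^2) * y^2) * (2 * h - 2 * h * y^2)) (at h within ?U)"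
      by (rule has_field_derivative_at_within)
  next
    fix h assume h: "h \<in> ?U"
    have "continuous_on {0..1} (\<lambda>y. W (h^2 + (c^2 - h^2) * y^2))"
    proof (rule continuous_on_compose2[OF cont_W])
      show "continuous_on {0..1} (\<lambda>y. h^2 + (c^2 - h^2) * y^2)" by (intro continuous_intros)
      show "(\<lambda>y. h^2 + (c^2 - h^2) * y^2) ` {0..1} \<subseteq> {0<..<R^2}"
        using inner_arg[OF h c(2)] by blast
    qed
    then show "(\<lambda>y. W (h^2 + (c^2 - h^2) * y^2)) integrable_on cbox 0 1"
      by (simp add: integrable_continuous_interval)
  next
    have "continuous_on (?U \<times> cbox 0 1) (\<lambda>p. W' ((fst p)^2 + (c^2 - (fst p)^2) * (snd p)^2) * (2 * fst p - 2 * fst p * (snd p)^2))"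
    proof (intro continuous_intros continuous_on_compose2[OF cont_W'])
      show "(\<lambda>p. (fst p)\<^sup>2 + (c\<^sup>2 - (fst p)\<^sup>2) * (snd p)\<^sup>2) ` (?U \<times> cbox 0 1) \<subseteq> {0<..<R\<^sup>2}"
      proof
        fix z assume "z \<in> (\<lambda>p. (fst p)\<^sup>2 + (c\<^sup>2 - (fst p)\<^sup>2) * (snd p)\<^sup>2) ` (?U \<times> cbox 0 1)"
        then obtain p where p: "p \<in> ?U \<times> cbox 0 1" "z = (fst p)\<^sup>2 + (c\<^sup>2 - (fst p)\<^sup>2) * (snd p)\<^sup>2" by blast
        have "fst p \<in> ?U" "snd p \<in> {0..1}" using p(1) by (auto simp: mem_Times_iff)
        then show "z \<in> {0<..<R\<^sup>2}" unfolding p(2) by (rule inner_arg[OF _ c(2)])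
      qed
    qed
    then show "continuous_on (?U \<times> cbox 0 1) (\<lambda>(h, y). W' (h^2 + (c^2 - h^2) * y^2) * (2 * h - 2 * h * y^2))"
      unfolding case_prod_unfold .
  qed
  have rc: "h < r x" "0 < (r x)^2 - h^2" if x: "x \<in> {iota c..pi/2}" and h: "h \<in> ?U" for x h
  proof -
    show "h < r x" using iota_h_interval[OF c(4) x] h by simp
    then have "h^2 < (r x)^2" using h by (intro power_strict_mono) simp_all
    then show "0 < (r x)^2 - h^2" by simp
  qed
  have d2: "(I2 has_real_derivative integral (cbox (iota c) (pi/2)) (\<lambda>x. h0 / (sqrt ((r x)^2 - h0^2))^3 * (s x / r x))) (at h0 within ?U)"
    unfolding I2_def
  proof (rule leibniz_rule_field_derivative[OF _ _ _ U(1,2)])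
    fix h x assume h: "h \<in> ?U" and x: "x \<in> cbox (iota c) (pi/2)"
    have p: "0 < (r x)^2 - h^2" by (rule rc(2)) (use x h in simp_all)
    have e0: "((\<lambda>h. (r x)^2 - h^2) has_real_derivative - (2 * h)) (at h)"
      by (auto intro!: derivative_eq_intros)
    have e1: "((\<lambda>h. sqrt ((r x)^2 - h^2)) has_real_derivative - h / sqrt ((r x)^2 - h^2)) (at h)"
      by (rule DERIV_cong[OF DERIV_chain2[where f = sqrt, OF DERIV_real_sqrt[OF p] e0]]) (simp add: field_simps)
    have e2: "((\<lambda>h. 1 / sqrt ((r x)^2 - h^2)) has_real_derivative h / (sqrt ((r x)^2 - h^2))^3) (at h)"
    proof (rule DERIV_cong[OF DERIV_divide[OF DERIV_const e1]])
      show "sqrt ((r x)^2 - h^2) \<noteq> 0" using p by simp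
      show "(0 * sqrt ((r x)^2 - h^2) - 1 * (- h / sqrt ((r x)^2 - h^2))) / (sqrt ((r x)^2 - h^2) * sqrt ((r x)^2 - h^2)) =
        h / (sqrt ((r x)^2 - h^2))^3"
        by (simp only: power3_eq_cube) simp
    qed
    show "((\<lambda>h. 1 / sqrt ((r x)^2 - h^2) * (s x / r x)) has_real_derivative h / (sqrt ((r x)^2 - h^2))^3 * (s x / r x)) (at h within ?U)"
      by (rule has_field_derivative_at_within[OF DERIV_cmult_right[OF e2]])
  next
    fix h assume h: "h \<in> ?U"
    have "continuous_on {iota c..pi/2} (\<lambda>x. 1 / sqrt ((r x)^2 - h^2) * (s x / r x))"
    proof (intro continuous_intros ballI)
      fix x assume x: "x \<in> {iota c..pi/2}"
      show "sqrt ((r x)\<^sup>2 - h\<^sup>2) \<noteq> 0" "r x \<noteq> 0" using rc[OF x h] h by simp_all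
    qed
    then show "(\<lambda>x. 1 / sqrt ((r x)^2 - h^2) * (s x / r x)) integrable_on cbox (iota c) (pi/2)"
      by (simp add: integrable_continuous_interval)
  next
    have "continuous_on (?U \<times> cbox (iota c) (pi/2)) (\<lambda>p. fst p / (sqrt ((r (snd p))^2 - (fst p)^2))^3 * (s (snd p) / r (snd p)))"
    proof (intro continuous_intros ballI)
      fix p assume "p \<in> ?U \<times> cbox (iota c) (pi/2)"
      then have p: "snd p \<in> {iota c..pi/2}" "fst p \<in> ?U" by auto
      show "sqrt ((r (snd p))\<^sup>2 - (fst p)\<^sup>2) ^ 3 \<noteq> 0" "r (snd p) \<noteq> 0" using rc[OF p] p by simp_all
    qed
    then show "continuous_on (?U \<times> cbox (iota c) (pi/2)) (\<lambda>(h, x). h / (sqrt ((r x)^2 - h^2))^3 * (s x / r x))"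
      unfolding case_prod_unfold .
  qed
  have D1: "I1 differentiable (at h0)" and D2: "I2 differentiable (at h0)"
    using d1 d2 unfolding real_differentiable_def at_within_open[OF U(1,3)] by - (rule exI, assumption)+
  have "h0^2 < c^2" using h0 c by (intro power_strict_mono) auto
  then have "0 < c^2 - h0^2" by simp
  moreover have "((\<lambda>h. c^2 - h^2) has_real_derivative - (2 * h0)) (at h0)"
    by (auto intro!: derivative_eq_intros)
  ultimately have "((\<lambda>h. sqrt (c^2 - h^2)) has_real_derivative inverse (sqrt (c^2 - h0^2)) / 2 * - (2 * h0)) (at h0)"
    by (intro DERIV_chain2[where f = sqrt and g = "\<lambda>h. c^2 - h^2", OF DERIV_real_sqrt])
  then have D3: "(\<lambda>h. sqrt (c^2 - h^2)) differentiable (at h0)"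
    unfolding real_differentiable_def by (rule exI)
  have "(\<lambda>h. 4 * (h * sqrt (c^2 - h^2) * I1 h + h * I2 h)) differentiable (at h0)"
    by (intro differentiable_mult differentiable_add differentiable_ident differentiable_const D1 D2 D3)
  then obtain D where D: "((\<lambda>h. 4 * (h * sqrt (c^2 - h^2) * I1 h + h * I2 h)) has_derivative D) (at h0)"
    unfolding differentiable_def by blast
  have "(Theta has_derivative D) (at h0)"
  proof (rule has_derivative_transform_within_open[OF D U(3,1)])
    show "4 * (h * sqrt (c^2 - h^2) * I1 h + h * I2 h) = Theta h" if "h \<in> ?U" for h
      using Theta_split[OF that c(2)] by (simp add: I1_def I2_def)
  qed
  then show ?thesis
    unfolding differentiable_def by blast
qed

lemma Theta_cont: "A \<subseteq> {0<..<R} \<Longrightarrow> continuous_on A Theta"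
  using Theta_differentiable by (intro continuous_at_imp_continuous_on ballI differentiable_imp_continuous_within) auto

lemma S_diff:
  assumes "0 < h" "h \<le> c" "c < R"
  shows "S h = integral {h..c} Theta + S c"
proof -
  have hR: "h \<in> {0<..<R}" and cR: "c \<in> {0<..<R}" using assms by auto
  have cont: "continuous_on {h..c} Theta" using assms by (intro Theta_cont) auto
  have nn: "0 \<le> Theta x" if "x \<in> {h..c}" for x using Theta_pos[of x] that assms by auto
  \<comment> \<open>Continuity of \<open>Theta\<close> is known below \<open>R\<close> only;
    measurability up to \<open>R\<close> follows by splitting off the single point
    \<open>R\<close>.\<close>
  have m: "(\<lambda>x. ennreal (Theta x) * indicator {h..R} x) \<in> borel_measurable lborel" if h: "h \<in> {0<..<R}" for h
  proof -
    have "(\<lambda>x. indicator {h..<R} x *\<^sub>R Theta x) \<in> borel_measurable borel"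
      using h by (intro borel_measurable_continuous_on_indicator Theta_cont) auto
    then have "(\<lambda>x. ennreal (indicator {h..<R} x *\<^sub>R Theta x) + ennreal (Theta R) * indicator {R} x) \<in> borel_measurable borel"
      by measurable
    moreover have "(\<lambda>x. ennreal (indicator {h..<R} x *\<^sub>R Theta x) + ennreal (Theta R) * indicator {R} x) = (\<lambda>x. ennreal (Theta x) * indicator {h..R} x)"
      using h by (auto simp: fun_eq_iff split: split_indicator)
    ultimately show ?thesis by simp
  qed
  have "ennreal (S h) = (\<integral>\<^sup>+x. ennreal (Theta x) * indicator {h..R} x \<partial>lborel)"
    by (simp add: Theta_integral[OF hR])
  also have "\<dots> = (\<integral>\<^sup>+x. ennreal (Theta x) * indicator {h..c} x + ennreal (Theta x) * indicator {c..R} x \<partial>lborel)"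
  proof (rule nn_integral_cong_AE)
    have "ennreal (Theta x) * indicator {h..R} x = ennreal (Theta x) * indicator {h..c} x + ennreal (Theta x) * indicator {c..R} x"
      if "x \<noteq> c" for x using that assms by (auto split: split_indicator)
    then show "AE x in lborel. ennreal (Theta x) * indicator {h..R} x = ennreal (Theta x) * indicator {h..c} x + ennreal (Theta x) * indicator {c..R} x"
      using AE_lborel_singleton[of c] by (auto elim: eventually_mono)
  qed
  also have "\<dots> = (\<integral>\<^sup>+x. ennreal (Theta x) * indicator {h..c} x \<partial>lborel) + (\<integral>\<^sup>+x. ennreal (Theta x) * indicator {c..R} x \<partial>lborel)"
  proof (rule nn_integral_add)
    have "(\<lambda>x. ennreal (Theta x) * indicator {h..c} x) = (\<lambda>x. ennreal (Theta x) * indicator {h..R} x * indicator {h..c} x)"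
      using assms by (auto simp: fun_eq_iff split: split_indicator)
    then show "(\<lambda>x. ennreal (Theta x) * indicator {h..c} x) \<in> borel_measurable lborel"
      using m[OF hR] by simp
  qed (rule m[OF cR])
  also have "\<dots> = ennreal (integral {h..c} Theta) + ennreal (S c)"
    by (simp only: Theta_integral[OF cR] nn_integral_continuous_Icc[OF cont nn])
  also have "\<dots> = ennreal (integral {h..c} Theta + S c)"
    by (intro ennreal_plus[symmetric] S_nonneg[OF cR] integral_nonneg integrable_continuous_interval cont nn)
  finally show ?thesis
    by (subst (asm) ennreal_inj) (auto intro!: add_nonneg_nonneg S_nonneg[OF cR] S_nonneg[OF hR] integral_nonneg integrable_continuous_interval cont nn)
qed

lemma S_deriv:
  assumes h0: "h0 \<in> {0<..<R}"
  shows "(S has_real_derivative - Theta h0) (at h0)"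
proof -
  define c where "c = (h0 + R) / 2"
  define b where "b = h0 / 2"
  have c: "h0 < c" "c < R" "0 < b" "b < h0" using h0 by (auto simp: c_def b_def)
  have "((\<lambda>u. integral {u..c} Theta) has_real_derivative - Theta h0) (at h0 within {b..c})"
    using c by (intro integral_has_real_derivative' Theta_cont) auto
  then have "((\<lambda>u. integral {u..c} Theta) has_real_derivative - Theta h0) (at h0)"
    using c by (simp add: at_within_Icc_at)
  then have "((\<lambda>u. integral {u..c} Theta + S c) has_real_derivative - Theta h0) (at h0)"
    by (auto intro!: derivative_eq_intros)
  then show ?thesis
  proof (rule has_field_derivative_transform_within_open)
    show "open {b<..<c}" "h0 \<in> {b<..<c}" using c by auto
    show "integral {x..c} Theta + S c = S x" if "x \<in> {b<..<c}" for x
      using S_diff[of x c] that c by auto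
  qed
qed

lemma S_antimono: "0 < h \<Longrightarrow> h \<le> c \<Longrightarrow> c < R \<Longrightarrow> S c \<le> S h"
proof -
  assume a: "0 < h" "h \<le> c" "c < R"
  have "0 \<le> integral {h..c} Theta"
  proof (rule integral_nonneg)
    show "Theta integrable_on {h..c}" using a by (intro integrable_continuous_interval Theta_cont) auto
    show "0 \<le> Theta x" if "x \<in> {h..c}" for x using Theta_pos[of x] that a by auto
  qed
  then show ?thesis using S_diff[OF a] by simp
qed

lemma S_le:
  assumes h: "h \<in> {0<..<R}"
  shows "S h \<le> 4 * integral {iota h..pi/2} s"
proof -
  have "ennreal (S h / 4) \<le> (\<integral>\<^sup>+x. ennreal (s x) * indicator {iota h..pi/2} x \<partial>lborel)"
    unfolding S_nn[OF h]
  proof (rule nn_integral_mono)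
    fix x
    have "s x / r x * sqrt ((r x)^2 - h^2) \<le> s x" if x: "x \<in> {iota h..pi/2}"
    proof -
      have rx: "0 < r x" using iota_h_interval[OF h x] h by auto
      have "sqrt ((r x)^2 - h^2) \<le> sqrt ((r x)^2)" by (rule real_sqrt_le_mono) simp
      then have "sqrt ((r x)^2 - h^2) \<le> r x" using rx by simp
      then have "s x / r x * sqrt ((r x)^2 - h^2) \<le> s x / r x * r x"
        using rx s_pos[of x] by (intro mult_left_mono) auto
      then show ?thesis using rx by simp
    qed
    then show "ennreal (s x / r x * sqrt ((r x)^2 - h^2)) * indicator {iota h..pi/2} x \<le> ennreal (s x) * indicator {iota h..pi/2} x"
      by (auto split: split_indicator intro!: ennreal_leI)
  qed
  also have "\<dots> = ennreal (integral {iota h..pi/2} s)"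
    using s_pos by (intro nn_integral_continuous_Icc cont_s) (auto intro: less_imp_le)
  finally have "S h / 4 \<le> integral {iota h..pi/2} s"
  proof (subst (asm) ennreal_le_iff)
    show "0 \<le> integral {iota h..pi/2} s"
      using s_pos by (intro integral_nonneg integrable_continuous_interval cont_s) (auto intro: less_imp_le)
  qed
  then show ?thesis by simp
qed

lemma S_at_R: "(S \<longlongrightarrow> 0) (at_left R)"
proof -
  have "continuous_on {0..pi/2} (\<lambda>x. integral {x..pi/2} s)"
    by (rule indefinite_integral_continuous_1') (intro integrable_continuous_interval cont_s)
  then have "continuous_on {0..R} (\<lambda>h. integral {iota h..pi/2} s)"
    by (rule continuous_on_compose2[OF _ cont_iota]) (use iota_bounds in blast)
  then have "((\<lambda>h. integral {iota h..pi/2} s) \<longlongrightarrow> integral {iota R..pi/2} s) (at R within {0..R})"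
    using R_pos by (auto simp: continuous_on_def)
  then have lim: "((\<lambda>h. 4 * integral {iota h..pi/2} s) \<longlongrightarrow> 0) (at_left R)"
    using R_pos by (auto simp: iota_R at_within_Icc_at_left intro: tendsto_mult_right_zero)
  have ev: "\<forall>\<^sub>F h in at_left R. h \<in> {0<..<R}"
    using eventually_at_left_real[OF R_pos] .
  show ?thesis
  proof (rule tendsto_sandwich[OF _ _ tendsto_const lim])
    show "\<forall>\<^sub>F h in at_left R. 0 \<le> S h" using ev by eventually_elim (rule S_nonneg)
    show "\<forall>\<^sub>F h in at_left R. S h \<le> 4 * integral {iota h..pi/2} s" using ev by eventually_elim (rule S_le)
  qed
qed

text \<open>The action grows as \<open>h\<close> decreases and stays below \<open>M\<close>, the
  length of a full meridian circle. Only the existence of the limit matters, since the limit merely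
  produces countably many exceptional values of the front.\<close>

lemma S_at_0: "\<exists>l. (S \<longlongrightarrow> l) (at_right 0)"
proof -
  define M where "M = 4 * integral {0..pi/2} s"
  have bd: "S h \<le> M" if h: "h \<in> {0<..<R}" for h
  proof -
    have "integral {iota h..pi/2} s \<le> integral {0..pi/2} s"
      using iota_h[OF h] s_pos by (intro integral_subset_le integrable_continuous_interval cont_s) (auto intro: less_imp_le)
    then show ?thesis using S_le[OF h] by (simp add: M_def)
  qed
  define l where "l = (SUP h\<in>{0<..<R}. S h)"
  have bdd: "bdd_above (S ` {0<..<R})" using bd by (intro bdd_aboveI2[of _ _ M])
  have ev: "\<forall>\<^sub>F h in at_right 0. h \<in> {0<..<R}" using eventually_at_right_real[OF R_pos] .
  have "(S \<longlongrightarrow> l) (at_right 0)"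
  proof (rule increasing_tendsto)
    show "\<forall>\<^sub>F h in at_right 0. S h \<le> l" using ev
      by eventually_elim (auto simp: l_def intro!: cSUP_upper bdd)
    fix x assume "x < l"
    then obtain h where h: "h \<in> {0<..<R}" "x < S h"
      using less_cSUP_iff[of "{0<..<R}" S x] bdd R_pos by (auto simp: l_def)
    have "\<forall>\<^sub>F k in at_right 0. k \<in> {0<..<h}" using h eventually_at_right_real[of 0 h] by auto
    then show "\<forall>\<^sub>F k in at_right 0. x < S k"
    proof eventually_elim
      case (elim k)
      then have "S h \<le> S k" using h by (intro S_antimono) auto
      with h show ?case by simp
    qed
  qed
  then show ?thesis by blast
qed

text \<open>With the radius as variable the integral is that of \<open>w \<rho> / \<rho>\<close>
  from \<open>h\<close> to \<open>R\<close>; so \<open>Theta_abel\<close> determines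
  \<open>w\<close> by differentiation in \<open>h\<close>.\<close>

lemma d_w_integral:
  assumes h: "h \<in> {0<..<R}"
  shows "((\<lambda>h. integral {iota h..pi/2} (\<lambda>x. s x / r x)) has_real_derivative - w h / h) (at h)"
proof -
  define b where "b = iota h / 2"
  have b: "0 < b" "b < iota h" "iota h < pi/2" using iota_h[OF h] by (auto simp: b_def)
  have "continuous_on {b..pi/2} (\<lambda>x. s x / r x)"
  proof (intro continuous_intros ballI)
    fix x assume "x \<in> {b..pi/2}"
    then have "x \<in> {0<..<pi}" using b pi_gt_zero unfolding atLeastAtMost_iff greaterThanLessThan_iff by linarith
    then show "r x \<noteq> 0" using r_pos[of x] by simp
  qed
  then have "((\<lambda>u. integral {u..pi/2} (\<lambda>x. s x / r x)) has_real_derivative - (s (iota h) / r (iota h))) (at (iota h) within {b..pi/2})"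
    using b by (intro integral_has_real_derivative') auto
  then have "((\<lambda>u. integral {u..pi/2} (\<lambda>x. s x / r x)) has_real_derivative - (s (iota h) / r (iota h))) (at (iota h))"
    using b by (simp add: at_within_Icc_at)
  from DERIV_chain2[where g = iota, OF this d_iota[OF h]] show ?thesis
    by (simp add: w_def iota_h[OF h] ac_simps)
qed

text \<open>Near the pole the radius grows like the arc length, which is the assumption
  \<open>r'_0\<close>. This normalization later fixes the free factor.\<close>

lemma w_at_0: "(w \<longlongrightarrow> 1) (at_right 0)"
proof -
  have "(iota \<longlongrightarrow> iota 0) (at 0 within {0..R})"
    using cont_iota R_pos by (auto simp: continuous_on_def)
  then have "(iota \<longlongrightarrow> 0) (at_right 0)"
    using R_pos by (simp add: iota_0 at_within_Icc_at_right)
  moreover have "isCont (\<lambda>x. s x / r' x) 0"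
    using ds dr' r'_pos[of 0] by (intro continuous_intros DERIV_isCont) auto
  ultimately have "((\<lambda>\<rho>. s (iota \<rho>) / r' (iota \<rho>)) \<longlongrightarrow> s 0 / r' 0) (at_right 0)"
    by (rule isCont_tendsto_compose[rotated])
  then show ?thesis using r'_pos[of 0] r'_0 by (simp add: w_def[abs_def])
qed

end

text \<open>\<open>Theta_abel\<close> is linear in the advance, so a constant factor between the
  advances passes to the integrals of \<open>s / r\<close> and to their derivatives. The factor
  \<open>k\<close> is kept for the case of constant advances.\<close>

lemma profile_abel_unique:
  fixes k :: real
  assumes p1: "profile r1 r1' r1'' s1 s1'" and p2: "profile r2 r2' r2'' s2 s2'"
    and R: "profile.R r1 = profile.R r2" and k: "k > 0"
    and \<Theta>: "\<And>h. h \<in> {0<..<profile.R r1} \<Longrightarrow> profile.Theta r1 r1' s1 h = k * profile.Theta r2 r2' s2 h"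
    and h: "h \<in> {0<..<profile.R r1}"
  shows "profile.w r1 r1' s1 h = k * profile.w r2 r2' s2 h"
proof -
  interpret p1: profile r1 r1' r1'' s1 s1' by (rule p1)
  interpret p2: profile r2 r2' r2'' s2 s2' by (rule p2)
  define V1 where "V1 = (\<lambda>h. integral {p1.iota h..pi/2} (\<lambda>x. s1 x / r1 x))"
  define V2 where "V2 = (\<lambda>h. integral {p2.iota h..pi/2} (\<lambda>x. s2 x / r2 x))"
  have V2_nonneg: "V2 x \<ge> 0" if x: "x \<in> {0<..<p1.R}" for x
  proof -
    have "0 \<le> s2 y / r2 y" if "y \<in> {p2.iota x..pi/2}" for y
      using p2.iota_h_interval[of x y] that x R p2.s_pos[of y] by simp
    \<comment> \<open>If the function were not integrable, the integral would be 0 by convention,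
      which is nonnegative as well.\<close>
    then show ?thesis unfolding V2_def
      by (cases "(\<lambda>y. s2 y / r2 y) integrable_on {p2.iota x..pi/2}") (auto intro: integral_nonneg simp: not_integrable_integral)
  qed
  have V1_nonneg: "V1 x \<ge> 0" if x: "x \<in> {0<..<p1.R}" for x
  proof -
    have "0 \<le> s1 y / r1 y" if "y \<in> {p1.iota x..pi/2}" for y
      using p1.iota_h_interval[of x y] that x p1.s_pos[of y] by simp
    then show ?thesis unfolding V1_def
      by (cases "(\<lambda>y. s1 y / r1 y) integrable_on {p1.iota x..pi/2}") (auto intro: integral_nonneg simp: not_integrable_integral)
  qed
  have V: "V1 x = k * V2 x" if x: "x \<in> {0<..<p1.R}" for x
  proof -
    have x2: "x \<in> {0<..<p2.R}" using x R by simp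
    have "ennreal (2 * pi * V1 x) = (\<integral>\<^sup>+y. ennreal (1 / sqrt (y^2 - x^2) * p1.Theta y) * indicator {x..p1.R} y \<partial>lborel)"
      unfolding V1_def by (rule p1.Theta_abel[OF x, symmetric])
    also have "\<dots> = (\<integral>\<^sup>+y. ennreal k * (ennreal (1 / sqrt (y^2 - x^2) * p2.Theta y) * indicator {x..p2.R} y) \<partial>lborel)"
    proof (rule nn_integral_cong_AE)
      have "ennreal (1 / sqrt (y^2 - x^2) * p1.Theta y) * indicator {x..p1.R} y = ennreal k * (ennreal (1 / sqrt (y^2 - x^2) * p2.Theta y) * indicator {x..p2.R} y)"
        if ne: "y \<noteq> p1.R" for y
      proof (cases "y \<in> {x..p1.R}")
        case True
        then have y: "y \<in> {0<..<p1.R}" using x ne by auto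
        have "0 \<le> 1 / sqrt (y^2 - x^2) * p2.Theta y"
          using True x y R p2.Theta_pos[of y] by (intro mult_nonneg_nonneg) (auto simp: power_mono)
        then have "ennreal k * ennreal (1 / sqrt (y^2 - x^2) * p2.Theta y) = ennreal (k * (1 / sqrt (y^2 - x^2) * p2.Theta y))"
          using k by (intro ennreal_mult[symmetric]) auto
        moreover have "1 / sqrt (y^2 - x^2) * p1.Theta y = k * (1 / sqrt (y^2 - x^2) * p2.Theta y)"
          unfolding \<Theta>[OF y] by simp
        ultimately have "ennreal (1 / sqrt (y^2 - x^2) * p1.Theta y) = ennreal k * ennreal (1 / sqrt (y^2 - x^2) * p2.Theta y)"
          by (simp only:)
        then show ?thesis using True R by (simp only: indicator_simps mult_1_right)
      next
        case False
        then show ?thesis using R by simp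
      qed
      then show "AE y in lborel. ennreal (1 / sqrt (y^2 - x^2) * p1.Theta y) * indicator {x..p1.R} y = ennreal k * (ennreal (1 / sqrt (y^2 - x^2) * p2.Theta y) * indicator {x..p2.R} y)"
        using AE_lborel_singleton[of p1.R] by (auto elim: eventually_mono)
    qed
    also have "\<dots> = ennreal k * (\<integral>\<^sup>+y. ennreal (1 / sqrt (y^2 - x^2) * p2.Theta y) * indicator {x..p2.R} y \<partial>lborel)"
    proof (rule nn_integral_cmult)
      have "(\<lambda>y. indicator {x..<p2.R} y *\<^sub>R p2.Theta y) \<in> borel_measurable borel"
        using x2 by (intro borel_measurable_continuous_on_indicator p2.Theta_cont) auto
      then have [measurable]: "(\<lambda>y. indicator {x..<p2.R} y *\<^sub>R p2.Theta y + indicator {p2.R} y *\<^sub>R p2.Theta p2.R) \<in> borel_measurable borel"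
        by (intro borel_measurable_add) auto
      have "(\<lambda>y. ennreal (1 / sqrt (y^2 - x^2) * p2.Theta y) * indicator {x..p2.R} y) =
        (\<lambda>y. ennreal (1 / sqrt (y^2 - x^2) * (indicator {x..<p2.R} y *\<^sub>R p2.Theta y + indicator {p2.R} y *\<^sub>R p2.Theta p2.R)) * indicator {x..p2.R} y)"
        using x2 by (auto simp: fun_eq_iff split: split_indicator)
      also have "\<dots> \<in> borel_measurable lborel" by measurable
      finally show "(\<lambda>y. ennreal (1 / sqrt (y^2 - x^2) * p2.Theta y) * indicator {x..p2.R} y) \<in> borel_measurable lborel" .
    qed
    also have "\<dots> = ennreal k * ennreal (2 * pi * V2 x)"
      unfolding V2_def by (subst p2.Theta_abel[OF x2]) simp
    also have "\<dots> = ennreal (k * (2 * pi * V2 x))"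
      using k V2_nonneg[OF x] by (intro ennreal_mult[symmetric]) auto
    finally have "2 * pi * V1 x = k * (2 * pi * V2 x)"
      using k V2_nonneg[OF x] V1_nonneg[OF x] by (subst (asm) ennreal_inj) auto
    then show ?thesis by simp
  qed
  have "(V1 has_real_derivative - p1.w h / h) (at h)"
    unfolding V1_def by (rule p1.d_w_integral[OF h])
  moreover have "(V1 has_real_derivative k * (- p2.w h / h)) (at h)"
  proof (rule has_field_derivative_transform_within_open)
    show "((\<lambda>x. k * V2 x) has_real_derivative k * (- p2.w h / h)) (at h)"
      unfolding V2_def using h R by (intro DERIV_cmult p2.d_w_integral) simp
    show "open {0<..<p1.R}" "h \<in> {0<..<p1.R}" using h by auto
    show "k * V2 x = V1 x" if "x \<in> {0<..<p1.R}" for x using V[OF that] by simp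
  qed
  ultimately have "- p1.w h / h = k * (- p2.w h / h)" by (rule DERIV_unique)
  then show ?thesis using h by simp
qed

text \<open>A positive rational \<open>Theta h / (2 * pi)\<close> is \<open>p / q\<close> in lowest
  terms, and division of the length \<open>q * T h\<close> by \<open>q\<close> turns the length sets
  into the rational points of the fronts.\<close>

theorem profile_determined_by_front:
  assumes p1: "profile r1 r1' r1'' s1 s1'" and p2: "profile r2 r2' r2'' s2 s2'"
    and R: "profile.R r1 = profile.R r2"
    and spec: "\<And>p q. p \<ge> (1::nat) \<Longrightarrow> q \<ge> (1::nat) \<Longrightarrow> coprime p q \<Longrightarrow>
      {q * profile.T r1 r1' s1 h | h. h \<in> {0<..<profile.R r1} \<and> q * profile.Theta r1 r1' s1 h = 2 * pi * p} =
      {q * profile.T r2 r2' s2 h | h. h \<in> {0<..<profile.R r2} \<and> q * profile.Theta r2 r2' s2 h = 2 * pi * p}"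
    and h: "h \<in> {0<..<profile.R r1}"
  shows "profile.w r1 r1' s1 h = profile.w r2 r2' s2 h"
proof -
  interpret p1: profile r1 r1' r1'' s1 s1' by (rule p1)
  interpret p2: profile r2 r2' r2'' s2 s2' by (rule p2)
  have ratio: "\<exists>p q. p \<ge> (1::nat) \<and> q \<ge> (1::nat) \<and> coprime p q \<and> real q * x = 2 * pi * real p"
    if x: "x / (2 * pi) \<in> \<rat>" "x > 0" for x :: real
  proof -
    have "x / (2 * pi) \<noteq> 0" using x by simp
    with x(1) obtain m n :: nat where mn: "n \<noteq> 0" "\<bar>x / (2 * pi)\<bar> = real m / real n" "coprime m n"
      using Rats_abs_nat_div_natE by blast
    moreover from mn x have "m \<noteq> 0" by (cases "m = 0") auto
    moreover have "x / (2 * pi) = real m / real n" using mn x by simp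
    then have "real n * x = 2 * pi * real m" using mn(1) by (simp add: field_simps)
    ultimately show ?thesis by (intro exI[of _ m] exI[of _ n]) auto
  qed
  have s12: "\<exists>k\<in>{0<..<p1.R}. p2.Theta k = p1.Theta h \<and> p2.S k + k * p2.Theta k = p1.S h + h * p1.Theta h"
    if h: "h \<in> {0<..<p1.R}" and rat: "p1.Theta h / (2 * pi) \<in> \<rat>" for h
  proof -
    obtain p q :: nat where pq: "p \<ge> 1" "q \<ge> 1" "coprime p q" "real q * p1.Theta h = 2 * pi * real p"
      using ratio[OF rat p1.Theta_pos[OF h]] by blast
    then have "q * p1.T h \<in> {q * p1.T h | h. h \<in> {0<..<p1.R} \<and> q * p1.Theta h = 2 * pi * p}" using h by blast
    then obtain k where k: "k \<in> {0<..<p2.R}" "q * p2.Theta k = 2 * pi * p" "q * p1.T h = q * p2.T k"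
      unfolding spec[OF pq(1-3)] by blast
    have "p2.Theta k = p1.Theta h" using k(2) pq(2,4) by (metis mult_cancel_left of_nat_eq_0_iff not_one_le_zero)
    moreover have "p1.T h = p2.T k" using k(3) pq(2) by simp
    ultimately show ?thesis using k(1) R by (intro bexI[of _ k]) (auto simp: p1.S_def p2.S_def)
  qed
  have s21: "\<exists>k\<in>{0<..<p1.R}. p1.Theta k = p2.Theta h \<and> p1.S k + k * p1.Theta k = p2.S h + h * p2.Theta h"
    if h: "h \<in> {0<..<p1.R}" and rat: "p2.Theta h / (2 * pi) \<in> \<rat>" for h
  proof -
    have h2: "h \<in> {0<..<p2.R}" using h R by simp
    obtain p q :: nat where pq: "p \<ge> 1" "q \<ge> 1" "coprime p q" "real q * p2.Theta h = 2 * pi * real p"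
      using ratio[OF rat p2.Theta_pos[OF h2]] by blast
    then have "q * p2.T h \<in> {q * p2.T h | h. h \<in> {0<..<p2.R} \<and> q * p2.Theta h = 2 * pi * p}" using h2 by blast
    then obtain k where k: "k \<in> {0<..<p1.R}" "q * p1.Theta k = 2 * pi * p" "q * p2.T h = q * p1.T k"
      unfolding spec[OF pq(1-3), symmetric] by blast
    have "p1.Theta k = p2.Theta h" using k(2) pq(2,4) by (metis mult_cancel_left of_nat_eq_0_iff not_one_le_zero)
    moreover have "p2.T h = p1.T k" using k(3) pq(2) by simp
    ultimately show ?thesis using k(1) R by (intro bexI[of _ k]) (auto simp: p1.S_def p2.S_def)
  qed
  obtain l1 l2 where l: "(p1.S \<longlongrightarrow> l1) (at_right 0)" "(p2.S \<longlongrightarrow> l2) (at_right 0)"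
    using p1.S_at_0 p2.S_at_0 by blast
  have "(\<forall>h\<in>{0<..<p1.R}. p1.Theta h = p2.Theta h) \<or> (\<exists>c1 c2. \<forall>h\<in>{0<..<p1.R}. p1.Theta h = c1 \<and> p2.Theta h = c2)"
    using p1.S_at_R p2.S_at_R p2.S_deriv p2.Theta_differentiable
    unfolding R[symmetric]
    by (intro front_determined[OF p1.S_deriv _ p1.Theta_differentiable _ l(1) _ l(2) _ s12 s21])
  \<comment> \<open>Both alternatives are brought into one form: equal advances with
    \<open>k = 1\<close>, constant advances with the ratio of the constants, which is positive by
    \<open>Theta_pos\<close>.\<close>
  then obtain k where k: "k > 0" "\<And>h. h \<in> {0<..<p1.R} \<Longrightarrow> p1.Theta h = k * p2.Theta h"
  proof
    assume "\<forall>h\<in>{0<..<p1.R}. p1.Theta h = p2.Theta h"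
    then show ?thesis using that[of 1] by simp
  next
    assume "\<exists>c1 c2. \<forall>h\<in>{0<..<p1.R}. p1.Theta h = c1 \<and> p2.Theta h = c2"
    then obtain c1 c2 where c: "\<And>h. h \<in> {0<..<p1.R} \<Longrightarrow> p1.Theta h = c1 \<and> p2.Theta h = c2" by blast
    then have "c1 > 0" "c2 > 0" using p1.Theta_pos[OF h] p2.Theta_pos[of h] h R by auto
    then show ?thesis using that[of "c1 / c2"] c by simp
  qed
  have w: "p1.w x = k * p2.w x" if "x \<in> {0<..<p1.R}" for x
    by (rule profile_abel_unique[OF p1 p2 R k that])
  have "\<forall>\<^sub>F x in at_right 0. x \<in> {0<..<p1.R}" using eventually_at_right_real[OF p1.R_pos] .
  then have "\<forall>\<^sub>F x in at_right 0. k * p2.w x = p1.w x" by eventually_elim (simp add: w)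
  moreover have "((\<lambda>x. k * p2.w x) \<longlongrightarrow> k * 1) (at_right 0)" by (intro tendsto_intros p2.w_at_0)
  ultimately have "(p1.w \<longlongrightarrow> k * 1) (at_right 0)" by (rule Lim_transform_eventually[rotated])
  \<comment> \<open>Both weights tend to 1 at the pole, which leaves \<open>k = 1\<close>.\<close>
  with p1.w_at_0 have "1 = k * 1" by (rule tendsto_unique[rotated]) simp
  then show ?thesis using w[OF h] by simp
qed

text \<open>Both radii, as functions of arc length, are the inverse of \<open>\<rho> \<mapsto> \<integral>\<^sub>0\<^sup>\<rho> w\<close> on the southern hemisphere.\<close>

theorem profile_radius_unique:
  assumes p1: "profile r1 r1' r1'' s1 s1'" and p2: "profile r2 r2' r2'' s2 s2'"
    and R: "profile.R r1 = profile.R r2"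
    and w: "\<And>h. h \<in> {0<..<profile.R r1} \<Longrightarrow> profile.w r1 r1' s1 h = profile.w r2 r2' s2 h"
    and F1: "\<And>x. (F1 has_real_derivative s1 x) (at x)" "F1 0 = 0"
    and F2: "\<And>x. (F2 has_real_derivative s2 x) (at x)" "F2 0 = 0"
  shows "F1 pi = F2 pi" and "x \<in> {0..pi} \<Longrightarrow> y \<in> {0..pi} \<Longrightarrow> F1 x = F2 y \<Longrightarrow> r1 x = r2 y"
proof -
  interpret p1: profile r1 r1' r1'' s1 s1' by (rule p1)
  interpret p2: profile r2 r2' r2'' s2 s2' by (rule p2)
  have cF: "continuous_on A F1" "continuous_on A F2" for A
    using F1(1) F2(1) by (meson DERIV_continuous_on has_field_derivative_at_within)+
  have mono: "F2 a < F2 b" if "a < b" for a b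
    using DERIV_pos_imp_increasing[OF that] F2(1) p2.s_pos by blast
  \<comment> \<open>The difference of the arc lengths from the south pole to the parallel of radius
    \<open>\<rho>\<close>; equality of the weights makes its derivative vanish.\<close>
  define H where "H = (\<lambda>\<rho>. F1 (p1.iota \<rho>) - F2 (p2.iota \<rho>))"
  have cH: "continuous_on {0..p1.R} H"
    unfolding H_def using p1.cont_iota p2.cont_iota R
    by (intro continuous_intros continuous_on_compose2[OF cF(1) _ subset_UNIV] continuous_on_compose2[OF cF(2) _ subset_UNIV]) auto
  have H0: "H \<rho> = 0" if \<rho>: "\<rho> \<in> {0..p1.R}" for \<rho>
  proof -
    have "H \<rho> = H 0"
    proof (cases "\<rho> = 0")
      case False
      have "H \<rho> = H 0"
      proof (rule DERIV_isconst_end[of 0 \<rho> H])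
        show "0 < \<rho>" using False \<rho> by simp
        show "continuous_on {0..\<rho>} H" using \<rho> by (intro continuous_on_subset[OF cH]) auto
        fix z assume z: "0 < z" "z < \<rho>"
        then have z1: "z \<in> {0<..<p1.R}" and z2: "z \<in> {0<..<p2.R}" using \<rho> R by auto
        have "(H has_real_derivative s1 (p1.iota z) * (1 / r1' (p1.iota z)) - s2 (p2.iota z) * (1 / r2' (p2.iota z))) (at z)"
          unfolding H_def
          by (intro DERIV_diff DERIV_chain2[OF F1(1) p1.d_iota[OF z1]] DERIV_chain2[OF F2(1) p2.d_iota[OF z2]])
        moreover have "s1 (p1.iota z) * (1 / r1' (p1.iota z)) - s2 (p2.iota z) * (1 / r2' (p2.iota z)) = 0"
          using w[OF z1] by (simp add: p1.w_def p2.w_def)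
        ultimately show "(H has_real_derivative 0) (at z)" by simp
      qed
      then show ?thesis .
    qed simp
    then show ?thesis by (simp add: H_def p1.iota_0 p2.iota_0 F1 F2)
  qed
  have mid: "F1 (pi/2) = F2 (pi/2)"
  proof -
    have e: "p2.iota p1.R = pi/2" using p2.iota_R R by simp
    have "H p1.R = 0" using p1.R_pos by (intro H0) auto
    then show ?thesis unfolding H_def p1.iota_R e by simp
  qed
  have sym1: "F1 x + F1 (pi - x) = 2 * F1 (pi/2)" for x
  proof -
    have "((\<lambda>x. F1 x + F1 (pi - x)) has_real_derivative 0) (at y)" for y
      using p1.s_sym by (auto intro!: derivative_eq_intros F1(1)[THEN DERIV_chain2])
    from constant_if_deriv_zero[OF this, of x "pi/2"] show ?thesis by simp
  qed
  have sym2: "F2 x + F2 (pi - x) = 2 * F2 (pi/2)" for x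
  proof -
    have "((\<lambda>x. F2 x + F2 (pi - x)) has_real_derivative 0) (at y)" for y
      using p2.s_sym by (auto intro!: derivative_eq_intros F2(1)[THEN DERIV_chain2])
    from constant_if_deriv_zero[OF this, of x "pi/2"] show ?thesis by simp
  qed
  show "F1 pi = F2 pi" using sym1[of 0] sym2[of 0] mid F1(2) F2(2) by simp
  \<comment> \<open>Only \<open>x\<close> is assumed to be southern. As \<open>F2\<close> is
    injective, \<open>y\<close> must be the southern angle at which the second profile has the
    radius \<open>r1 x\<close>.\<close>
  have half: "r1 x = r2 y" if x: "x \<in> {0..pi/2}" and y: "y \<in> {0..pi}" and e: "F1 x = F2 y" for x y
  proof -
    define \<rho> where "\<rho> = r1 x"
    have "r1 0 \<le> r1 x" using x by (subst p1.r_le_iff) auto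
    then have \<rho>: "\<rho> \<in> {0..p1.R}" using p1.r_le_R[of x] x by (auto simp: \<rho>_def p1.r_0)
    then have "F1 x = F2 (p2.iota \<rho>)" using H0[OF \<rho>] x p1.iota_r[of x] by (simp add: H_def \<rho>_def)
    then have "F2 y = F2 (p2.iota \<rho>)" using e by simp
    then have "y = p2.iota \<rho>" using mono[of y "p2.iota \<rho>"] mono[of "p2.iota \<rho>" y] by linarith
    then show ?thesis using p2.r_iota[of \<rho>] \<rho> R by (simp add: \<rho>_def)
  qed
  show "r1 x = r2 y" if x: "x \<in> {0..pi}" and y: "y \<in> {0..pi}" and e: "F1 x = F2 y"
  proof (cases "x \<le> pi/2")
    case True
    then show ?thesis using half[of x y] x y e by auto
  next
    case False
    have "F1 (pi - x) = F2 (pi - y)" using sym1[of x] sym2[of y] mid e by simp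
    then have "r1 (pi - x) = r2 (pi - y)" using half[of "pi - x" "pi - y"] x y False by auto
    then show ?thesis by (simp add: p1.r_sym p2.r_sym)
  qed
qed

section \<open>Rotation-invariant metrics on the sphere\<close>

lemma vec3_eq: "(x::real^3) = y \<longleftrightarrow> x $ 1 = y $ 1 \<and> x $ 2 = y $ 2 \<and> x $ 3 = y $ 3"
  by (simp add: vec_eq_iff forall_3)

lemma inner3: "(x::real^3) \<bullet> y = x $ 1 * y $ 1 + x $ 2 * y $ 2 + x $ 3 * y $ 3"
  by (simp add: inner_vec_def sum_3)

lemma axis3_nth [simp]:
  "axis (1::3) (1::real) $ 1 = 1" "axis (1::3) (1::real) $ 2 = 0" "axis (1::3) (1::real) $ 3 = 0"
  "axis (2::3) (1::real) $ 1 = 0" "axis (2::3) (1::real) $ 2 = 1" "axis (2::3) (1::real) $ 3 = 0"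
  "axis (3::3) (1::real) $ 1 = 0" "axis (3::3) (1::real) $ 2 = 0" "axis (3::3) (1::real) $ 3 = 1"
  by (simp_all add: axis_def)

lemma has_vector_derivative_vec3:
  fixes f :: "real \<Rightarrow> real^3"
  assumes "((\<lambda>t. f t $ 1) has_real_derivative d $ 1) F" "((\<lambda>t. f t $ 2) has_real_derivative d $ 2) F"
    "((\<lambda>t. f t $ 3) has_real_derivative d $ 3) F"
  shows "(f has_vector_derivative d) F"
proof -
  define f' :: "real \<Rightarrow> real^3" where "f' = (\<lambda>t. (f t $ 1) *\<^sub>R axis 1 1 + (f t $ 2) *\<^sub>R axis 2 1 + (f t $ 3) *\<^sub>R axis 3 (1::real))"
  have f: "f' = f"
    by (simp add: f'_def fun_eq_iff vec3_eq)
  have "(f' has_vector_derivative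
     (d $ 1) *\<^sub>R axis 1 1 + (d $ 2) *\<^sub>R axis 2 1 + (d $ 3) *\<^sub>R axis 3 (1::real)) F"
    using assms unfolding has_real_derivative_iff_has_vector_derivative f'_def
    by (intro has_vector_derivative_add bounded_linear.has_vector_derivative[OF bounded_linear_scaleR_left])
  moreover have "(d $ 1) *\<^sub>R axis 1 1 + (d $ 2) *\<^sub>R axis 2 1 + (d $ 3) *\<^sub>R axis 3 (1::real) = d"
    by (simp add: vec3_eq)
  ultimately show ?thesis by (simp only: f)
qed

lemma has_real_derivative_vec_nth:
  fixes f :: "real \<Rightarrow> real^'n"
  shows "(f has_vector_derivative d) F \<Longrightarrow> ((\<lambda>t. f t $ i) has_real_derivative d $ i) F"
  unfolding has_real_derivative_iff_has_vector_derivative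
  by (rule bounded_linear.has_vector_derivative[OF bounded_linear_vec_nth])

lemma rot_nth [simp]:
  "rot a x $ 1 = cos a * x $ 1 - sin a * x $ 2" "rot a x $ 2 = sin a * x $ 1 + cos a * x $ 2" "rot a x $ 3 = x $ 3"
  by (simp_all add: rot_def vector_3)

lemma rot_field_nth [simp]: "rot_field x $ 1 = - (x $ 2)" "rot_field x $ 2 = x $ 1" "rot_field x $ 3 = 0"
  by (simp_all add: rot_field_def vector_3)

lemma refl_z_nth [simp]: "refl_z x $ 1 = x $ 1" "refl_z x $ 2 = x $ 2" "refl_z x $ 3 = - (x $ 3)"
  by (simp_all add: refl_z_def vector_3)

lemma pole_nth [simp]: "south $ 1 = 0" "south $ 2 = 0" "south $ 3 = -1" "north $ 1 = 0" "north $ 2 = 0" "north $ 3 = 1"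
  by (simp_all add: south_def north_def vector_3)

lemma rot_rot: "rot a (rot b x) = rot (a + b) x"
  by (simp add: vec3_eq cos_add sin_add algebra_simps)

lemma rot_0 [simp]: "rot 0 x = x" by (simp add: vec3_eq)

lemma rot_add: "rot a (x + y) = rot a x + rot a y" and rot_scale: "rot a (k *\<^sub>R x) = k *\<^sub>R rot a x"
  and rot_diff: "rot a (x - y) = rot a x - rot a y"
  by (simp_all add: vec3_eq algebra_simps)

lemma rot_inner: "rot a x \<bullet> rot a y = x \<bullet> y"
proof -
  have "rot a x \<bullet> rot a y = ((sin a)^2 + (cos a)^2) * (x $ 1 * y $ 1 + x $ 2 * y $ 2) + x $ 3 * y $ 3"
    by (simp only: inner3 rot_nth power2_eq_square) algebra
  then show ?thesis by (simp add: inner3)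
qed

lemma rot_norm: "norm (rot a x) = norm x" by (simp add: norm_eq_sqrt_inner rot_inner)

lemma rot_rot_field: "rot_field (rot a x) = rot a (rot_field x)" by (simp add: vec3_eq)

lemma refl_z_inner: "refl_z x \<bullet> refl_z y = x \<bullet> y" by (simp add: inner3)

lemma refl_z_norm: "norm (refl_z x) = norm x" by (simp add: norm_eq_sqrt_inner refl_z_inner)

lemma refl_z_lin: "refl_z (x - y) = refl_z x - refl_z y" "refl_z (k *\<^sub>R x) = k *\<^sub>R refl_z x"
  by (simp_all add: vec3_eq)

lemma rot_deriv: "((\<lambda>a. rot a x) has_vector_derivative rot a (rot_field x)) (at a)"
  by (rule has_vector_derivative_vec3) (auto intro!: derivative_eq_intros)

lemma S2_iff: "x \<in> S2 \<longleftrightarrow> norm x = 1" by simp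

lemma S2_nth: "x \<in> S2 \<longleftrightarrow> (x $ 1)^2 + (x $ 2)^2 + (x $ 3)^2 = 1"
  by (simp add: norm_eq_sqrt_inner inner3 power2_eq_square)

lemma tangent_iff: "v \<in> tangent x \<longleftrightarrow> v \<bullet> x = 0" by (simp add: tangent_def)

lemma rot_tangent: "v \<in> tangent x \<Longrightarrow> rot a v \<in> tangent (rot a x)" by (simp add: tangent_iff rot_inner)

lemma rot_field_tangent: "rot_field x \<in> tangent x" by (simp add: tangent_iff inner3)

lemma sgn_rot: "sgn (rot a x) = rot a (sgn x)"
  unfolding sgn_div_norm rot_norm rot_scale ..

lemma dsgn_rot: "dsgn (rot a x) (rot a v) = rot a (dsgn x v)"
  by (simp only: dsgn_def sgn_rot rot_inner rot_norm rot_diff rot_scale)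

lemma sgn_refl_z: "sgn (refl_z x) = refl_z (sgn x)"
  unfolding sgn_div_norm refl_z_norm refl_z_lin ..

lemma dsgn_refl_z: "dsgn (refl_z x) (refl_z v) = refl_z (dsgn x v)"
  by (simp only: dsgn_def sgn_refl_z refl_z_inner refl_z_norm refl_z_lin)

lemma dsgn_lin: "dsgn x (k *\<^sub>R u + v) = k *\<^sub>R dsgn x u + dsgn x v"
  by (simp add: dsgn_def inner_add_left algebra_simps)

lemma dsgn_tangent: "x \<noteq> 0 \<Longrightarrow> dsgn x v \<in> tangent (sgn x)"
proof -
  assume "x \<noteq> 0"
  then have "sgn x \<bullet> sgn x = 1" by (metis norm_sgn power2_norm_eq_inner one_power2)
  then show ?thesis by (simp add: tangent_iff dsgn_def inner_diff_left)
qed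

lemma sgn_S2: "x \<noteq> 0 \<Longrightarrow> sgn x \<in> S2" by (simp add: norm_sgn)

lemma dsgn_self: "dsgn x x = 0"
proof (cases "x = 0")
  case False
  then have "x \<bullet> sgn x = norm x"
    by (simp add: sgn_div_norm power2_norm_eq_inner[symmetric] power2_eq_square)
  then have "(x \<bullet> sgn x) *\<^sub>R sgn x = x"
    using False by (simp add: sgn_div_norm)
  then show ?thesis by (simp add: dsgn_def)
qed (simp add: dsgn_def)

lemma dsgn_zero [simp]: "dsgn x 0 = 0" by (simp add: dsgn_def)

lemma dsgn_on_S2: "x \<in> S2 \<Longrightarrow> v \<in> tangent x \<Longrightarrow> dsgn x v = v" "x \<in> S2 \<Longrightarrow> sgn x = x"
  by (simp_all add: dsgn_def tangent_iff sgn_div_norm)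

lemma dsgn_scale: "k > 0 \<Longrightarrow> dsgn (k *\<^sub>R x) v = dsgn x v /\<^sub>R k" "k > 0 \<Longrightarrow> sgn (k *\<^sub>R x) = sgn x"
  by (simp_all add: dsgn_def sgn_scaleR)

section \<open>Calculus of the radially extended metric\<close>

locale sphere_metric =
  fixes g :: tensor
  assumes riem: "riemannian_metric g" and inv: "S1_invariant g"
begin

abbreviation G where "G \<equiv> pull g"

lemma G_eq: "x \<in> S2 \<Longrightarrow> v \<in> tangent x \<Longrightarrow> w \<in> tangent x \<Longrightarrow> G x v w = g x v w"
  unfolding pull_def using dsgn_on_S2 by metis

lemma G_lin1: "x \<noteq> 0 \<Longrightarrow> G x (k *\<^sub>R u + v) w = k * G x u w + G x v w"
  using riem sgn_S2[of x] dsgn_tangent[of x] unfolding riemannian_metric_def pull_def dsgn_lin by blast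

lemma G_sym: "x \<noteq> 0 \<Longrightarrow> G x v w = G x w v"
  using riem sgn_S2[of x] dsgn_tangent[of x] unfolding riemannian_metric_def pull_def by blast

lemma G_scale1: "x \<noteq> 0 \<Longrightarrow> G x (k *\<^sub>R u) w = k * G x u w"
  and G_zero1: "x \<noteq> 0 \<Longrightarrow> G x 0 w = 0"
  and G_add1: "x \<noteq> 0 \<Longrightarrow> G x (u + v) w = G x u w + G x v w"
  and G_minus1: "x \<noteq> 0 \<Longrightarrow> G x (- u) w = - G x u w"
proof -
  assume x: "x \<noteq> 0"
  show z: "G x 0 w = 0" using G_lin1[OF x, of 1 0 0 w] by simp
  show "G x (k *\<^sub>R u) w = k * G x u w" using G_lin1[OF x, of k u 0 w] z by simp
  show "G x (u + v) w = G x u w + G x v w" using G_lin1[OF x, of 1 u v w] by simp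
  show "G x (- u) w = - G x u w" using G_lin1[OF x, of "-1" u 0 w] z by simp
qed

lemma G_scale2: "x \<noteq> 0 \<Longrightarrow> G x w (k *\<^sub>R u) = k * G x w u"
  and G_zero2: "x \<noteq> 0 \<Longrightarrow> G x w 0 = 0"
  and G_add2: "x \<noteq> 0 \<Longrightarrow> G x w (u + v) = G x w u + G x w v"
  and G_minus2: "x \<noteq> 0 \<Longrightarrow> G x w (- u) = - G x w u"
  using G_scale1[of x k u w] G_zero1[of x w] G_add1[of x u v w] G_minus1[of x u w] by (simp_all add: G_sym[of x w])

lemmas G_linear = G_scale1 G_zero1 G_add1 G_minus1 G_scale2 G_zero2 G_add2 G_minus2

lemma G_pos: "x \<in> S2 \<Longrightarrow> v \<in> tangent x \<Longrightarrow> v \<noteq> 0 \<Longrightarrow> G x v v > 0"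
  using riem by (simp add: G_eq) (auto simp: riemannian_metric_def)

lemma G_rot: "x \<noteq> 0 \<Longrightarrow> G (rot a x) (rot a v) (rot a w) = G x v w"
  using inv sgn_S2[of x] dsgn_tangent[of x] unfolding S1_invariant_def pull_def dsgn_rot sgn_rot by blast

lemma G_radial: "x \<noteq> 0 \<Longrightarrow> G x x w = 0" "x \<noteq> 0 \<Longrightarrow> G x w x = 0"
proof -
  assume x: "x \<noteq> 0"
  have "G x x w = G x 0 w" by (simp only: pull_def dsgn_self dsgn_zero)
  then show 1: "G x x w = 0" using G_zero1[OF x, of w] by simp
  show "G x w x = 0" using 1 G_sym[OF x, of w x] by simp
qed

lemma G_homogeneous: "x \<noteq> 0 \<Longrightarrow> k > 0 \<Longrightarrow> G (k *\<^sub>R x) v w = G x v w / k^2"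
proof -
  assume x: "x \<noteq> 0" and k: "k > 0"
  have "dsgn x v /\<^sub>R k = dsgn x (v /\<^sub>R k)" for v using dsgn_lin[of x "inverse k" v 0] by simp
  then have "G (k *\<^sub>R x) v w = G x (v /\<^sub>R k) (w /\<^sub>R k)" by (simp only: pull_def dsgn_scale[OF k])
  then show ?thesis using x k by (simp add: G_linear power2_eq_square divide_inverse)
qed

definition DG where "DG x v w = frechet_derivative (\<lambda>x. G x v w) (at x)"

lemma G_smooth: "Ck_on k (\<lambda>x. G x v w) (- {0})"
  using riem unfolding riemannian_metric_def smooth_on_open_def by blast

lemma G_has_derivative: "x \<noteq> 0 \<Longrightarrow> ((\<lambda>x. G x v w) has_derivative DG x v w) (at x)"
  using G_smooth[of "Suc 0" v w] unfolding DG_def frechet_derivative_works[symmetric] by simp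

lemma DG_linear: "x \<noteq> 0 \<Longrightarrow> linear (DG x v w)"
  using G_has_derivative has_derivative_linear by blast

lemma vec3_expansion: "(v::real^3) = (v $ 1) *\<^sub>R axis 1 1 + (v $ 2) *\<^sub>R axis 2 1 + (v $ 3) *\<^sub>R axis 3 1"
  by (simp add: vec3_eq)

lemma G_expansion: "x \<noteq> 0 \<Longrightarrow> G x v w = (\<Sum>i\<in>UNIV. \<Sum>j\<in>UNIV. v $ i * w $ j * G x (axis i 1) (axis j 1))"
proof -
  assume x: "x \<noteq> 0"
  have "G x v w = G x ((v $ 1) *\<^sub>R axis 1 1 + (v $ 2) *\<^sub>R axis 2 1 + (v $ 3) *\<^sub>R axis 3 1)
      ((w $ 1) *\<^sub>R axis 1 1 + (w $ 2) *\<^sub>R axis 2 1 + (w $ 3) *\<^sub>R axis 3 1)"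
    by (rule arg_cong2[OF vec3_expansion vec3_expansion])
  then show ?thesis using x by (simp add: G_linear sum_3 algebra_simps)
qed

lemma DG_expansion:
  assumes x: "x \<noteq> 0"
  shows "DG x v w e = (\<Sum>i\<in>UNIV. \<Sum>j\<in>UNIV. v $ i * w $ j * DG x (axis i 1) (axis j 1) e)"
proof -
  have "((\<lambda>x. \<Sum>i\<in>UNIV. \<Sum>j\<in>UNIV. v $ i * w $ j * G x (axis i 1) (axis j 1)) has_derivative
     (\<lambda>e. \<Sum>i\<in>UNIV. \<Sum>j\<in>UNIV. v $ i * w $ j * DG x (axis i 1) (axis j 1) e)) (at x)"
    by (intro has_derivative_sum has_derivative_mult_right G_has_derivative x)
  then have "((\<lambda>x. G x v w) has_derivative
     (\<lambda>e. \<Sum>i\<in>UNIV. \<Sum>j\<in>UNIV. v $ i * w $ j * DG x (axis i 1) (axis j 1) e)) (at x)"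
    by (rule has_derivative_transform_within_open[of _ _ _ _ "- {0}"]) (use x G_expansion in auto)
  from fun_cong[OF has_derivative_unique[OF G_has_derivative[OF x] this], of e] show ?thesis .
qed

text \<open>The tensor is smooth in the base point for fixed arguments. Expansion in the standard
  basis turns moving arguments into coefficients, and the ordinary product rule applies to a finite
  sum.\<close>

lemma G_along_curve:
  assumes X: "(X has_vector_derivative X') (at t)" and V: "(V has_vector_derivative V') (at t)"
    and W: "(W has_vector_derivative W') (at t)" and nz: "\<And>s. X s \<noteq> 0"
  shows "((\<lambda>s. G (X s) (V s) (W s)) has_real_derivative
    DG (X t) (V t) (W t) X' + G (X t) V' (W t) + G (X t) (V t) W') (at t)"
proof -
  have GX: "((\<lambda>s. G (X s) v w) has_real_derivative DG (X t) v w X') (at t)" for v w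
  proof -
    have "((\<lambda>s. G (X s) v w) has_derivative (\<lambda>h. DG (X t) v w (h *\<^sub>R X'))) (at t)"
      using has_derivative_compose[OF X[unfolded has_vector_derivative_def] G_has_derivative[OF nz]] .
    moreover have "(\<lambda>h. DG (X t) v w (h *\<^sub>R X')) = (*) (DG (X t) v w X')"
      using DG_linear[OF nz] by (simp add: fun_eq_iff linear_scale)
    ultimately show ?thesis by (simp add: has_field_derivative_def)
  qed
  have "((\<lambda>s. \<Sum>i\<in>UNIV. \<Sum>j\<in>UNIV. V s $ i * W s $ j * G (X s) (axis i 1) (axis j 1)) has_real_derivative
    (\<Sum>i\<in>UNIV. \<Sum>j\<in>UNIV. (V' $ i * W t $ j + W' $ j * V t $ i) * G (X t) (axis i 1) (axis j 1) +
      DG (X t) (axis i 1) (axis j 1) X' * (V t $ i * W t $ j))) (at t)"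
    by (intro DERIV_sum DERIV_mult GX has_real_derivative_vec_nth V W)
  moreover have "(\<Sum>i\<in>UNIV. \<Sum>j\<in>UNIV. (V' $ i * W t $ j + W' $ j * V t $ i) * G (X t) (axis i 1) (axis j 1) +
      DG (X t) (axis i 1) (axis j 1) X' * (V t $ i * W t $ j)) =
    DG (X t) (V t) (W t) X' + G (X t) V' (W t) + G (X t) (V t) W'"
    unfolding DG_expansion[OF nz, of t "V t"] G_expansion[OF nz, of t V'] G_expansion[OF nz, of t "V t"]
    by (simp add: sum_3 algebra_simps)
  moreover have "(\<lambda>s. \<Sum>i\<in>UNIV. \<Sum>j\<in>UNIV. V s $ i * W s $ j * G (X s) (axis i 1) (axis j 1)) = (\<lambda>s. G (X s) (V s) (W s))"
    by (rule ext) (rule G_expansion[OF nz, symmetric])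
  ultimately show ?thesis by simp
qed

text \<open>The Killing equation: derivative at angle 0 of the invariance under rotations.\<close>

lemma DG_rot_field:
  assumes x: "x \<noteq> 0"
  shows "DG x v w (rot_field x) + G x (rot_field v) w + G x v (rot_field w) = 0"
proof -
  have nz: "rot a x \<noteq> 0" for a using x rot_norm[of a x] by auto
  have "((\<lambda>a. G (rot a x) (rot a v) (rot a w)) has_real_derivative
    DG (rot 0 x) (rot 0 v) (rot 0 w) (rot 0 (rot_field x)) + G (rot 0 x) (rot 0 (rot_field v)) (rot 0 w)
     + G (rot 0 x) (rot 0 v) (rot 0 (rot_field w))) (at 0)"
    by (rule G_along_curve[where X = "\<lambda>a. rot a x" and V = "\<lambda>a. rot a v" and W = "\<lambda>a. rot a w", OF rot_deriv rot_deriv rot_deriv nz])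
  moreover have "(\<lambda>a. G (rot a x) (rot a v) (rot a w)) = (\<lambda>a. G x v w)"
    using G_rot[OF x] by (intro ext)
  then have "((\<lambda>a. G (rot a x) (rot a v) (rot a w)) has_real_derivative 0) (at 0)"
    by simp
  ultimately have "DG (rot 0 x) (rot 0 v) (rot 0 w) (rot 0 (rot_field x)) + G (rot 0 x) (rot 0 (rot_field v)) (rot 0 w)
     + G (rot 0 x) (rot 0 v) (rot 0 (rot_field w)) = 0" by (rule DERIV_unique)
  then show ?thesis by simp
qed

text \<open>Euler's identity, since the pulled back metric is homogeneous of degree -2 in the base
  point.\<close>

lemma DG_radial:
  assumes x: "x \<noteq> 0"
  shows "DG x v w x = - 2 * G x v w"
proof -
  have "((\<lambda>s. exp s *\<^sub>R x) has_vector_derivative x) (at 0)"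
    by (auto intro!: derivative_eq_intros)
  from G_along_curve[where X = "\<lambda>s. exp s *\<^sub>R x", OF this has_vector_derivative_const[of v] has_vector_derivative_const[of w]] x
  have "((\<lambda>s. G (exp s *\<^sub>R x) v w) has_real_derivative DG x v w x) (at 0)"
    by (simp add: G_linear)
  moreover have "((\<lambda>s. G (exp s *\<^sub>R x) v w) has_real_derivative - 2 * G x v w) (at 0)"
    using x by (auto simp: G_homogeneous intro!: derivative_eq_intros)
  ultimately show ?thesis by (rule DERIV_unique)
qed

end

text \<open>A twice differentiable curve on the sphere, with the covector \<open>xi\<close> whose vanishing is the
  geodesic equation. It annihilates the radial direction, and its values on the velocity and on the
  rotation field are the derivatives of the energy and of the momentum.\<close>

locale sphere_curve = sphere_metric +
  fixes \<gamma> v a :: "real \<Rightarrow> real^3"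
  assumes on_S2: "\<And>t. \<gamma> t \<in> S2"
    and vel: "\<And>t. (\<gamma> has_vector_derivative v t) (at t)"
    and acc: "\<And>t. (v has_vector_derivative a t) (at t)"
begin

definition xi where "xi t e = DG (\<gamma> t) (v t) e (v t) + G (\<gamma> t) (a t) e - 1/2 * DG (\<gamma> t) (v t) (v t) e"

lemma nz: "\<gamma> t \<noteq> 0" using on_S2[of t] by auto

lemma vel_tangent: "v t \<in> tangent (\<gamma> t)"
proof -
  have "((\<lambda>t. \<gamma> t \<bullet> \<gamma> t) has_vector_derivative \<gamma> t \<bullet> v t + v t \<bullet> \<gamma> t) (at t)"
    by (rule bounded_bilinear.has_vector_derivative[OF bounded_bilinear_inner vel vel])
  moreover have "\<gamma> t \<bullet> \<gamma> t = 1" for t using on_S2[of t] by (simp add: norm_eq_1)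
  then have "((\<lambda>t. \<gamma> t \<bullet> \<gamma> t) has_vector_derivative 0) (at t)" by simp
  ultimately have "\<gamma> t \<bullet> v t + v t \<bullet> \<gamma> t = 0" by (rule vector_derivative_unique_at)
  then show ?thesis by (simp add: tangent_iff inner_commute)
qed

lemma velocity_eq: "velocity \<gamma> t = v t"
  by (rule vector_derivative_at[OF vel])

lemma momentum_form_deriv: "((\<lambda>s. G (\<gamma> s) (v s) e) has_real_derivative DG (\<gamma> t) (v t) e (v t) + G (\<gamma> t) (a t) e) (at t)"
  using G_along_curve[OF vel acc has_vector_derivative_const[of e] nz, of t] by (simp add: G_linear nz)

lemma xi_linear: "xi t (k *\<^sub>R e + f) = k * xi t e + xi t f"
proof -
  have "DG (\<gamma> t) (v t) (k *\<^sub>R e + f) (v t) = k * DG (\<gamma> t) (v t) e (v t) + DG (\<gamma> t) (v t) f (v t)"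
    unfolding DG_expansion[OF nz, of t "v t"] by (simp add: sum_3 algebra_simps)
  moreover have "DG (\<gamma> t) (v t) (v t) (k *\<^sub>R e + f) = k * DG (\<gamma> t) (v t) (v t) e + DG (\<gamma> t) (v t) (v t) f"
    using DG_linear[OF nz, of t "v t" "v t"] by (simp add: linear_add linear_scale)
  ultimately show ?thesis unfolding xi_def by (simp add: G_linear nz algebra_simps)
qed

lemma geodesic_iff: "geodesic g \<gamma> \<longleftrightarrow> (\<forall>t e. xi t e = 0)"
proof -
  have "((\<lambda>s. G (\<gamma> s) (v s) e) has_real_derivative 1/2 * DG (\<gamma> t) (v t) (v t) e) (at t) \<longleftrightarrow> xi t e = 0" for t e
  proof
    assume "((\<lambda>s. G (\<gamma> s) (v s) e) has_real_derivative 1/2 * DG (\<gamma> t) (v t) (v t) e) (at t)"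
    from DERIV_unique[OF this momentum_form_deriv] show "xi t e = 0" by (simp add: xi_def)
  next
    assume "xi t e = 0"
    then have "DG (\<gamma> t) (v t) e (v t) + G (\<gamma> t) (a t) e = 1/2 * DG (\<gamma> t) (v t) (v t) e"
      unfolding xi_def by simp
    then show "((\<lambda>s. G (\<gamma> s) (v s) e) has_real_derivative 1/2 * DG (\<gamma> t) (v t) (v t) e) (at t)"
      using momentum_form_deriv[of e t] by (simp only:)
  qed
  moreover have "\<gamma> differentiable (at t)" "v differentiable (at t)" for t
    using vel acc by (auto intro: differentiableI_vector)
  ultimately show ?thesis
    unfolding geodesic_def velocity_eq DG_def[symmetric] using on_S2 by (simp only: velocity_eq simp_thms)
qed

text \<open>The pulled back metric annihilates radial vectors, so the pairing of velocity and
  position vanishes along the curve. Its derivative expresses the first two terms of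
  \<open>xi\<close> as minus the energy, and Euler's identity makes the third term plus the
  energy.\<close>

lemma xi_radial: "xi t (\<gamma> t) = 0"
proof -
  have "((\<lambda>s. G (\<gamma> s) (v s) (\<gamma> s)) has_real_derivative
    DG (\<gamma> t) (v t) (\<gamma> t) (v t) + G (\<gamma> t) (a t) (\<gamma> t) + G (\<gamma> t) (v t) (v t)) (at t)"
    by (rule G_along_curve[OF vel acc vel nz])
  moreover have "((\<lambda>s. G (\<gamma> s) (v s) (\<gamma> s)) has_real_derivative 0) (at t)" by (simp add: G_radial nz)
  ultimately have "DG (\<gamma> t) (v t) (\<gamma> t) (v t) + G (\<gamma> t) (a t) (\<gamma> t) + G (\<gamma> t) (v t) (v t) = 0"
    by (rule DERIV_unique)
  then show ?thesis by (simp add: xi_def DG_radial nz)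
qed

lemma energy_deriv: "((\<lambda>s. G (\<gamma> s) (v s) (v s)) has_real_derivative 2 * xi t (v t)) (at t)"
proof -
  have "((\<lambda>s. G (\<gamma> s) (v s) (v s)) has_real_derivative
    DG (\<gamma> t) (v t) (v t) (v t) + G (\<gamma> t) (a t) (v t) + G (\<gamma> t) (v t) (a t)) (at t)"
    by (rule G_along_curve[OF vel acc acc nz])
  then show ?thesis by (rule DERIV_cong) (simp add: xi_def G_sym[OF nz, of t "v t" "a t"])
qed

lemma rot_field_deriv: "((\<lambda>s. rot_field (\<gamma> s)) has_vector_derivative rot_field (v t)) (at t)"
  using has_real_derivative_vec_nth[OF vel[of t]] by (intro has_vector_derivative_vec3) (auto intro!: derivative_eq_intros)

text \<open>Noether's theorem for rotations: by the Killing equation the term that comes from moving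
  the rotation field is the term \<open>- 1/2 * DG\<close> in \<open>xi\<close>. On geodesics this
  yields Clairaut's relation.\<close>

lemma momentum_deriv: "((\<lambda>s. G (\<gamma> s) (v s) (rot_field (\<gamma> s))) has_real_derivative xi t (rot_field (\<gamma> t))) (at t)"
proof -
  have "((\<lambda>s. G (\<gamma> s) (v s) (rot_field (\<gamma> s))) has_real_derivative
    DG (\<gamma> t) (v t) (rot_field (\<gamma> t)) (v t) + G (\<gamma> t) (a t) (rot_field (\<gamma> t)) + G (\<gamma> t) (v t) (rot_field (v t))) (at t)"
    by (rule G_along_curve[OF vel acc rot_field_deriv nz])
  moreover have "DG (\<gamma> t) (v t) (v t) (rot_field (\<gamma> t)) = - 2 * G (\<gamma> t) (v t) (rot_field (v t))"
    using DG_rot_field[OF nz, of t "v t" "v t"] G_sym[OF nz, of t "v t" "rot_field (v t)"] by simp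
  ultimately show ?thesis by (simp add: xi_def)
qed

end

lemma geodesic_sphere_curve:
  assumes "sphere_metric g" "geodesic g \<gamma>"
  shows "sphere_curve g \<gamma> (velocity \<gamma>) (velocity (velocity \<gamma>))"
proof -
  have "\<gamma> t \<in> S2" "(\<gamma> has_vector_derivative velocity \<gamma> t) (at t)"
    "(velocity \<gamma> has_vector_derivative velocity (velocity \<gamma>) t) (at t)" for t
    using assms(2) unfolding geodesic_def by (auto simp: vector_derivative_works[symmetric])
  then show ?thesis using assms(1) by (auto simp: sphere_curve_def sphere_curve_axioms_def)
qed

section \<open>The profile function of a metric\<close>

definition C1 :: "(real \<Rightarrow> real) \<Rightarrow> bool" where
  "C1 f \<longleftrightarrow> (\<exists>f'. (\<forall>x. (f has_real_derivative f' x) (at x)) \<and> continuous_on UNIV f')"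

definition C2 :: "(real \<Rightarrow> real) \<Rightarrow> bool" where
  "C2 f \<longleftrightarrow> (\<exists>f'. (\<forall>x. (f has_real_derivative f' x) (at x)) \<and> C1 f')"

lemma C1I: "(\<And>x. (f has_real_derivative f' x) (at x)) \<Longrightarrow> continuous_on UNIV f' \<Longrightarrow> C1 f"
  unfolding C1_def by blast

lemma C2I: "(\<And>x. (f has_real_derivative f' x) (at x)) \<Longrightarrow> C1 f' \<Longrightarrow> C2 f"
  unfolding C2_def by blast

lemma C1_deriv: "C1 f \<Longrightarrow> (f has_real_derivative deriv f x) (at x)" "C1 f \<Longrightarrow> continuous_on UNIV (deriv f)"
proof -
  assume "C1 f"
  then obtain f' where f': "\<And>x. (f has_real_derivative f' x) (at x)" "continuous_on UNIV f'"
    unfolding C1_def by blast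
  then have "deriv f = f'" by (intro ext DERIV_imp_deriv)
  with f' show "(f has_real_derivative deriv f x) (at x)" "continuous_on UNIV (deriv f)" by simp_all
qed

lemma C1_continuous: "C1 f \<Longrightarrow> continuous_on UNIV f"
  using C1_deriv(1) by (meson DERIV_continuous_on has_field_derivative_at_within)

lemma C2_deriv: "C2 f \<Longrightarrow> (f has_real_derivative deriv f x) (at x)" "C2 f \<Longrightarrow> C1 (deriv f)"
proof -
  assume "C2 f"
  then obtain f' where f': "\<And>x. (f has_real_derivative f' x) (at x)" "C1 f'"
    unfolding C2_def by blast
  then have "deriv f = f'" by (intro ext DERIV_imp_deriv)
  with f' show "(f has_real_derivative deriv f x) (at x)" "C1 (deriv f)" by simp_all
qed

lemma C2_imp_C1: "C2 f \<Longrightarrow> C1 f"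
  using C2_deriv C1_continuous C1I by blast

lemma C1_const: "C1 (\<lambda>x. c)" by (rule C1I[of _ "\<lambda>x. 0"]) auto
lemma C1_sin: "C1 sin" by (rule C1I[OF DERIV_sin]) (auto intro!: continuous_intros)
lemma C1_cos: "C1 cos" by (rule C1I[OF DERIV_cos]) (auto intro!: continuous_intros)

lemma C1_add: assumes "C1 f" "C1 g" shows "C1 (\<lambda>x. f x + g x)"
  by (rule C1I[OF DERIV_add[OF C1_deriv(1)[OF assms(1)] C1_deriv(1)[OF assms(2)]]])
    (intro continuous_intros C1_deriv(2) assms)

lemma C1_mult: assumes "C1 f" "C1 g" shows "C1 (\<lambda>x. f x * g x)"
  by (rule C1I[OF DERIV_mult[OF C1_deriv(1)[OF assms(1)] C1_deriv(1)[OF assms(2)]]])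
    (intro continuous_intros C1_deriv(2) C1_continuous assms)

lemma C1_inverse: assumes "C1 f" "\<And>x. f x \<noteq> 0" shows "C1 (\<lambda>x. inverse (f x))"
  by (rule C1I[OF DERIV_inverse_fun[OF C1_deriv(1)[OF assms(1)] assms(2)]])
    (intro continuous_intros C1_deriv(2) C1_continuous assms(1) ballI, simp add: assms(2))

lemma d_sqrt: assumes "C1 f" "f x > (0::real)"
  shows "((\<lambda>x. sqrt (f x)) has_real_derivative inverse (sqrt (f x)) / 2 * deriv f x) (at x)"
  by (rule DERIV_chain2[where f = sqrt, OF DERIV_real_sqrt[OF assms(2)] C1_deriv(1)[OF assms(1)]])

lemma C1_sqrt: assumes "C1 f" "\<And>x. f x > 0" shows "C1 (\<lambda>x. sqrt (f x))"
proof (rule C1I[OF d_sqrt[OF assms]])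
  have "sqrt (f x) \<noteq> 0" for x using assms(2)[of x] by simp
  then show "continuous_on UNIV (\<lambda>x. inverse (sqrt (f x)) / 2 * deriv f x)"
    by (intro continuous_intros C1_deriv(2) C1_continuous assms ballI) auto
qed

text \<open>A round half circle in a fixed plane, in general not a meridian of the metric. It
  continues to all real angles as a smooth curve through the poles, so that the coefficients below
  are regular on the whole line.\<close>

definition mer :: "real \<Rightarrow> real^3" where "mer \<phi> = vector [sin \<phi>, 0, - cos \<phi>]"
definition mer' :: "real \<Rightarrow> real^3" where "mer' \<phi> = vector [cos \<phi>, 0, sin \<phi>]"

lemma mer_nth [simp]: "mer \<phi> $ 1 = sin \<phi>" "mer \<phi> $ 2 = 0" "mer \<phi> $ 3 = - cos \<phi>"
  "mer' \<phi> $ 1 = cos \<phi>" "mer' \<phi> $ 2 = 0" "mer' \<phi> $ 3 = sin \<phi>"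
  by (simp_all add: mer_def mer'_def vector_3)

lemma mer_deriv: "(mer has_vector_derivative mer' \<phi>) (at \<phi>)" "(mer' has_vector_derivative - mer \<phi>) (at \<phi>)"
  by (rule has_vector_derivative_vec3; simp; auto intro!: derivative_eq_intros)+

lemma mer_S2: "mer \<phi> \<in> S2" by (simp only: S2_nth mer_nth) simp

lemma mer_nz: "mer \<phi> \<noteq> 0" using mer_S2[of \<phi>] by auto

lemma mer'_tangent: "mer' \<phi> \<in> tangent (mer \<phi>)" by (simp add: tangent_iff inner3)

lemma Y_tangent: "axis 2 1 \<in> tangent (mer \<phi>)" by (simp add: tangent_iff inner3)

lemma rot_field_mer: "rot_field (mer \<phi>) = sin \<phi> *\<^sub>R axis 2 1" by (simp add: vec3_eq)

lemma mer'_axis: "mer' \<phi> = cos \<phi> *\<^sub>R axis 1 1 + sin \<phi> *\<^sub>R axis 3 1" by (simp add: vec3_eq)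

lemma refl_z_mer: "refl_z (mer \<phi>) = mer (pi - \<phi>)" "refl_z (mer' \<phi>) = - mer' (pi - \<phi>)" "refl_z (axis 2 1) = axis 2 1"
  by (simp_all add: vec3_eq)

text \<open>The derivative along the half circle is a combination, with trigonometric coefficients,
  of functions that satisfy the same hypothesis; so the lemma can be iterated.\<close>

lemma smooth_along_mer:
  fixes F :: "real^3 \<Rightarrow> real"
  assumes F: "\<And>k. Ck_on k F (- {0})"
  shows "((\<lambda>\<phi>. F (mer \<phi>)) has_real_derivative
      cos \<phi> * frechet_derivative F (at (mer \<phi>)) (axis 1 1) + sin \<phi> * frechet_derivative F (at (mer \<phi>)) (axis 3 1)) (at \<phi>)"
    and "Ck_on k (\<lambda>x. frechet_derivative F (at x) (axis i 1)) (- {0})"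
    and "continuous_on UNIV (\<lambda>\<phi>. F (mer \<phi>))"
proof -
  have "F differentiable (at (mer \<phi>))" using F[of "Suc 0"] mer_nz by simp
  then have d: "(F has_derivative frechet_derivative F (at (mer \<phi>))) (at (mer \<phi>))"
    by (simp add: frechet_derivative_works)
  note lin = has_derivative_linear[OF d]
  have "((\<lambda>\<phi>. F (mer \<phi>)) has_derivative (\<lambda>h. frechet_derivative F (at (mer \<phi>)) (h *\<^sub>R mer' \<phi>))) (at \<phi>)"
    using has_derivative_compose[OF mer_deriv(1)[unfolded has_vector_derivative_def] d] .
  moreover have "(\<lambda>h. frechet_derivative F (at (mer \<phi>)) (h *\<^sub>R mer' \<phi>)) =
     (*) (cos \<phi> * frechet_derivative F (at (mer \<phi>)) (axis 1 1) + sin \<phi> * frechet_derivative F (at (mer \<phi>)) (axis 3 1))"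
    by (rule ext) (simp add: mer'_axis linear_add[OF lin] linear_scale[OF lin] algebra_simps)
  ultimately show "((\<lambda>\<phi>. F (mer \<phi>)) has_real_derivative
      cos \<phi> * frechet_derivative F (at (mer \<phi>)) (axis 1 1) + sin \<phi> * frechet_derivative F (at (mer \<phi>)) (axis 3 1)) (at \<phi>)"
    by (simp add: has_field_derivative_def)
  have "axis i (1::real) \<in> (Basis :: (real^3) set)" by (auto simp: Basis_vec_def)
  then show "Ck_on k (\<lambda>x. frechet_derivative F (at x) (axis i 1)) (- {0})"
    using F[of "Suc k"] by simp
  have "continuous_on (- {0}) F" using F[of 0] by simp
  moreover have "continuous_on UNIV mer"
    using mer_deriv(1) by (meson continuous_at_imp_continuous_on has_vector_derivative_continuous)
  ultimately show "continuous_on UNIV (\<lambda>\<phi>. F (mer \<phi>))"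
    by (rule continuous_on_compose2) (use mer_nz in auto)
qed

lemma C1_along_mer: assumes F: "\<And>k. Ck_on k (F :: real^3 \<Rightarrow> real) (- {0})" shows "C1 (\<lambda>\<phi>. F (mer \<phi>))"
  by (rule C1I[OF smooth_along_mer(1)[OF F]])
    (intro continuous_intros smooth_along_mer(3)[OF smooth_along_mer(2)[OF F]])

lemma C2_along_mer: assumes F: "\<And>k. Ck_on k (F :: real^3 \<Rightarrow> real) (- {0})" shows "C2 (\<lambda>\<phi>. F (mer \<phi>))"
  by (rule C2I[OF smooth_along_mer(1)[OF F]])
    (intro C1_add C1_mult C1_cos C1_sin C1_along_mer[OF smooth_along_mer(2)[OF F]])

context sphere_metric
begin

text \<open>The metric along the meridian half circle, with the longitude field \<open>sin \<phi> \<partial>\<^sub>2\<close> divided by \<open>sin \<phi>\<close>,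
  so that the coefficients stay regular and positive at the poles.\<close>

definition Af where "Af \<phi> = G (mer \<phi>) (mer' \<phi>) (mer' \<phi>)"
definition bf where "bf \<phi> = G (mer \<phi>) (mer' \<phi>) (axis 2 1)"
definition cf where "cf \<phi> = G (mer \<phi>) (axis 2 1) (axis 2 1)"
definition kap where "kap \<phi> = Af \<phi> - (bf \<phi>)^2 / cf \<phi>"
definition ss where "ss \<phi> = sqrt (kap \<phi>)"
definition rr where "rr \<phi> = sin \<phi> * sqrt (cf \<phi>)"

lemma cf_pos: "cf \<phi> > 0"
proof -
  have "axis 2 (1::real) \<noteq> (0::real^3)" by (simp add: vec3_eq)
  then show ?thesis unfolding cf_def by (rule G_pos[OF mer_S2 Y_tangent])
qed

text \<open>\<open>kap \<phi>\<close> is the squared length of the component of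
  \<open>mer' \<phi>\<close> orthogonal to the parallel, by one Gram-Schmidt step with the
  coefficient \<open>- bf \<phi> / cf \<phi>\<close>. Its root \<open>ss\<close> is hence the speed
  of the true meridian in terms of the polar angle.\<close>

lemma kap_pos: "kap \<phi> > 0"
proof -
  define k where "k = - bf \<phi> / cf \<phi>"
  define u where "u = mer' \<phi> + k *\<^sub>R axis 2 1"
  have "u \<noteq> 0"
  proof
    assume "u = 0"
    then have "u $ 1 = 0" "u $ 3 = 0" by simp_all
    then show False using sin_cos_squared_add[of \<phi>] by (simp add: u_def)
  qed
  moreover have "u \<in> tangent (mer \<phi>)" by (simp add: u_def tangent_iff inner3)
  ultimately have "G (mer \<phi>) u u > 0" by (intro G_pos[OF mer_S2])
  moreover have "G (mer \<phi>) u u = Af \<phi> + 2 * k * bf \<phi> + k^2 * cf \<phi>"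
    unfolding u_def using mer_nz[of \<phi>] G_sym[OF mer_nz, of \<phi> "axis 2 1" "mer' \<phi>"]
    by (simp add: G_linear Af_def bf_def cf_def power2_eq_square algebra_simps)
  moreover have "Af \<phi> + 2 * k * bf \<phi> + k^2 * cf \<phi> = kap \<phi>"
    using cf_pos[of \<phi>] by (simp add: kap_def k_def power2_eq_square field_simps)
  ultimately show ?thesis by simp
qed

lemma C2_cf: "C2 cf" unfolding cf_def[abs_def] by (rule C2_along_mer[OF G_smooth])

lemma C1_Af: "C1 Af"
proof -
  have eq: "Af = (\<lambda>\<phi>. cos \<phi> * (cos \<phi> * G (mer \<phi>) (axis 1 1) (axis 1 1)) + 2 * (cos \<phi> * (sin \<phi> * G (mer \<phi>) (axis 1 1) (axis 3 1)))
     + sin \<phi> * (sin \<phi> * G (mer \<phi>) (axis 3 1) (axis 3 1)))"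
  proof
    fix \<phi> show "Af \<phi> = cos \<phi> * (cos \<phi> * G (mer \<phi>) (axis 1 1) (axis 1 1)) + 2 * (cos \<phi> * (sin \<phi> * G (mer \<phi>) (axis 1 1) (axis 3 1)))
     + sin \<phi> * (sin \<phi> * G (mer \<phi>) (axis 3 1) (axis 3 1))"
      using G_sym[OF mer_nz, of \<phi> "axis 3 1" "axis 1 1"]
      by (simp add: Af_def mer'_axis G_linear mer_nz algebra_simps)
  qed
  show ?thesis unfolding eq by (intro C1_add C1_mult C1_const C1_cos C1_sin C1_along_mer G_smooth)
qed

lemma C1_bf: "C1 bf"
proof -
  have eq: "bf = (\<lambda>\<phi>. cos \<phi> * G (mer \<phi>) (axis 1 1) (axis 2 1) + sin \<phi> * G (mer \<phi>) (axis 3 1) (axis 2 1))"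
    by (rule ext) (simp add: bf_def mer'_axis G_linear mer_nz)
  show ?thesis unfolding eq by (intro C1_add C1_mult C1_const C1_cos C1_sin C1_along_mer G_smooth)
qed

lemma C1_kap: "C1 kap"
proof -
  have eq: "kap = (\<lambda>\<phi>. Af \<phi> + (-1) * (bf \<phi> * bf \<phi> * inverse (cf \<phi>)))"
    by (rule ext) (simp add: kap_def power2_eq_square divide_inverse)
  show ?thesis unfolding eq
  proof (intro C1_add C1_mult C1_const C1_Af C1_bf C1_inverse C2_imp_C1 C2_cf)
    show "cf x \<noteq> 0" for x using cf_pos[of x] by simp
  qed
qed

lemma C1_ss: "C1 ss" unfolding ss_def[abs_def] by (rule C1_sqrt[OF C1_kap kap_pos])

lemma ss_pos: "ss \<phi> > 0" unfolding ss_def using kap_pos by simp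

lemma d_rr: "(rr has_real_derivative cos \<phi> * sqrt (cf \<phi>) + inverse (sqrt (cf \<phi>)) / 2 * deriv cf \<phi> * sin \<phi>) (at \<phi>)"
  unfolding rr_def[abs_def] by (rule DERIV_mult[OF DERIV_sin d_sqrt[OF C2_imp_C1[OF C2_cf] cf_pos]])

lemma C2_rr: "C2 rr"
proof (rule C2I[OF d_rr])
  have "C1 (\<lambda>x. cos x * sqrt (cf x) + inverse (sqrt (cf x)) * (1/2) * deriv cf x * sin x)"
  proof (intro C1_add C1_mult C1_const C1_cos C1_sin C1_inverse C1_sqrt C2_deriv(2) C2_imp_C1[OF C2_cf] C2_cf cf_pos)
    show "sqrt (cf x) \<noteq> 0" for x using cf_pos[of x] by simp
  qed
  then show "C1 (\<lambda>x. cos x * sqrt (cf x) + inverse (sqrt (cf x)) / 2 * deriv cf x * sin x)" by simp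
qed

lemma deriv_rr: "2 * sqrt (cf \<phi>) * deriv rr \<phi> = 2 * cos \<phi> * cf \<phi> + sin \<phi> * deriv cf \<phi>"
proof -
  have "sqrt (cf \<phi>) * sqrt (cf \<phi>) = cf \<phi>" "sqrt (cf \<phi>) > 0" using cf_pos[of \<phi>] by simp_all
  then show ?thesis unfolding DERIV_imp_deriv[OF d_rr] by (simp add: field_simps)
qed

lemma rr_sq: "(rr \<phi>)^2 = G (mer \<phi>) (rot_field (mer \<phi>)) (rot_field (mer \<phi>))"
  using cf_pos[of \<phi>] by (simp add: rr_def rot_field_mer G_linear mer_nz cf_def[symmetric] power_mult_distrib) (simp add: power2_eq_square)

lemma rr_pos: "\<phi> \<in> {0<..<pi} \<Longrightarrow> rr \<phi> > 0"
  unfolding rr_def using cf_pos[of \<phi>] sin_gt_zero[of \<phi>] by simp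

text \<open>A quarter turn fixes the pole and maps \<open>mer' 0\<close> to \<open>axis 2 1\<close>
  and \<open>axis 2 1\<close> to \<open>- mer' 0\<close>, so the invariant inner product there is a
  multiple of the round one.\<close>

lemma pole_isotropic: "bf 0 = 0" "Af 0 = cf 0"
proof -
  have m: "rot (pi/2) (mer 0) = mer 0" "rot (pi/2) (mer' 0) = axis 2 1" "rot (pi/2) (axis 2 1) = - mer' 0"
    by (simp_all add: vec3_eq)
  have "cf 0 = Af 0" unfolding cf_def Af_def using G_rot[OF mer_nz, of "pi/2" 0 "mer' 0" "mer' 0"] by (simp only: m)
  then show "Af 0 = cf 0" by simp
  have "bf 0 = G (mer 0) (axis 2 1) (- mer' 0)"
    unfolding bf_def using G_rot[OF mer_nz, of "pi/2" 0 "mer' 0" "axis 2 1"] by (simp only: m)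
  also have "\<dots> = - bf 0" unfolding bf_def using G_sym[OF mer_nz, of 0 "axis 2 1" "mer' 0"] by (simp add: G_linear mer_nz)
  finally show "bf 0 = 0" by simp
qed

lemma deriv_rr_0: "deriv rr 0 = ss 0"
  unfolding DERIV_imp_deriv[OF d_rr] ss_def kap_def by (simp add: pole_isotropic)

text \<open>\<open>axis 3 1\<close> is invariant under rotations, and radially projected it is \<open>sin \<phi> \<partial>\<^sub>\<phi>\<close>.\<close>

lemma DG_axis3: "DG (rot \<theta> (mer \<phi>)) (k *\<^sub>R rot_field (rot \<theta> (mer \<phi>))) (k *\<^sub>R rot_field (rot \<theta> (mer \<phi>))) (axis 3 1) =
   2 * k^2 * (sin \<phi>)^2 * sqrt (cf \<phi>) * deriv rr \<phi>"
proof -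
  define w :: "real^3" where "w = (k * sin \<phi>) *\<^sub>R axis 2 1"
  have w: "k *\<^sub>R rot_field (rot \<theta> (mer \<phi>)) = rot \<theta> w" by (simp add: rot_rot_field rot_field_mer w_def rot_scale)
  define X where "X = (\<lambda>s. rot \<theta> (mer \<phi>) + s *\<^sub>R axis 3 1)"
  have X: "(X has_vector_derivative axis 3 1) (at 0)"
    unfolding X_def by (auto intro!: derivative_eq_intros)
  have lin: "linear (DG (mer \<phi>) w w)" by (rule DG_linear[OF mer_nz])
  have rnz: "rot \<theta> x \<noteq> 0" if "x \<noteq> 0" for x using that rot_norm[of \<theta> x] by auto
  have "DG (rot \<theta> (mer \<phi>)) (rot \<theta> w) (rot \<theta> w) (axis 3 1) = DG (mer \<phi>) w w (axis 3 1)"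
  proof -
    have r: "((\<lambda>x. rot \<theta> x) has_derivative rot \<theta>) (at (mer \<phi>))"
      by (intro bounded_linear_imp_has_derivative linear_conv_bounded_linear[THEN iffD1] linearI rot_add rot_scale)
    have "((\<lambda>x. G (rot \<theta> x) (rot \<theta> w) (rot \<theta> w)) has_derivative (\<lambda>h. DG (rot \<theta> (mer \<phi>)) (rot \<theta> w) (rot \<theta> w) (rot \<theta> h))) (at (mer \<phi>))"
      by (rule has_derivative_compose[OF r G_has_derivative[OF rnz[OF mer_nz]]])
    then have "((\<lambda>x. G x w w) has_derivative (\<lambda>h. DG (rot \<theta> (mer \<phi>)) (rot \<theta> w) (rot \<theta> w) (rot \<theta> h))) (at (mer \<phi>))"
      by (rule has_derivative_transform_within_open[of _ _ _ _ "- {0}"]) (use mer_nz G_rot in auto)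
    from fun_cong[OF has_derivative_unique[OF this G_has_derivative[OF mer_nz]], of "axis 3 1"]
    have "DG (rot \<theta> (mer \<phi>)) (rot \<theta> w) (rot \<theta> w) (rot \<theta> (axis 3 1)) = DG (mer \<phi>) w w (axis 3 1)" .
    moreover have "rot \<theta> (axis 3 1) = axis 3 1" by (simp add: vec3_eq)
    ultimately show ?thesis by simp
  qed
  \<comment> \<open>The axis splits into a part along the half circle, which differentiates
    \<open>cf\<close>, and a radial part, which is evaluated by Euler's identity.\<close>
  also have "DG (mer \<phi>) w w (axis 3 1) = DG (mer \<phi>) w w (sin \<phi> *\<^sub>R mer' \<phi> + (- cos \<phi>) *\<^sub>R mer \<phi>)"
    by (rule arg_cong[of _ _ "DG (mer \<phi>) w w"]) (simp add: vec3_eq power2_eq_square[symmetric] sin_squared_eq)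
  also have "\<dots> = sin \<phi> * DG (mer \<phi>) w w (mer' \<phi>) - cos \<phi> * DG (mer \<phi>) w w (mer \<phi>)"
    by (simp only: linear_add[OF lin] linear_scale[OF lin]) simp
  also have "DG (mer \<phi>) w w (mer \<phi>) = - 2 * G (mer \<phi>) w w" by (rule DG_radial[OF mer_nz])
  also have "G (mer \<phi>) w w = (k * sin \<phi>)^2 * cf \<phi>"
    by (simp add: w_def G_linear mer_nz cf_def power2_eq_square)
  also have "DG (mer \<phi>) w w (mer' \<phi>) = (k * sin \<phi>)^2 * deriv cf \<phi>"
  proof -
    have "((\<lambda>s. G (mer s) w w) has_real_derivative DG (mer \<phi>) w w (mer' \<phi>)) (at \<phi>)"
      using G_along_curve[OF mer_deriv(1) has_vector_derivative_const[of w] has_vector_derivative_const[of w] mer_nz, of \<phi>]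
      by (simp add: G_linear mer_nz)
    moreover have "(\<lambda>s. G (mer s) w w) = (\<lambda>s. (k * sin \<phi>)^2 * cf s)"
      by (rule ext) (simp add: w_def G_linear mer_nz cf_def power2_eq_square)
    moreover have "((\<lambda>s. (k * sin \<phi>)^2 * cf s) has_real_derivative (k * sin \<phi>)^2 * deriv cf \<phi>) (at \<phi>)"
      by (rule DERIV_cmult[OF C2_deriv(1)[OF C2_cf]])
    ultimately show ?thesis using DERIV_unique by simp
  qed
  also have "sin \<phi> * ((k * sin \<phi>)^2 * deriv cf \<phi>) - cos \<phi> * (- 2 * ((k * sin \<phi>)^2 * cf \<phi>)) =
     (k * sin \<phi>)^2 * (2 * cos \<phi> * cf \<phi> + sin \<phi> * deriv cf \<phi>)" by (simp add: algebra_simps)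
  also have "\<dots> = 2 * k^2 * (sin \<phi>)^2 * sqrt (cf \<phi>) * deriv rr \<phi>"
    unfolding deriv_rr[symmetric] by (simp add: power_mult_distrib)
  finally show ?thesis by (simp only: w)
qed

end

context sphere_curve
begin

lemma xi_scale: "xi t (k *\<^sub>R e) = k * xi t e" and xi_add: "xi t (e + f) = xi t e + xi t f"
proof -
  have z: "xi t 0 = 0" using xi_linear[of t 1 0 0] by simp
  show "xi t (k *\<^sub>R e) = k * xi t e" using xi_linear[of t k e 0] z by simp
  show "xi t (e + f) = xi t e + xi t f" using xi_linear[of t 1 e f] by simp
qed

text \<open>Off the poles the position, the rotation field and the axis form a basis of space, and
  \<open>xi\<close> kills the position. So the geodesic equation consists of conservation of
  momentum and one equation along the axis.\<close>

lemma xi_decompose: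
  assumes "\<gamma> t \<noteq> south" "\<gamma> t \<noteq> north"
  shows "xi t e = (e $ 2 * \<gamma> t $ 1 - e $ 1 * \<gamma> t $ 2) / ((\<gamma> t $ 1)^2 + (\<gamma> t $ 2)^2) * xi t (rot_field (\<gamma> t))
    + (e $ 3 - (e $ 1 * \<gamma> t $ 1 + e $ 2 * \<gamma> t $ 2) / ((\<gamma> t $ 1)^2 + (\<gamma> t $ 2)^2) * \<gamma> t $ 3) * xi t (axis 3 1)"
proof -
  have nz: "(\<gamma> t $ 1)^2 + (\<gamma> t $ 2)^2 \<noteq> 0"
  proof
    assume 0: "(\<gamma> t $ 1)^2 + (\<gamma> t $ 2)^2 = 0"
    then have "\<gamma> t $ 1 = 0" "\<gamma> t $ 2 = 0" by (simp_all add: sum_power2_eq_zero_iff)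
    moreover have "(\<gamma> t $ 3)^2 = 1" using on_S2[of t] 0 unfolding S2_nth by simp
    then have "\<gamma> t $ 3 = 1 \<or> \<gamma> t $ 3 = -1" by (simp add: power2_eq_1_iff)
    ultimately show False using assms by (auto simp: vec3_eq)
  qed
  define n where "n = (\<gamma> t $ 1)^2 + (\<gamma> t $ 2)^2"
  define \<alpha> where "\<alpha> = (e $ 1 * \<gamma> t $ 1 + e $ 2 * \<gamma> t $ 2) / n"
  define \<beta> where "\<beta> = (e $ 2 * \<gamma> t $ 1 - e $ 1 * \<gamma> t $ 2) / n"
  have "e = \<alpha> *\<^sub>R \<gamma> t + (\<beta> *\<^sub>R rot_field (\<gamma> t) + (e $ 3 - \<alpha> * \<gamma> t $ 3) *\<^sub>R axis 3 1)"
  proof -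
    have "\<alpha> * \<gamma> t $ 1 - \<beta> * \<gamma> t $ 2 = e $ 1 * n / n" "\<alpha> * \<gamma> t $ 2 + \<beta> * \<gamma> t $ 1 = e $ 2 * n / n"
      unfolding \<alpha>_def \<beta>_def n_def by (simp_all add: power2_eq_square diff_divide_distrib[symmetric] add_divide_distrib[symmetric] algebra_simps)
    then show ?thesis using nz unfolding n_def[symmetric] by (simp add: vec3_eq)
  qed
  then have "xi t e = xi t (\<alpha> *\<^sub>R \<gamma> t + (\<beta> *\<^sub>R rot_field (\<gamma> t) + (e $ 3 - \<alpha> * \<gamma> t $ 3) *\<^sub>R axis 3 1))"
    by (rule arg_cong)
  also have "\<dots> = \<beta> * xi t (rot_field (\<gamma> t)) + (e $ 3 - \<alpha> * \<gamma> t $ 3) * xi t (axis 3 1)"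
    by (simp add: xi_add xi_scale xi_radial)
  finally show ?thesis by (simp only: \<alpha>_def \<beta>_def n_def)
qed

end

lemma rot_eq_iff_2pi:
  assumes "x $ 1 \<noteq> 0 \<or> x $ 2 \<noteq> 0"
  shows "rot a x = rot b x \<longleftrightarrow> (\<exists>k::int. a - b = 2 * pi * k)"
proof
  assume "rot a x = rot b x"
  then have "rot (- b) (rot a x) = rot (- b) (rot b x)" by simp
  then have "rot (a - b) x = x" by (simp add: rot_rot)
  then have 1: "cos (a - b) * x $ 1 - sin (a - b) * x $ 2 = x $ 1" and 2: "sin (a - b) * x $ 1 + cos (a - b) * x $ 2 = x $ 2"
    by (metis rot_nth)+
  have "(cos (a - b) - 1) * ((x $ 1)^2 + (x $ 2)^2) = 0" 
  proof -
    have "(cos (a - b) - 1) * x $ 1 = sin (a - b) * x $ 2" "(cos (a - b) - 1) * x $ 2 = - (sin (a - b) * x $ 1)"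
      using 1 2 by (simp_all add: algebra_simps)
    moreover have "(cos (a - b) - 1) * ((x $ 1)^2 + (x $ 2)^2) = x $ 1 * ((cos (a - b) - 1) * x $ 1) + x $ 2 * ((cos (a - b) - 1) * x $ 2)"
      by (simp add: power2_eq_square algebra_simps)
    ultimately show ?thesis by simp
  qed
  moreover have "(x $ 1)^2 + (x $ 2)^2 \<noteq> 0" using assms by (simp add: sum_power2_eq_zero_iff)
  ultimately have "cos (a - b) = 1" by (metis eq_iff_diff_eq_0 mult_eq_0_iff)
  then show "\<exists>k::int. a - b = 2 * pi * k" by (auto simp: cos_one_2pi_int mult.commute mult.left_commute)
next
  assume "\<exists>k::int. a - b = 2 * pi * k"
  then obtain k :: int where "a = b + 2 * pi * k" by (auto simp: algebra_simps)
  moreover have "cos (2 * pi * k) = 1" "sin (2 * pi * k) = 0"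
    using cos_int_2pin[of k] sin_int_2pin[of k] by (simp_all add: mult.commute mult.left_commute)
  ultimately show "rot a x = rot b x" by (simp add: vec3_eq cos_add sin_add)
qed

section \<open>Parallels as equators\<close>

context sphere_metric
begin

lemma parallel_curve: "sphere_curve g (\<lambda>t. rot t (mer \<phi>)) (\<lambda>t. rot t (rot_field (mer \<phi>))) (\<lambda>t. rot t (rot_field (rot_field (mer \<phi>))))"
  by unfold_locales (use mer_S2 rot_norm rot_deriv in auto)

text \<open>A parallel is an orbit of the rotations, so its pairings with the rotation field and
  with the axis are constant. The remaining force along the axis is proportional to
  \<open>deriv rr \<phi>\<close> by \<open>DG_axis3\<close>.\<close>

lemma parallel_geodesic:
  assumes \<phi>: "\<phi> \<in> {0<..<pi}" and crit: "deriv rr \<phi> = 0"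
  shows "geodesic g (\<lambda>t. rot t (mer \<phi>))"
proof -
  interpret sphere_curve g "\<lambda>t. rot t (mer \<phi>)" "\<lambda>t. rot t (rot_field (mer \<phi>))" "\<lambda>t. rot t (rot_field (rot_field (mer \<phi>)))"
    by (rule parallel_curve)
  have s: "sin \<phi> > 0" using \<phi> by (intro sin_gt_zero) auto
  have np: "rot t (mer \<phi>) \<noteq> south" "rot t (mer \<phi>) \<noteq> north" for t
  proof -
    have "(cos \<phi>)^2 \<noteq> 1" using s by (simp add: cos_squared_eq)
    then have "- cos \<phi> \<noteq> 1" "- cos \<phi> \<noteq> -1" by (auto simp: power2_eq_1_iff minus_equation_iff)
    then show "rot t (mer \<phi>) \<noteq> south" "rot t (mer \<phi>) \<noteq> north" by (auto simp: vec3_eq)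
  qed
  have p: "xi t (rot_field (rot t (mer \<phi>))) = 0" for t
  proof -
    have "(\<lambda>s. G (rot s (mer \<phi>)) (rot s (rot_field (mer \<phi>))) (rot_field (rot s (mer \<phi>)))) = (\<lambda>s. G (mer \<phi>) (rot_field (mer \<phi>)) (rot_field (mer \<phi>)))"
      by (simp add: fun_eq_iff rot_rot_field G_rot mer_nz)
    then show ?thesis using momentum_deriv[of t] DERIV_unique[OF _ DERIV_const] by metis
  qed
  have z: "xi t (axis 3 1) = 0" for t
  proof -
    have r3: "axis 3 1 = rot s (axis 3 1)" for s by (simp add: vec3_eq)
    have "(\<lambda>s. G (rot s (mer \<phi>)) (rot s (rot_field (mer \<phi>))) (axis 3 1)) = (\<lambda>s. G (mer \<phi>) (rot_field (mer \<phi>)) (axis 3 1))"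
      by (rule ext) (subst r3, rule G_rot[OF mer_nz])
    then have "DG (rot t (mer \<phi>)) (rot t (rot_field (mer \<phi>))) (axis 3 1) (rot t (rot_field (mer \<phi>))) + G (rot t (mer \<phi>)) (rot t (rot_field (rot_field (mer \<phi>)))) (axis 3 1) = 0"
      using momentum_form_deriv[of "axis 3 1" t] DERIV_unique[OF _ DERIV_const] by metis
    moreover have "DG (rot t (mer \<phi>)) (rot t (rot_field (mer \<phi>))) (rot t (rot_field (mer \<phi>))) (axis 3 1) = 0"
      using DG_axis3[of t \<phi> 1] crit by (simp add: rot_rot_field)
    ultimately show ?thesis by (simp add: xi_def)
  qed
  show ?thesis unfolding geodesic_iff using xi_decompose[OF np] p z by simp
qed

lemma parallel_equator:
  assumes \<phi>: "\<phi> \<in> {0<..<pi}" and crit: "deriv rr \<phi> = 0"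
  shows "closed_geodesic g (\<lambda>t. rot t (mer \<phi>)) (2 * pi)" "is_equator g (range (\<lambda>t. rot t (mer \<phi>)))"
proof -
  have s: "mer \<phi> $ 1 \<noteq> 0" using \<phi> sin_gt_zero[of \<phi>] by simp
  show 1: "closed_geodesic g (\<lambda>t. rot t (mer \<phi>)) (2 * pi)"
    unfolding closed_geodesic_def
  proof (intro conjI allI impI parallel_geodesic assms)
    show "rot (t + 2 * pi) (mer \<phi>) = rot t (mer \<phi>)" for t
      using rot_eq_iff_2pi[of "mer \<phi>"] s by (intro iffD2[OF rot_eq_iff_2pi] exI[of _ 1]) auto
    fix u :: real assume u: "0 < u \<and> u < 2 * pi"
    have "rot (0 + u) (mer \<phi>) \<noteq> rot 0 (mer \<phi>)"
    proof
      assume "rot (0 + u) (mer \<phi>) = rot 0 (mer \<phi>)"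
      then obtain k :: int where "u = 2 * pi * k" using rot_eq_iff_2pi[of "mer \<phi>" "0 + u" 0] s by auto
      then have "0 < real_of_int k" "real_of_int k < 1" using u by (simp_all add: zero_less_mult_iff)
      then show False by simp
    qed
    then show "\<exists>t. rot (t + u) (mer \<phi>) \<noteq> rot t (mer \<phi>)" by blast
  qed simp
  have "rot a ` range (\<lambda>t. rot t (mer \<phi>)) = range (\<lambda>t. rot t (mer \<phi>))" for a
  proof (intro equalityI subsetI)
    fix x assume "x \<in> range (\<lambda>t. rot t (mer \<phi>))"
    then obtain t where "x = rot a (rot (t - a) (mer \<phi>))" by (auto simp: rot_rot)
    then show "x \<in> rot a ` range (\<lambda>t. rot t (mer \<phi>))" by blast
  qed (auto simp: rot_rot)
  with 1 show "is_equator g (range (\<lambda>t. rot t (mer \<phi>)))" unfolding is_equator_def by blast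
qed

end

locale rotation_metric = sphere_metric +
  assumes Z2: "Z2_symmetric g" and unique_equator: "\<exists>!C. is_equator g C"
begin

lemma G_refl: "x \<noteq> 0 \<Longrightarrow> G (refl_z x) (refl_z v) (refl_z w) = G x v w"
  using Z2 sgn_S2[of x] dsgn_tangent[of x] unfolding Z2_symmetric_def pull_def dsgn_refl_z sgn_refl_z by blast

lemma coefficients_sym: "Af (pi - \<phi>) = Af \<phi>" "bf (pi - \<phi>) = - bf \<phi>" "cf (pi - \<phi>) = cf \<phi>"
  unfolding Af_def bf_def cf_def
  using G_refl[OF mer_nz, of \<phi> "mer' \<phi>" "mer' \<phi>"] G_refl[OF mer_nz, of \<phi> "mer' \<phi>" "axis 2 1"]
    G_refl[OF mer_nz, of \<phi> "axis 2 1" "axis 2 1"]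
  unfolding refl_z_mer by (simp_all add: G_linear mer_nz)

lemma rr_sym: "rr (pi - \<phi>) = rr \<phi>" and ss_sym: "ss (pi - \<phi>) = ss \<phi>"
  by (simp_all add: rr_def ss_def kap_def coefficients_sym)

lemma deriv_rr_equator: "deriv rr (pi/2) = 0"
proof -
  have "((\<lambda>x. rr (pi - x)) has_real_derivative deriv rr (pi - pi/2) * - 1) (at (pi/2))"
    by (rule DERIV_chain2[where f = rr, OF C2_deriv(1)[OF C2_rr]]) (auto intro!: derivative_eq_intros)
  then have "(rr has_real_derivative - deriv rr (pi/2)) (at (pi/2))" by (simp add: rr_sym)
  from DERIV_unique[OF this C2_deriv(1)[OF C2_rr]] show ?thesis by simp
qed

text \<open>Every critical parallel is an equator, and so is the parallel fixed by the reflection.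
  By uniqueness they coincide as sets, and the height, which is constant on each, determines the
  angle.\<close>

lemma critical_imp_equator:
  assumes \<phi>: "\<phi> \<in> {0<..<pi}" and crit: "deriv rr \<phi> = 0"
  shows "\<phi> = pi/2"
proof -
  have "pi/2 \<in> {0<..<pi}" by simp
  then have "range (\<lambda>t. rot t (mer \<phi>)) = range (\<lambda>t. rot t (mer (pi/2)))"
    using unique_equator parallel_equator(2)[OF \<phi> crit] parallel_equator(2)[OF _ deriv_rr_equator] by blast
  then obtain t where "mer \<phi> = rot t (mer (pi/2))" by (metis rangeE rangeI rot_0)
  then have "mer \<phi> $ 3 = rot t (mer (pi/2)) $ 3" by simp
  then have "cos \<phi> = cos (pi/2)" by simp
  then show ?thesis using \<phi> cos_inj_pi[of \<phi> "pi/2"] by auto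
qed

lemma deriv_rr_pos: "\<phi> \<in> {0..<pi/2} \<Longrightarrow> deriv rr \<phi> > 0"
proof (rule ccontr)
  assume \<phi>: "\<phi> \<in> {0..<pi/2}" and neg: "\<not> deriv rr \<phi> > 0"
  have 0: "deriv rr 0 > 0" using deriv_rr_0 ss_pos by simp
  have "continuous_on {0..\<phi>} (deriv rr)"
    using C1_continuous[OF C2_deriv(2)[OF C2_rr]] by (rule continuous_on_subset) simp
  then have "\<exists>x\<ge>0. x \<le> \<phi> \<and> deriv rr x = 0"
    using 0 neg \<phi> by (intro IVT2') auto
  then obtain x where x: "0 \<le> x" "x \<le> \<phi>" "deriv rr x = 0" by blast
  have "x \<noteq> 0" using x(3) 0 by auto
  then have "x = pi/2" using x \<phi> by (intro critical_imp_equator) auto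
  then show False using x \<phi> by simp
qed

lemma equator_eq: "equator g = {x \<in> S2. x $ 3 = 0}"
proof -
  have "is_equator g (range (\<lambda>t. rot t (mer (pi/2))))"
    by (rule parallel_equator) (auto simp: deriv_rr_equator)
  then have "equator g = range (\<lambda>t. rot t (mer (pi/2)))"
    unfolding equator_def using unique_equator by (intro the1_equality)
  also have "\<dots> = {x \<in> S2. x $ 3 = 0}"
  proof (intro equalityI subsetI)
    fix x assume "x \<in> {x \<in> S2. x $ 3 = 0}"
    then have x: "(x $ 1)^2 + (x $ 2)^2 = 1" "x $ 3 = 0" using S2_nth[of x] by auto
    then obtain t where "x $ 1 = cos t" "x $ 2 = sin t" using sincos_total_2pi[of "x $ 1" "x $ 2"] by metis
    then have "x = rot t (mer (pi/2))" using x by (simp add: vec3_eq)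
    then show "x \<in> range (\<lambda>t. rot t (mer (pi/2)))" by blast
  next
    fix x assume "x \<in> range (\<lambda>t. rot t (mer (pi/2)))"
    then obtain t where t: "x = rot t (mer (pi/2))" by blast
    have "norm x = 1" unfolding t rot_norm using mer_S2 by simp
    then show "x \<in> {x \<in> S2. x $ 3 = 0}" by (simp add: t)
  qed
  finally show ?thesis .
qed

end

section \<open>Geodesics as oscillations about the equator\<close>

lemma continuous_antiderivative_interval:
  fixes f :: "real \<Rightarrow> real"
  assumes cont: "continuous_on {l<..<u} f" and c: "c \<in> {l<..<u}"
  shows "\<exists>F. \<forall>x\<in>{l<..<u}. (F has_real_derivative f x) (at x)"
proof (intro exI ballI)
  fix x assume x: "x \<in> {l<..<u}"
  define a where "a = (min c x + l) / 2"
  define b where "b = (max c x + u) / 2"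
  have ab: "l < a" "a < c" "a < x" "x < b" "c < b" "b < u" using x c by (auto simp: a_def b_def min_def max_def)
  have "((\<lambda>w. LBINT y=ereal c..ereal w. f y) has_vector_derivative f x) (at x within {a..b})"
    by (rule interval_integral_FTC2) (use ab in \<open>auto intro: continuous_on_subset[OF cont]\<close>)
  then show "((\<lambda>w. LBINT y=ereal c..ereal w. f y) has_real_derivative f x) (at x)"
    using ab by (simp add: at_within_Icc_at has_real_derivative_iff_has_vector_derivative)
qed

definition antider :: "(real \<Rightarrow> real) \<Rightarrow> real \<Rightarrow> real" where
  "antider f = (SOME F. (\<forall>x. (F has_real_derivative f x) (at x)) \<and> F 0 = 0)"

lemma antider:
  assumes "continuous_on UNIV f"
  shows "(antider f has_real_derivative f x) (at x)" "antider f 0 = 0"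
proof -
  have "\<exists>F. (\<forall>x. (F has_real_derivative f x) (at x)) \<and> F 0 = 0"
    using continuous_antiderivative[OF assms] by metis
  from someI_ex[OF this] show "(antider f has_real_derivative f x) (at x)" "antider f 0 = 0"
    unfolding antider_def by blast+
qed

lemma antider_period:
  assumes cont: "continuous_on UNIV f" and per: "\<And>x. f (x + 2 * pi) = f x"
  shows "antider f (x + 2 * pi * of_int k) = antider f x + of_int k * integral {0..2 * pi} f"
proof -
  have int: "integral {0..2 * pi} f = antider f (2 * pi)"
  proof -
    have "(f has_integral antider f (2 * pi) - antider f 0) {0..2 * pi}"
      using antider(1)[OF cont] by (intro fundamental_theorem_of_calculus)
        (auto simp: has_real_derivative_iff_has_vector_derivative[symmetric] intro: has_field_derivative_at_within)
    then show ?thesis using antider(2)[OF cont] by (simp add: integral_unique)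
  qed
  have step: "antider f (x + 2 * pi) = antider f x + integral {0..2 * pi} f" for x
  proof -
    have "((\<lambda>x. antider f (x + 2 * pi) - antider f x) has_real_derivative f (y + 2 * pi) * 1 - f y) (at y)" for y
      by (intro DERIV_diff DERIV_chain2[where f = "antider f", OF antider(1)[OF cont]] antider(1)[OF cont]) (auto intro!: derivative_eq_intros)
    then have "((\<lambda>x. antider f (x + 2 * pi) - antider f x) has_real_derivative 0) (at y)" for y by (simp add: per)
    from constant_if_deriv_zero[OF this, of x 0] show ?thesis by (simp add: int antider(2)[OF cont])
  qed
  have nat: "antider f (x + 2 * pi * real n) = antider f x + real n * integral {0..2 * pi} f" for x n
  proof (induction n)
    case (Suc n)
    have "x + 2 * pi * real (Suc n) = (x + 2 * pi * real n) + 2 * pi" by (simp add: algebra_simps)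
    then show ?case using step[of "x + 2 * pi * real n"] Suc by (simp add: algebra_simps)
  qed simp
  show ?thesis
  proof (cases "k \<ge> 0")
    case True
    then show ?thesis using nat[of x "nat k"] by simp
  next
    case False
    then show ?thesis using nat[of "x + 2 * pi * of_int k" "nat (- k)"] by (simp add: algebra_simps)
  qed
qed

lemma card_sin_zeros:
  assumes "k \<ge> (1::nat)"
  shows "card {x \<in> {c..<c + 2 * pi * real k}. sin x = 0} = 2 * k"
proof -
  \<comment> \<open>The zeros are the multiples of \<open>pi\<close>. The half-open interval has
    length \<open>2 * k\<close> in units of \<open>pi\<close>, an integer, so its end is compatible
    with the ceiling and no off-by-one depends on \<open>c\<close>.\<close>
  have "{x \<in> {c..<c + 2 * pi * real k}. sin x = 0} = (\<lambda>i. of_int i * pi) ` {\<lceil>c / pi\<rceil>..<\<lceil>c / pi\<rceil> + 2 * int k}"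
  proof (intro equalityI subsetI)
    fix x assume x: "x \<in> {x \<in> {c..<c + 2 * pi * real k}. sin x = 0}"
    then obtain i :: int where i: "x = of_int i * pi" by (auto simp: sin_zero_iff_int2)
    have "c / pi \<le> of_int i" "of_int i < c / pi + 2 * real k"
      using x i pi_gt_zero by (auto simp: field_simps)
    then have "\<lceil>c / pi\<rceil> \<le> i" "i < \<lceil>c / pi\<rceil> + 2 * int k" by (auto simp: ceiling_le_iff) (linarith)
    then show "x \<in> (\<lambda>i. of_int i * pi) ` {\<lceil>c / pi\<rceil>..<\<lceil>c / pi\<rceil> + 2 * int k}" using i by auto
  next
    fix x assume "x \<in> (\<lambda>i. of_int i * pi) ` {\<lceil>c / pi\<rceil>..<\<lceil>c / pi\<rceil> + 2 * int k}"
    then obtain i :: int where i: "x = of_int i * pi" "\<lceil>c / pi\<rceil> \<le> i" "i < \<lceil>c / pi\<rceil> + 2 * int k" by auto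
    then have "c / pi \<le> of_int i" "of_int i < c / pi + 2 * real k" by (simp add: ceiling_le_iff, linarith)
    then have "c \<le> x" "x < c + 2 * pi * real k" using i(1) pi_gt_zero by (auto simp: field_simps)
    then show "x \<in> {x \<in> {c..<c + 2 * pi * real k}. sin x = 0}" using i(1) by (auto simp: sin_zero_iff_int2)
  qed
  moreover have "inj_on (\<lambda>i::int. of_int i * pi) A" for A by (auto simp: inj_on_def)
  ultimately show ?thesis by (simp add: card_image)
qed

context profile
begin

text \<open>Elapsed time and advance of the longitude relative to the twisted meridian, as functions
  of the phase, both starting with 0 at phase 0.\<close>

definition tq where "tq h = antider (q h)"
definition eta where "eta h = antider (\<lambda>x. h * q h x / (r (pi/2 + amp h * sin x))^2)"

context
  fixes h assumes h: "h \<in> {0<..<R}"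
begin

lemma d_tq: "(tq h has_real_derivative q h x) (at x)"
  unfolding tq_def by (rule antider(1)[OF cont_q[OF h]])

lemma d_eta: "(eta h has_real_derivative h * q h x / (r (pi/2 + amp h * sin x))^2) (at x)"
  unfolding eta_def by (rule antider(1)[OF weight_continuous[OF h]])

lemma tq_period: "tq h (x + 2 * pi * of_int k) = tq h x + of_int k * T h"
  unfolding tq_def T_def
proof (rule antider_period[OF cont_q[OF h]])
  show "q h (x + 2 * pi) = q h x" for x by (simp add: q_def)
qed

lemma eta_period: "eta h (x + 2 * pi * of_int k) = eta h x + of_int k * Theta h"
  unfolding eta_def Theta_def
proof (rule antider_period[OF weight_continuous[OF h]])
  show "h * q h (x + 2 * pi) / (r (pi/2 + amp h * sin (x + 2 * pi)))^2 = h * q h x / (r (pi/2 + amp h * sin x))^2" for x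
    by (simp add: q_def)
qed

lemma tq_less: "x < y \<Longrightarrow> tq h x < tq h y"
  by (rule DERIV_pos_imp_increasing) (use d_tq q_pos[OF h] in blast)+

lemma tq_less_iff: "tq h x < tq h y \<longleftrightarrow> x < y"
  using tq_less[of x y] tq_less[of y x] by (cases x y rule: linorder_cases) auto

lemma tq_inj: "tq h x = tq h y \<longleftrightarrow> x = y"
  using tq_less[of x y] tq_less[of y x] by (cases x y rule: linorder_cases) auto

lemma tq_surj: "\<exists>x. tq h x = t"
proof -
  have Tp: "T h > 0" using T_pos[OF h] .
  obtain n :: nat where n: "\<bar>t - tq h 0\<bar> / T h < n" using reals_Archimedean2 by blast
  then have b: "\<bar>t - tq h 0\<bar> \<le> n * T h" using Tp by (simp add: divide_less_eq)
  have "tq h (2 * pi * n) = tq h 0 + n * T h" "tq h (- (2 * pi * n)) = tq h 0 - n * T h"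
    using tq_period[of 0 "int n"] tq_period[of 0 "- int n"] by simp_all
  then have "tq h (- (2 * pi * n)) \<le> t" "t \<le> tq h (2 * pi * n)" using b by linarith+
  moreover have "continuous_on {- (2 * pi * n)..2 * pi * n} (tq h)"
    using d_tq by (meson DERIV_continuous_on has_field_derivative_at_within)
  ultimately show ?thesis using IVT'[of "tq h" "- (2 * pi * n)" t "2 * pi * n"] by auto
qed

end
end

section \<open>Curves with prescribed energy and momentum\<close>

context rotation_metric
begin

text \<open>The reflection gives the symmetries, uniqueness of the equator the sign of
  \<open>deriv rr\<close> on the southern hemisphere, and isotropy at the pole the normalization
  \<open>deriv rr 0 = ss 0\<close>.\<close>

sublocale p: profile rr "deriv rr" "deriv (deriv rr)" ss "deriv ss"
proof
  show "(rr has_real_derivative deriv rr x) (at x)" for x by (rule C2_deriv(1)[OF C2_rr])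
  show "(deriv rr has_real_derivative deriv (deriv rr) x) (at x)" for x by (rule C1_deriv(1)[OF C2_deriv(2)[OF C2_rr]])
  show "continuous_on UNIV (deriv (deriv rr))" by (rule C1_deriv(2)[OF C2_deriv(2)[OF C2_rr]])
  show "(ss has_real_derivative deriv ss x) (at x)" for x by (rule C1_deriv(1)[OF C1_ss])
  show "continuous_on UNIV (deriv ss)" by (rule C1_deriv(2)[OF C1_ss])
  show "rr 0 = 0" by (simp add: rr_def)
qed (use ss_pos rr_pos rr_sym ss_sym deriv_rr_pos deriv_rr_0 in auto)

text \<open>Meridian geodesics are the curves \<open>\<phi> \<mapsto> rot (beta \<phi> + const) (mer \<phi>)\<close>; they need not be planar.\<close>

definition beta where "beta = (SOME F. \<forall>x\<in>{0<..<pi}. (F has_real_derivative - bf x / (sin x * cf x)) (at x))"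

text \<open>The slope that makes \<open>mer' + beta' * rot_field\<close> orthogonal to the rotation
  field, as the pairing of \<open>mer'\<close> with that field is \<open>bf * sin\<close> and the
  squared length of the field is \<open>sin^2 * cf\<close>. It may be singular at the poles, hence
  the open interval.\<close>

lemma d_beta: "x \<in> {0<..<pi} \<Longrightarrow> (beta has_real_derivative - bf x / (sin x * cf x)) (at x)"
proof -
  have "sin x * cf x \<noteq> 0" if "x \<in> {0<..<pi}" for x using sin_gt_zero[of x] cf_pos[of x] that by auto
  then have "continuous_on {0<..<pi} (\<lambda>x. - bf x / (sin x * cf x))"
    using C1_continuous[OF C1_bf] C1_continuous[OF C2_imp_C1[OF C2_cf]]
    by (intro continuous_intros) (auto intro: continuous_on_subset)
  then have "\<exists>F. \<forall>x\<in>{0<..<pi}. (F has_real_derivative - bf x / (sin x * cf x)) (at x)"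
    by (rule continuous_antiderivative_interval[of _ _ _ "pi/2"]) simp
  from someI_ex[OF this] show "x \<in> {0<..<pi} \<Longrightarrow> ?thesis" unfolding beta_def by blast
qed

end

text \<open>The geodesic with speed \<open>e\<close> and momentum \<open>sg * h * e\<close>, solved by its first integrals; \<open>\<alpha>\<close> is the phase.\<close>

locale oscillation = rotation_metric +
  fixes h e sg \<theta>0 :: real and \<alpha> :: "real \<Rightarrow> real" and \<gamma> :: "real \<Rightarrow> real^3"
  assumes h: "h \<in> {0<..<p.R}" and e: "e > 0" and sg: "\<bar>sg\<bar> = 1"
    and d_\<alpha>: "\<And>t. (\<alpha> has_real_derivative e / p.q h (\<alpha> t)) (at t)"
    and \<gamma>: "\<And>t. \<gamma> t = rot (sg * p.eta h (\<alpha> t) + beta (pi/2 + p.amp h * sin (\<alpha> t)) + \<theta>0) (mer (pi/2 + p.amp h * sin (\<alpha> t)))"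
begin

definition lat where "lat t = pi/2 + p.amp h * sin (\<alpha> t)"
definition lon where "lon t = sg * p.eta h (\<alpha> t) + beta (lat t) + \<theta>0"

lemma \<gamma>_coords: "\<gamma> t = rot (lon t) (mer (lat t))"
  unfolding \<gamma> lat_def lon_def ..

lemma lat_bounds: "lat t \<in> {0<..<pi}"
  using p.arg_bounds'[OF h, of "\<alpha> t"] p.iota_h[OF h] by (auto simp: lat_def)

text \<open>The differential equation of the phase in integrated form. As \<open>tq h\<close> is
  injective, statements on the phase reduce to statements on time.\<close>

lemma tq_\<alpha>: "p.tq h (\<alpha> t) = p.tq h (\<alpha> 0) + e * t"
proof -
  have "((\<lambda>t. p.tq h (\<alpha> t) - e * t) has_real_derivative p.q h (\<alpha> t) * (e / p.q h (\<alpha> t)) - e * 1) (at t)" for t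
    by (intro DERIV_diff DERIV_chain2[where f = "p.tq h", OF p.d_tq[OF h] d_\<alpha>] DERIV_cmult DERIV_ident)
  moreover have "p.q h (\<alpha> t) * (e / p.q h (\<alpha> t)) - e * 1 = 0" for t using p.q_pos[OF h, of "\<alpha> t"] by simp
  ultimately have "((\<lambda>t. p.tq h (\<alpha> t) - e * t) has_real_derivative 0) (at t)" for t by metis
  from constant_if_deriv_zero[OF this, of t 0] show ?thesis by simp
qed

lemma \<alpha>_shift: "\<alpha> (t + of_int k * p.T h / e) = \<alpha> t + 2 * pi * of_int k"
proof -
  have "p.tq h (\<alpha> (t + of_int k * p.T h / e)) = p.tq h (\<alpha> t + 2 * pi * of_int k)"
    unfolding p.tq_period[OF h] tq_\<alpha>[of "t + of_int k * p.T h / e"] tq_\<alpha>[of t] using e by (simp add: field_simps)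
  then show ?thesis by (simp add: p.tq_inj[OF h])
qed

lemma \<alpha>_less_iff: "\<alpha> t < \<alpha> u \<longleftrightarrow> t < u"
  using p.tq_less_iff[OF h, of "\<alpha> t" "\<alpha> u"] e by (simp add: tq_\<alpha>[of t] tq_\<alpha>[of u])

lemma \<alpha>_surj: "\<exists>t. \<alpha> t = x"
proof -
  define t where "t = (p.tq h x - p.tq h (\<alpha> 0)) / e"
  have "p.tq h (\<alpha> t) = p.tq h x" using tq_\<alpha>[of t] e by (simp add: t_def)
  then show ?thesis using p.tq_inj[OF h] by blast
qed

lemma lat_shift: "lat (t + of_int k * p.T h / e) = lat t"
proof -
  have "sin (\<alpha> t + 2 * pi * of_int k) = sin (\<alpha> t)"
    by (simp add: sin_add)
  then show ?thesis unfolding lat_def \<alpha>_shift by simp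
qed

lemma lon_shift: "lon (t + of_int k * p.T h / e) = lon t + sg * of_int k * p.Theta h"
  unfolding lon_def lat_shift unfolding \<alpha>_shift p.eta_period[OF h] by (simp add: algebra_simps)

lemma mer_lat_nz: "mer (lat t) $ 1 \<noteq> 0 \<or> mer (lat t) $ 2 \<noteq> 0"
  using lat_bounds[of t] sin_gt_zero[of "lat t"] by auto

lemma period_if: "of_int k * p.Theta h = 2 * pi * of_int m \<Longrightarrow> \<gamma> (t + of_int k * p.T h / e) = \<gamma> t"
proof -
  assume k: "of_int k * p.Theta h = 2 * pi * of_int m"
  have "sg = 1 \<or> sg = -1" using sg by (auto simp: abs_if split: if_splits)
  then have "\<exists>j::int. sg * (2 * pi * of_int m) = 2 * pi * of_int j"
    by (auto intro: exI[of _ m] exI[of _ "- m"])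
  then obtain j :: int where "sg * (of_int k * p.Theta h) = 2 * pi * of_int j" unfolding k by blast
  then have "lon (t + of_int k * p.T h / e) - lon t = 2 * pi * of_int j" unfolding lon_shift by (simp add: mult.assoc)
  then show ?thesis unfolding \<gamma>_coords lat_shift rot_eq_iff_2pi[OF mer_lat_nz] by blast
qed

text \<open>The height recovers the latitude, hence the sine of the phase. Once its cosine is
  recovered too, the phase has advanced by full turns, and what is left of the period condition
  concerns the longitude.\<close>

lemma period_only_if:
  assumes per: "\<And>t. \<gamma> (t + \<tau>) = \<gamma> t" and \<tau>: "\<tau> > 0"
  obtains k :: nat and m :: int where "k \<ge> 1" "\<tau> = real k * p.T h / e" "real k * p.Theta h = 2 * pi * of_int m"
proof -
  have lat: "lat (t + \<tau>) = lat t" for t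
  proof -
    have "\<gamma> (t + \<tau>) $ 3 = \<gamma> t $ 3" by (simp add: per)
    then have "cos (lat (t + \<tau>)) = cos (lat t)" by (simp add: \<gamma>_coords)
    then show ?thesis using lat_bounds[of t] lat_bounds[of "t + \<tau>"] cos_inj_pi[of "lat (t + \<tau>)" "lat t"] by auto
  qed
  have s: "sin (\<alpha> (t + \<tau>)) = sin (\<alpha> t)" for t
    using lat[of t] p.amp_pos[OF h] by (simp add: lat_def)
  \<comment> \<open>The derivative of the periodic function \<open>sin (\<alpha> t)\<close> is
    periodic; \<open>q h\<close> depends on the sine of the phase only, so its factor
    cancels.\<close>
  have c: "cos (\<alpha> (0 + \<tau>)) = cos (\<alpha> 0)"
  proof -
    have d1: "((\<lambda>t. sin (\<alpha> t)) has_real_derivative cos (\<alpha> 0) * (e / p.q h (\<alpha> 0))) (at 0)"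
      by (rule DERIV_chain2[OF DERIV_sin d_\<alpha>])
    have "((\<lambda>t. \<alpha> (t + \<tau>)) has_real_derivative e / p.q h (\<alpha> (0 + \<tau>)) * 1) (at 0)"
      by (rule DERIV_chain2[where f = \<alpha>, OF d_\<alpha>]) (auto intro!: derivative_eq_intros)
    from DERIV_chain2[OF DERIV_sin this]
    have "((\<lambda>t. sin (\<alpha> t)) has_real_derivative cos (\<alpha> (0 + \<tau>)) * (e / p.q h (\<alpha> (0 + \<tau>)) * 1)) (at 0)"
      unfolding s .
    from DERIV_unique[OF d1 this]
    have "cos (\<alpha> 0) * (e / p.q h (\<alpha> 0)) = cos (\<alpha> (0 + \<tau>)) * (e / p.q h (\<alpha> (0 + \<tau>)))" by simp
    moreover have "p.q h (\<alpha> (0 + \<tau>)) = p.q h (\<alpha> 0)" unfolding p.q_def s ..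
    ultimately show ?thesis using e p.q_pos[OF h, of "\<alpha> 0"] by simp
  qed
  have "sin (\<alpha> \<tau>) = sin (\<alpha> 0) \<and> cos (\<alpha> \<tau>) = cos (\<alpha> 0)" using s[of 0] c by simp
  then obtain j :: int where j: "\<alpha> \<tau> = \<alpha> 0 + 2 * pi * of_int j"
    using sin_cos_eq_iff[of "\<alpha> \<tau>" "\<alpha> 0"] by (auto simp: algebra_simps)
  have "p.tq h (\<alpha> \<tau>) = p.tq h (\<alpha> 0) + of_int j * p.T h" unfolding j by (rule p.tq_period[OF h])
  then have jT: "e * \<tau> = of_int j * p.T h" using tq_\<alpha>[of \<tau>] by simp
  then have "0 < of_int j * p.T h" using e \<tau> by (metis mult_pos_pos)
  then have jp: "j > 0" using p.T_pos[OF h] by (simp add: zero_less_mult_iff)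
  have \<tau>eq: "\<tau> = of_int j * p.T h / e" using jT e by (simp add: field_simps)
  have "rot (lon (0 + \<tau>)) (mer (lat 0)) = rot (lon 0) (mer (lat 0))"
    using per[of 0] lat[of 0] by (simp add: \<gamma>_coords)
  then obtain i :: int where i: "lon (0 + \<tau>) - lon 0 = 2 * pi * of_int i"
    unfolding rot_eq_iff_2pi[OF mer_lat_nz] by blast
  then have "sg * (of_int j * p.Theta h) = 2 * pi * of_int i"
    unfolding \<tau>eq lon_shift by simp
  moreover have "sg = 1 \<or> sg = -1" using sg by (auto simp: abs_if split: if_splits)
  ultimately have "of_int j * p.Theta h = 2 * pi * of_int (if sg = 1 then i else - i)" by auto
  then show ?thesis using that[of "nat j" "if sg = 1 then i else - i"] jp \<tau>eq by (simp add: nat_le_iff)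
qed

text \<open>The equator is met exactly at the zeros of \<open>sin (\<alpha> t)\<close>, and the
  phase maps one period bijectively onto a half-open interval of \<open>k\<close> full
  turns.\<close>

lemma crossings:
  assumes k: "k \<ge> 1" and \<tau>: "\<tau> = real k * p.T h / e"
  shows "card {t \<in> {0..<\<tau>}. \<gamma> t \<in> equator g} = 2 * k"
proof -
  have eq: "\<gamma> t \<in> equator g \<longleftrightarrow> sin (\<alpha> t) = 0" for t
  proof -
    have "norm (\<gamma> t) = 1" unfolding \<gamma>_coords rot_norm using mer_S2 by simp
    then have "\<gamma> t \<in> equator g \<longleftrightarrow> cos (lat t) = 0" unfolding equator_eq by (simp add: \<gamma>_coords)
    also have "\<dots> \<longleftrightarrow> lat t = pi/2"
    proof
      assume "cos (lat t) = 0"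
      then show "lat t = pi/2" using lat_bounds[of t] cos_inj_pi[of "lat t" "pi/2"] by auto
    next
      assume "lat t = pi/2"
      then show "cos (lat t) = 0" by (simp only: cos_pi_half)
    qed
    also have "\<dots> \<longleftrightarrow> sin (\<alpha> t) = 0" using p.amp_pos[OF h] by (simp add: lat_def)
    finally show ?thesis .
  qed
  have \<alpha>\<tau>: "\<alpha> \<tau> = \<alpha> 0 + 2 * pi * real k" using \<alpha>_shift[of 0 "int k"] by (simp add: \<tau>)
  have "bij_betw \<alpha> {t \<in> {0..<\<tau>}. \<gamma> t \<in> equator g} {x \<in> {\<alpha> 0..<\<alpha> 0 + 2 * pi * real k}. sin x = 0}"
    unfolding bij_betw_def
  proof
    show "inj_on \<alpha> {t \<in> {0..<\<tau>}. \<gamma> t \<in> equator g}"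
      using \<alpha>_less_iff by (intro inj_onI) (metis linorder_neq_iff)
    show "\<alpha> ` {t \<in> {0..<\<tau>}. \<gamma> t \<in> equator g} = {x \<in> {\<alpha> 0..<\<alpha> 0 + 2 * pi * real k}. sin x = 0}"
    proof (intro equalityI subsetI)
      fix x assume "x \<in> \<alpha> ` {t \<in> {0..<\<tau>}. \<gamma> t \<in> equator g}"
      then obtain t where t: "x = \<alpha> t" "0 \<le> t" "t < \<tau>" "sin (\<alpha> t) = 0" by (auto simp: eq)
      then show "x \<in> {x \<in> {\<alpha> 0..<\<alpha> 0 + 2 * pi * real k}. sin x = 0}"
        using \<alpha>_less_iff[of t \<tau>] \<alpha>_less_iff[of t 0] \<alpha>\<tau> by auto
    next
      fix x assume x: "x \<in> {x \<in> {\<alpha> 0..<\<alpha> 0 + 2 * pi * real k}. sin x = 0}"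
      obtain t where t: "x = \<alpha> t" using \<alpha>_surj[of x] by blast
      then have "0 \<le> t" "t < \<tau>" using x \<alpha>_less_iff[of t \<tau>] \<alpha>_less_iff[of t 0] \<alpha>\<tau> by auto
      then show "x \<in> \<alpha> ` {t \<in> {0..<\<tau>}. \<gamma> t \<in> equator g}" using x t by (auto simp: eq)
    qed
  qed
  then show ?thesis using card_sin_zeros[OF k] by (simp add: bij_betw_same_card)
qed

end

lemma polar_velocity:
  assumes "(\<phi> has_real_derivative \<phi>') (at t)" "(\<theta> has_real_derivative \<theta>') (at t)"
  shows "((\<lambda>t. rot (\<theta> t) (mer (\<phi> t))) has_vector_derivative
    \<phi>' *\<^sub>R rot (\<theta> t) (mer' (\<phi> t)) + \<theta>' *\<^sub>R rot (\<theta> t) (rot_field (mer (\<phi> t)))) (at t)"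
  using assms by (intro has_vector_derivative_vec3) (auto intro!: derivative_eq_intros simp: algebra_simps)

lemma winding_number_polar:
  assumes \<gamma>: "\<And>t. \<gamma> t = rot (\<theta> t) (mer (\<phi> t))" and \<phi>: "\<And>t. \<phi> t \<in> {0<..<pi}"
    and d\<phi>: "\<And>t. (\<phi> has_real_derivative \<phi>' t) (at t)" and d\<theta>: "\<And>t. (\<theta> has_real_derivative \<theta>' t) (at t)"
    and c\<phi>: "continuous_on UNIV \<phi>'" and c\<theta>: "continuous_on UNIV \<theta>'"
    and per: "\<phi> \<tau> = \<phi> 0"
  shows "norm (winding_number (shadow \<gamma> \<tau>) 0) = \<bar>\<theta> \<tau> - \<theta> 0\<bar> / (2 * pi)"
proof -
  have s: "sin (\<phi> t) > 0" for t using \<phi>[of t] by (intro sin_gt_zero) auto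
  \<comment> \<open>A global logarithm of the shadow, available because the curve avoids the axis.
    The contour integral is its increment, whose real part vanishes because the latitude
    returns.\<close>
  define L where "L = (\<lambda>x. complex_of_real (ln (sin (\<phi> (x * \<tau>)))) + \<i> * complex_of_real (\<theta> (x * \<tau>)))"
  define L' where "L' = (\<lambda>x. complex_of_real (1 / sin (\<phi> (x * \<tau>)) * (cos (\<phi> (x * \<tau>)) * (\<phi>' (x * \<tau>) * \<tau>))) + \<i> * complex_of_real (\<theta>' (x * \<tau>) * \<tau>))"
  have dx: "((\<lambda>x. x * \<tau>) has_real_derivative \<tau>) (at x)" for x by (auto intro!: derivative_eq_intros)
  have dL: "(L has_vector_derivative L' x) (at x)" for x
  proof -
    have 1: "((\<lambda>x. ln (sin (\<phi> (x * \<tau>)))) has_real_derivative 1 / sin (\<phi> (x * \<tau>)) * (cos (\<phi> (x * \<tau>)) * (\<phi>' (x * \<tau>) * \<tau>))) (at x)"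
      by (rule DERIV_chain2[where f = ln, OF DERIV_ln_divide[OF s] DERIV_chain2[where f = sin, OF DERIV_sin DERIV_chain2[where f = \<phi>, OF d\<phi> dx]]])
    have 2: "((\<lambda>x. \<theta> (x * \<tau>)) has_real_derivative \<theta>' (x * \<tau>) * \<tau>) (at x)"
      by (rule DERIV_chain2[where f = \<theta>, OF d\<theta> dx])
    show ?thesis unfolding L_def L'_def
      by (intro has_vector_derivative_add has_vector_derivative_mult_right has_vector_derivative_of_real 1 2)
  qed
  have cL': "continuous_on UNIV L'"
  proof -
    have c: "continuous_on UNIV \<phi>" using d\<phi> by (meson DERIV_continuous_on has_field_derivative_at_within)
    have "sin (\<phi> (x * \<tau>)) \<noteq> 0" for x using s[of "x * \<tau>"] by simp
    then show ?thesis unfolding L'_def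
      by (intro continuous_intros continuous_on_compose2[OF c] continuous_on_compose2[OF c\<phi>] continuous_on_compose2[OF c\<theta>]) auto
  qed
  have sh: "shadow \<gamma> \<tau> x = exp (L x)" for x
    unfolding shadow_def L_def \<gamma> using s[of "x * \<tau>"]
    by (simp add: exp_add exp_of_real complex_eq_iff Re_exp Im_exp)
  have dsh: "(shadow \<gamma> \<tau> has_vector_derivative L' x * exp (L x)) (at x)" for x
  proof -
    have "(exp \<circ> L has_vector_derivative L' x * exp (L x)) (at x)"
      by (rule field_vector_diff_chain_at[OF dL DERIV_exp])
    then show ?thesis by (simp add: sh[abs_def] o_def)
  qed
  have cL: "continuous_on UNIV L"
    using dL by (meson continuous_at_imp_continuous_on has_vector_derivative_continuous)
  have "shadow \<gamma> \<tau> C1_differentiable_on {0..1}"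
    unfolding C1_differentiable_on_def
    by (intro exI[of _ "\<lambda>x. L' x * exp (L x)"] conjI ballI dsh continuous_on_subset[of UNIV _ "{0..1}"] continuous_intros cL cL') simp
  then have vp: "valid_path (shadow \<gamma> \<tau>)"
    unfolding valid_path_def by (rule C1_differentiable_imp_piecewise)
  have nz: "0 \<notin> path_image (shadow \<gamma> \<tau>)" unfolding path_image_def sh by auto
  have "(L' has_integral L 1 - L 0) {0..1}"
    using dL by (intro fundamental_theorem_of_calculus) (auto intro: has_vector_derivative_at_within)
  then have "((\<lambda>w. 1 / (w - 0)) has_contour_integral (L 1 - L 0)) (shadow \<gamma> \<tau>)"
    unfolding has_contour_integral_def
  proof (rule has_integral_eq[rotated])
    fix x :: real assume x: "x \<in> {0..1}"
    have "vector_derivative (shadow \<gamma> \<tau>) (at x within {0..1}) = L' x * exp (L x)"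
      using vector_derivative_at_within_ivl[OF dsh, of 0 x 1] x by auto
    then show "L' x = 1 / (shadow \<gamma> \<tau> x - 0) * vector_derivative (shadow \<gamma> \<tau>) (at x within {0..1})"
      by (simp add: sh)
  qed
  then have "winding_number (shadow \<gamma> \<tau>) 0 = 1 / (2 * pi * \<i>) * (L 1 - L 0)"
    using winding_number_valid_path[OF vp nz] contour_integral_unique by simp
  also have "L 1 - L 0 = \<i> * complex_of_real (\<theta> \<tau> - \<theta> 0)"
    by (simp add: L_def per algebra_simps)
  also have "1 / (2 * pi * \<i>) * (\<i> * complex_of_real (\<theta> \<tau> - \<theta> 0)) = complex_of_real ((\<theta> \<tau> - \<theta> 0) / (2 * pi))"
    by (simp add: field_simps)
  also have "norm \<dots> = \<bar>\<theta> \<tau> - \<theta> 0\<bar> / (2 * pi)" unfolding norm_of_real by simp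
  finally show ?thesis .
qed

context sphere_metric
begin

text \<open>The momentum is linear in the longitude speed \<open>l\<close> and can be solved for it.
  Completing the square in the energy then leaves \<open>kap \<phi>\<close> as the coefficient of
  \<open>k^2\<close>.\<close>

lemma coordinate_energy_momentum:
  fixes \<phi> \<theta> k l :: real
  assumes \<phi>: "\<phi> \<in> {0<..<pi}"
  defines "x \<equiv> rot \<theta> (mer \<phi>)" and "u \<equiv> k *\<^sub>R rot \<theta> (mer' \<phi>) + l *\<^sub>R rot \<theta> (rot_field (mer \<phi>))"
  shows "l = G x u (rot_field x) / (rr \<phi>)^2 - bf \<phi> / (sin \<phi> * cf \<phi>) * k"
    and "kap \<phi> * k^2 + (G x u (rot_field x))^2 / (rr \<phi>)^2 = G x u u"
proof -
  have s: "sin \<phi> > 0" using \<phi> by (intro sin_gt_zero) auto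
  have c: "cf \<phi> > 0" by (rule cf_pos)
  have u: "u = rot \<theta> (k *\<^sub>R mer' \<phi> + (l * sin \<phi>) *\<^sub>R axis 2 1)"
    by (simp add: u_def rot_add rot_scale rot_field_mer)
  have x: "rot_field x = rot \<theta> (sin \<phi> *\<^sub>R axis 2 1)" by (simp add: x_def rot_rot_field rot_field_mer)
  have P: "G x u (rot_field x) = bf \<phi> * sin \<phi> * k + (sin \<phi>)^2 * cf \<phi> * l"
    unfolding x unfolding u unfolding x_def G_rot[OF mer_nz]
    by (simp add: G_linear mer_nz bf_def cf_def power2_eq_square algebra_simps)
  have E: "G x u u = Af \<phi> * k^2 + 2 * bf \<phi> * sin \<phi> * k * l + (sin \<phi>)^2 * cf \<phi> * l^2"
    unfolding u unfolding x_def G_rot[OF mer_nz] using G_sym[OF mer_nz, of \<phi> "axis 2 1" "mer' \<phi>"]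
    by (simp add: G_linear mer_nz Af_def bf_def cf_def power2_eq_square algebra_simps)
  have r2: "(rr \<phi>)^2 = (sin \<phi>)^2 * cf \<phi>" using c by (simp add: rr_def power_mult_distrib)
  show "l = G x u (rot_field x) / (rr \<phi>)^2 - bf \<phi> / (sin \<phi> * cf \<phi>) * k"
    unfolding P r2 using s c by (simp add: field_simps power2_eq_square)
  have "(G x u (rot_field x))^2 / (rr \<phi>)^2 = (bf \<phi>)^2 / cf \<phi> * k^2 + 2 * bf \<phi> * sin \<phi> * k * l + (sin \<phi>)^2 * cf \<phi> * l^2"
    unfolding P r2 using s c by (simp add: field_simps power2_eq_square)
  then show "kap \<phi> * k^2 + (G x u (rot_field x))^2 / (rr \<phi>)^2 = G x u u"
    unfolding E kap_def by (simp add: algebra_simps)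
qed

end

context oscillation
begin

definition latd where "latd t = p.amp h * (cos (\<alpha> t) * (e / p.q h (\<alpha> t)))"
definition lond where "lond t = sg * (h / (rr (lat t))^2 * e) + - bf (lat t) / (sin (lat t) * cf (lat t)) * latd t"

lemma d_lat: "(lat has_real_derivative latd t) (at t)"
proof -
  have "((\<lambda>t. pi/2 + p.amp h * sin (\<alpha> t)) has_real_derivative 0 + p.amp h * (cos (\<alpha> t) * (e / p.q h (\<alpha> t)))) (at t)"
    by (intro DERIV_add DERIV_const DERIV_cmult DERIV_chain2[where f = sin, OF DERIV_sin d_\<alpha>])
  then show ?thesis by (simp add: lat_def[abs_def] latd_def)
qed

lemma d_lon: "(lon has_real_derivative lond t) (at t)"
proof -
  have "((\<lambda>t. sg * p.eta h (\<alpha> t) + beta (lat t) + \<theta>0) has_real_derivative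
      sg * (h * p.q h (\<alpha> t) / (rr (pi/2 + p.amp h * sin (\<alpha> t)))^2 * (e / p.q h (\<alpha> t))) +
      - bf (lat t) / (sin (lat t) * cf (lat t)) * latd t + 0) (at t)"
    by (intro DERIV_add DERIV_const DERIV_cmult DERIV_chain2[where f = beta, OF d_beta[OF lat_bounds] d_lat]
        DERIV_chain2[where f = "p.eta h", OF p.d_eta[OF h] d_\<alpha>])
  moreover have "h * p.q h (\<alpha> t) / (rr (pi/2 + p.amp h * sin (\<alpha> t)))^2 * (e / p.q h (\<alpha> t)) = h / (rr (lat t))^2 * e"
    using p.q_pos[OF h, of "\<alpha> t"] by (simp add: lat_def)
  ultimately show ?thesis by (simp add: lon_def[abs_def] lond_def)
qed

lemma cont_\<alpha>: "continuous_on UNIV \<alpha>"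
  using d_\<alpha> by (meson DERIV_continuous_on has_field_derivative_at_within)

lemma cont_lat: "continuous_on UNIV lat"
  using d_lat by (meson DERIV_continuous_on has_field_derivative_at_within)

lemma cont_latd: "continuous_on UNIV latd"
proof -
  have "p.q h (\<alpha> t) \<noteq> 0" for t using p.q_pos[OF h, of "\<alpha> t"] by simp
  then show ?thesis unfolding latd_def[abs_def]
    by (intro continuous_intros cont_\<alpha> continuous_on_compose2[OF p.cont_q[OF h, of UNIV] cont_\<alpha>]) auto
qed

lemma rr_lat_pos: "rr (lat t) > 0" by (rule rr_pos[OF lat_bounds])

lemma sin_lat_pos: "sin (lat t) > 0" using lat_bounds[of t] by (intro sin_gt_zero) auto

lemma cont_lond: "continuous_on UNIV lond"
proof -
  have nz: "rr (lat t) \<noteq> 0" "sin (lat t) * cf (lat t) \<noteq> 0" for t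
    using rr_lat_pos[of t] sin_lat_pos[of t] cf_pos[of "lat t"] by simp_all
  show ?thesis unfolding lond_def[abs_def]
    by (intro continuous_intros cont_lat cont_latd continuous_on_compose2[OF p.cont_r[of UNIV] cont_lat]
        continuous_on_compose2[OF C1_continuous[OF C1_bf] cont_lat]
        continuous_on_compose2[OF C1_continuous[OF C2_imp_C1[OF C2_cf]] cont_lat]) (use nz in auto)
qed

lemma winding:
  assumes \<tau>: "\<tau> = real k * p.T h / e"
  shows "norm (winding_number (shadow \<gamma> \<tau>) 0) = real k * p.Theta h / (2 * pi)"
proof -
  have "lat \<tau> = lat 0" using lat_shift[of 0 "int k"] by (simp add: \<tau>)
  from winding_number_polar[OF \<gamma>_coords lat_bounds d_lat d_lon cont_latd cont_lond this]
  have "norm (winding_number (shadow \<gamma> \<tau>) 0) = \<bar>lon \<tau> - lon 0\<bar> / (2 * pi)" .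
  moreover have "lon \<tau> - lon 0 = sg * (real k * p.Theta h)" using lon_shift[of 0 "int k"] by (simp add: \<tau>)
  ultimately show ?thesis using sg p.Theta_pos[OF h] by (simp add: abs_mult)
qed

end

text \<open>L'Hopital's rule carries a formula for the derivative across an isolated point. It is
  used at turning times, once for the phase and once for the geodesic equation.\<close>

lemma derivative_at_limit:
  fixes f :: "real \<Rightarrow> real"
  assumes "isCont f x" "\<forall>\<^sub>F t in at x. (f has_real_derivative k t) (at t)" "(k \<longlongrightarrow> d) (at x)"
  shows "(f has_real_derivative d) (at x)"
proof -
  have "((\<lambda>t. (f t - f x) / (t - x)) \<longlongrightarrow> d) (at x)"
  proof (rule lhopital)
    show "((\<lambda>t. f t - f x) \<longlongrightarrow> 0) (at x)" using assms(1) unfolding isCont_def by (simp add: LIM_zero)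
    show "((\<lambda>t. t - x) \<longlongrightarrow> 0) (at x)" by (simp add: LIM_zero)
    show "\<forall>\<^sub>F t in at x. t - x \<noteq> 0" by (simp add: eventually_at_filter)
    show "\<forall>\<^sub>F t in at x. (1::real) \<noteq> 0" by simp
    show "\<forall>\<^sub>F t in at x. ((\<lambda>t. f t - f x) has_real_derivative k t) (at t)"
      using assms(2) by eventually_elim (auto intro!: derivative_eq_intros)
    show "\<forall>\<^sub>F t in at x. ((\<lambda>t. t - x) has_real_derivative 1) (at t)"
      by (intro always_eventually allI) (auto intro!: derivative_eq_intros)
    show "((\<lambda>t. k t / 1) \<longlongrightarrow> d) (at x)" using assms(3) by simp
  qed
  then show ?thesis by (simp add: has_field_derivative_iff)
qed

text \<open>The chain rule read backwards for a function known only to be continuous; Caratheodory's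
  form of the derivative of \<open>F\<close> supplies the divisor.\<close>

lemma derivative_of_lift:
  fixes f F :: "real \<Rightarrow> real"
  assumes "isCont f x" "((\<lambda>t. F (f t)) has_real_derivative d) (at x)" "(F has_real_derivative k) (at (f x))" "k \<noteq> 0"
  shows "(f has_real_derivative d / k) (at x)"
proof -
  obtain H where H: "\<And>z. F z - F (f x) = H z * (z - f x)" "isCont H (f x)" "H (f x) = k"
    using assms(3) unfolding CARAT_DERIV by blast
  have lim: "((\<lambda>t. H (f t)) \<longlongrightarrow> k) (at x)"
    using isCont_o2[OF assms(1) H(2)] H(3) unfolding isCont_def by simp
  have "((\<lambda>t. (F (f t) - F (f x)) / (t - x) / H (f t)) \<longlongrightarrow> d / k) (at x)"
    using assms(2,4) lim by (intro tendsto_divide) (auto simp: has_field_derivative_iff)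
  moreover have "\<forall>\<^sub>F t in at x. (F (f t) - F (f x)) / (t - x) / H (f t) = (f t - f x) / (t - x)"
    using tendsto_imp_eventually_ne[OF lim assms(4)] by eventually_elim (simp add: H(1))
  ultimately have "((\<lambda>t. (f t - f x) / (t - x)) \<longlongrightarrow> d / k) (at x)"
    by (rule Lim_transform_eventually)
  then show ?thesis by (simp add: has_field_derivative_iff)
qed

text \<open>The line is contractible, so a continuous curve in the punctured plane has a continuous
  logarithm; on the unit circle its imaginary part is the angle.\<close>

lemma angle_lift:
  fixes c s :: "real \<Rightarrow> real"
  assumes "continuous_on UNIV c" "continuous_on UNIV s" "\<And>t. (c t)^2 + (s t)^2 = 1"
  obtains \<alpha> where "continuous_on UNIV \<alpha>" "\<And>t. cos (\<alpha> t) = c t" "\<And>t. sin (\<alpha> t) = s t"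
proof -
  have nz: "Complex (c t) (s t) \<noteq> 0" for t using assms(3)[of t] by (auto simp: complex_eq_iff)
  have cont: "continuous_on UNIV (\<lambda>t. Complex (c t) (s t))"
    unfolding Complex_eq by (intro continuous_intros assms)
  have contr: "contractible (UNIV :: real set)" by (rule convex_imp_contractible) simp
  obtain g where g1: "continuous_on UNIV g" and g2: "\<And>t. t \<in> UNIV \<Longrightarrow> Complex (c t) (s t) = exp (g t)"
    using continuous_logarithm_on_contractible[OF cont contr nz] by metis
  note g = g1 g2[OF UNIV_I]
  have "exp (Re (g t)) = 1" for t
  proof -
    have "exp (Re (g t)) = norm (Complex (c t) (s t))" unfolding g(2) by (simp add: norm_exp_eq_Re)
    also have "\<dots> = 1" using assms(3)[of t] by (simp add: complex_norm)
    finally show ?thesis .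
  qed
  then have "cos (Im (g t)) = c t" "sin (Im (g t)) = s t" for t
    using arg_cong[OF g(2)[of t], of Re] arg_cong[OF g(2)[of t], of Im] by (simp_all add: Re_exp Im_exp)
  moreover have "continuous_on UNIV (\<lambda>t. Im (g t))" by (intro continuous_intros g(1))
  ultimately show ?thesis using that by blast
qed

context sphere_curve
begin

lemma vel_nth: "((\<lambda>t. \<gamma> t $ i) has_real_derivative v t $ i) (at t)"
  by (rule has_real_derivative_vec_nth[OF vel])

lemma cont_v_nth: "continuous_on UNIV (\<lambda>t. v t $ i)"
  using has_real_derivative_vec_nth[OF acc] by (meson DERIV_continuous_on has_field_derivative_at_within)

lemma cont_\<gamma>_nth: "continuous_on UNIV (\<lambda>t. \<gamma> t $ i)"
  using vel_nth by (meson DERIV_continuous_on has_field_derivative_at_within)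

text \<open>The latitude is an arccosine of the height. The longitude is obtained by integrating the
  angular velocity, which yields a differentiable choice of angle at once.\<close>

lemma polar_coordinates:
  assumes np: "\<And>t. \<gamma> t \<noteq> south" "\<And>t. \<gamma> t \<noteq> north"
  obtains \<phi> \<theta> \<phi>' \<theta>' where "\<And>t. \<phi> t \<in> {0<..<pi}" "\<And>t. \<gamma> t = rot (\<theta> t) (mer (\<phi> t))"
    "\<And>t. (\<phi> has_real_derivative \<phi>' t) (at t)" "\<And>t. (\<theta> has_real_derivative \<theta>' t) (at t)"
    "continuous_on UNIV \<phi>'"
proof -
  define x y z where "x = (\<lambda>t. \<gamma> t $ 1)" and "y = (\<lambda>t. \<gamma> t $ 2)" and "z = (\<lambda>t. \<gamma> t $ 3)"
  define x' y' z' where "x' = (\<lambda>t. v t $ 1)" and "y' = (\<lambda>t. v t $ 2)" and "z' = (\<lambda>t. v t $ 3)"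
  have d: "(x has_real_derivative x' t) (at t)" "(y has_real_derivative y' t) (at t)" "(z has_real_derivative z' t) (at t)" for t
    unfolding x_def y_def z_def x'_def y'_def z'_def by (rule vel_nth)+
  have c: "continuous_on UNIV x" "continuous_on UNIV y" "continuous_on UNIV z"
      "continuous_on UNIV x'" "continuous_on UNIV y'" "continuous_on UNIV z'"
    unfolding x_def y_def z_def x'_def y'_def z'_def by (rule cont_\<gamma>_nth cont_v_nth)+
  have sph: "(x t)^2 + (y t)^2 + (z t)^2 = 1" for t using on_S2[of t] unfolding S2_nth x_def y_def z_def .
  define n where "n = (\<lambda>t. (x t)^2 + (y t)^2)"
  have n_pos: "n t > 0" for t
  proof (rule ccontr)
    assume "\<not> n t > 0"
    then have "n t = 0" unfolding n_def using sum_power2_ge_zero[of "x t" "y t"] by linarith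
    then have 0: "x t = 0" "y t = 0" unfolding n_def by (simp_all add: sum_power2_eq_zero_iff)
    then have "z t = 1 \<or> z t = -1" using sph[of t] by (simp add: power2_eq_1_iff)
    then show False using 0 np[of t] by (auto simp: x_def y_def z_def vec3_eq)
  qed
  define \<rho> where "\<rho> = (\<lambda>t. sqrt (n t))"
  have \<rho>: "\<rho> t > 0" "(\<rho> t)^2 = n t" for t using n_pos[of t] by (simp_all add: \<rho>_def)
  have zb: "-1 < - z t" "- z t < 1" for t
  proof -
    have "(z t)^2 < 1^2" using sph[of t] n_pos[of t] unfolding n_def by simp
    then have "\<bar>z t\<bar> < 1" using power2_less_imp_less[of "\<bar>z t\<bar>" 1] by simp
    then show "-1 < - z t" "- z t < 1" by auto
  qed
  have \<rho>z: "\<rho> t = sqrt (1 - (- z t)^2)" for t using sph[of t] unfolding \<rho>_def n_def by (simp add: algebra_simps)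
  define \<phi> where "\<phi> = (\<lambda>t. arccos (- z t))"
  have \<phi>b: "\<phi> t \<in> {0<..<pi}" for t
    unfolding \<phi>_def using arccos_lt_bounded[OF zb[of t]] by simp
  have cos\<phi>: "cos (\<phi> t) = - z t" and sin\<phi>: "sin (\<phi> t) = \<rho> t" for t
    unfolding \<phi>_def \<rho>z using zb[of t] by (simp_all add: cos_arccos sin_arccos)
  have d\<phi>: "(\<phi> has_real_derivative inverse (- \<rho> t) * - z' t) (at t)" for t
    unfolding \<phi>_def \<rho>z using zb[of t]
    by (intro DERIV_chain2[where f = arccos, OF DERIV_arccos] DERIV_minus d) auto
  have c\<phi>: "continuous_on UNIV (\<lambda>t. inverse (- \<rho> t) * - z' t)"
  proof -
    have "- sqrt ((x t)^2 + (y t)^2) \<noteq> 0" for t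
      using \<rho>(1)[of t, unfolded \<rho>_def n_def] by (metis less_irrefl neg_equal_0_iff_equal)
    then show ?thesis unfolding \<rho>_def n_def by (intro continuous_intros c) auto
  qed
  \<comment> \<open>The angular velocity of the projection to the plane of the parallels.\<close>
  define \<omega> where "\<omega> = (\<lambda>t. (x t * y' t - y t * x' t) / n t)"
  have c\<omega>: "continuous_on UNIV \<omega>"
  proof -
    have "(x t)^2 + (y t)^2 \<noteq> 0" for t using n_pos[of t, unfolded n_def] by (metis less_irrefl)
    then show ?thesis unfolding \<omega>_def n_def by (intro continuous_intros c) auto
  qed
  define P where "P = (\<lambda>t. x t / \<rho> t)"
  define Q where "Q = (\<lambda>t. y t / \<rho> t)"
  have d\<rho>: "(\<rho> has_real_derivative (x t * x' t + y t * y' t) / \<rho> t) (at t)" for t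
  proof -
    have "(n has_real_derivative 2 * (x t * x' t + y t * y' t)) (at t)"
      unfolding n_def by (auto intro!: derivative_eq_intros d)
    from DERIV_chain2[where f = sqrt, OF DERIV_real_sqrt[OF n_pos] this]
    moreover have "inverse A / 2 * (2 * B) = B / A" for A B :: real by (simp add: inverse_eq_divide)
    ultimately show ?thesis unfolding \<rho>_def by (simp only:)
  qed
  have nn: "\<rho> t * \<rho> t = x t * x t + y t * y t" for t using \<rho>(2)[of t] by (simp add: n_def power2_eq_square)
  have dP: "(P has_real_derivative - (\<omega> t * Q t)) (at t)" for t
  proof -
    have "(P has_real_derivative (x' t * \<rho> t - x t * ((x t * x' t + y t * y' t) / \<rho> t)) / (\<rho> t * \<rho> t)) (at t)"
      unfolding P_def using \<rho>(1)[of t] by (intro DERIV_divide d d\<rho>) auto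
    moreover have "(x' t * \<rho> t - x t * ((x t * x' t + y t * y' t) / \<rho> t)) / (\<rho> t * \<rho> t) = - (\<omega> t * Q t)"
    proof -
      have "(x' t * \<rho> t - x t * ((x t * x' t + y t * y' t) / \<rho> t)) = (x' t * (\<rho> t * \<rho> t) - x t * (x t * x' t + y t * y' t)) / \<rho> t"
        using \<rho>(1)[of t] by (simp add: field_simps)
      also have "x' t * (\<rho> t * \<rho> t) - x t * (x t * x' t + y t * y' t) = - ((x t * y' t - y t * x' t) * y t)"
        unfolding nn by (simp add: algebra_simps)
      finally show ?thesis unfolding \<omega>_def Q_def \<rho>(2)[symmetric] using \<rho>(1)[of t] by (simp add: power2_eq_square)
    qed
    ultimately show ?thesis by simp
  qed
  have dQ: "(Q has_real_derivative \<omega> t * P t) (at t)" for t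
  proof -
    have "(Q has_real_derivative (y' t * \<rho> t - y t * ((x t * x' t + y t * y' t) / \<rho> t)) / (\<rho> t * \<rho> t)) (at t)"
      unfolding Q_def using \<rho>(1)[of t] by (intro DERIV_divide d d\<rho>) auto
    moreover have "(y' t * \<rho> t - y t * ((x t * x' t + y t * y' t) / \<rho> t)) / (\<rho> t * \<rho> t) = \<omega> t * P t"
    proof -
      have "(y' t * \<rho> t - y t * ((x t * x' t + y t * y' t) / \<rho> t)) = (y' t * (\<rho> t * \<rho> t) - y t * (x t * x' t + y t * y' t)) / \<rho> t"
        using \<rho>(1)[of t] by (simp add: field_simps)
      also have "y' t * (\<rho> t * \<rho> t) - y t * (x t * x' t + y t * y' t) = (x t * y' t - y t * x' t) * x t"
        unfolding nn by (simp add: algebra_simps)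
      finally show ?thesis unfolding \<omega>_def P_def \<rho>(2)[symmetric] using \<rho>(1)[of t] by (simp add: power2_eq_square)
    qed
    ultimately show ?thesis by simp
  qed
  have PQ: "(P t)^2 + (Q t)^2 = 1" for t
  proof -
    have "(P t)^2 + (Q t)^2 = n t / n t"
      unfolding P_def Q_def power_divide \<rho>(2) add_divide_distrib[symmetric] by (simp only: n_def)
    then show ?thesis using n_pos[of t] by simp
  qed
  obtain \<theta>0 where \<theta>0: "P 0 = cos \<theta>0" "Q 0 = sin \<theta>0"
    using sincos_total_2pi[OF PQ[of 0]] by metis
  define \<theta> where "\<theta> = (\<lambda>t. \<theta>0 + antider \<omega> t)"
  have d\<theta>: "(\<theta> has_real_derivative \<omega> t) (at t)" for t
    unfolding \<theta>_def using DERIV_add[OF DERIV_const antider(1)[OF c\<omega>]] by simp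
  have \<theta>_0: "\<theta> 0 = \<theta>0" unfolding \<theta>_def using antider(2)[OF c\<omega>] by simp
  have ds: "((\<lambda>t. sin (\<theta> t)) has_real_derivative cos (\<theta> t) * \<omega> t) (at t)"
    and dc: "((\<lambda>t. cos (\<theta> t)) has_real_derivative - sin (\<theta> t) * \<omega> t) (at t)" for t
    by (rule DERIV_chain2[where f = sin, OF DERIV_sin d\<theta>], rule DERIV_chain2[where f = cos, OF DERIV_cos d\<theta>])
  \<comment> \<open>The two functions differentiated here and below are the components of the unit
    vector \<open>(P, Q)\<close> turned back by \<open>\<theta>\<close>. They are constant, so the
    vector stays at angle \<open>\<theta>\<close>.\<close>
  have "((\<lambda>t. P t * cos (\<theta> t) + Q t * sin (\<theta> t)) has_real_derivative
    (- (\<omega> t * Q t) * cos (\<theta> t) + - sin (\<theta> t) * \<omega> t * P t) + (\<omega> t * P t * sin (\<theta> t) + cos (\<theta> t) * \<omega> t * Q t)) (at t)" for t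
    by (intro DERIV_add DERIV_mult dP dQ ds dc)
  then have "((\<lambda>t. P t * cos (\<theta> t) + Q t * sin (\<theta> t)) has_real_derivative 0) (at t)" for t
    by (simp add: algebra_simps)
  from constant_if_deriv_zero[OF this, of _ 0]
  have 1: "P t * cos (\<theta> t) + Q t * sin (\<theta> t) = 1" for t using PQ[of 0] unfolding \<theta>_0 \<theta>0 by (simp add: power2_eq_square)
  have "((\<lambda>t. Q t * cos (\<theta> t) - P t * sin (\<theta> t)) has_real_derivative
    (\<omega> t * P t * cos (\<theta> t) + - sin (\<theta> t) * \<omega> t * Q t) - (- (\<omega> t * Q t) * sin (\<theta> t) + cos (\<theta> t) * \<omega> t * P t)) (at t)" for t
    by (intro DERIV_diff DERIV_mult dP dQ ds dc)
  then have "((\<lambda>t. Q t * cos (\<theta> t) - P t * sin (\<theta> t)) has_real_derivative 0) (at t)" for t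
    by (simp add: algebra_simps)
  from constant_if_deriv_zero[OF this, of _ 0]
  have 2: "Q t * cos (\<theta> t) - P t * sin (\<theta> t) = 0" for t unfolding \<theta>_0 \<theta>0 by simp
  have Pt: "P t = cos (\<theta> t)" and Qt: "Q t = sin (\<theta> t)" for t
  proof -
    have "P t = P t * ((cos (\<theta> t))^2 + (sin (\<theta> t))^2)" by simp
    also have "\<dots> = (P t * cos (\<theta> t) + Q t * sin (\<theta> t)) * cos (\<theta> t) - (Q t * cos (\<theta> t) - P t * sin (\<theta> t)) * sin (\<theta> t)"
      by (simp only: power2_eq_square) (simp only: algebra_simps)
    finally show "P t = cos (\<theta> t)" unfolding 1 2 by simp
    have "Q t = Q t * ((cos (\<theta> t))^2 + (sin (\<theta> t))^2)" by simp
    also have "\<dots> = (P t * cos (\<theta> t) + Q t * sin (\<theta> t)) * sin (\<theta> t) + (Q t * cos (\<theta> t) - P t * sin (\<theta> t)) * cos (\<theta> t)"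
      by (simp only: power2_eq_square) (simp only: algebra_simps)
    finally show "Q t = sin (\<theta> t)" unfolding 1 2 by simp
  qed
  have "\<gamma> t = rot (\<theta> t) (mer (\<phi> t))" for t
  proof -
    have "x t = \<rho> t * P t" "y t = \<rho> t * Q t" using \<rho>(1)[of t] by (simp_all add: P_def Q_def)
    then show ?thesis unfolding Pt Qt by (simp add: vec3_eq sin\<phi> cos\<phi> x_def y_def z_def)
  qed
  from that[OF \<phi>b this d\<phi> d\<theta> c\<phi>] show ?thesis .
qed

end

lemma (in sphere_metric) axis3_form_rot:
  assumes "x \<noteq> 0"
  shows "G (rot \<theta> x) (k *\<^sub>R rot_field (rot \<theta> x)) (axis 3 1) = k * G x (rot_field x) (axis 3 1)"
proof -
  have n: "rot \<theta> x \<noteq> 0" using assms rot_norm[of \<theta> x] by auto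
  have "rot \<theta> (axis 3 1) = axis 3 1" by (simp add: vec3_eq)
  then have "G (rot \<theta> x) (rot \<theta> (rot_field x)) (axis 3 1) = G x (rot_field x) (axis 3 1)"
    using G_rot[OF assms, of \<theta> "rot_field x" "axis 3 1"] by simp
  then show ?thesis by (simp add: G_linear n rot_rot_field)
qed

lemma (in sphere_curve) tangent_level:
  assumes np: "\<gamma> t \<noteq> south" "\<gamma> t \<noteq> north" and v3: "v t $ 3 = 0"
  obtains k where "v t = k *\<^sub>R rot_field (\<gamma> t)"
proof -
  define x y where "x = \<gamma> t $ 1" and "y = \<gamma> t $ 2"
  define n where "n = x^2 + y^2"
  have sph: "x^2 + y^2 + (\<gamma> t $ 3)^2 = 1" using on_S2[of t] unfolding S2_nth x_def y_def .
  have n: "n \<noteq> 0"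
  proof
    assume "n = 0"
    then have 0: "x = 0" "y = 0" unfolding n_def by (simp_all add: sum_power2_eq_zero_iff)
    then have "\<gamma> t $ 3 = 1 \<or> \<gamma> t $ 3 = -1" using sph by (simp add: power2_eq_1_iff)
    then show False using 0 np by (auto simp: x_def y_def vec3_eq)
  qed
  have t: "v t $ 1 * x + v t $ 2 * y = 0" using vel_tangent[of t] v3 by (simp add: tangent_iff inner3 x_def y_def)
  define k where "k = (v t $ 2 * x - v t $ 1 * y) / n"
  have "v t $ 1 * n = - ((v t $ 2 * x - v t $ 1 * y) * y)"
  proof -
    have "v t $ 1 * n + (v t $ 2 * x - v t $ 1 * y) * y = x * (v t $ 1 * x + v t $ 2 * y)"
      by (simp add: n_def power2_eq_square algebra_simps)
    then show ?thesis unfolding t by simp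
  qed
  moreover have "v t $ 2 * n = (v t $ 2 * x - v t $ 1 * y) * x"
  proof -
    have "v t $ 2 * n - (v t $ 2 * x - v t $ 1 * y) * x = y * (v t $ 1 * x + v t $ 2 * y)"
      by (simp add: n_def power2_eq_square algebra_simps)
    then show ?thesis unfolding t by simp
  qed
  ultimately have "v t $ 1 = - (k * y)" "v t $ 2 = k * x" using n by (simp_all add: k_def field_simps)
  then show ?thesis using that[of k] v3 by (simp add: vec3_eq x_def y_def)
qed

text \<open>At a highest or lowest point the velocity has no vertical component. Off the poles it
  would then be a multiple of the rotation field, and vanishing momentum would force vanishing
  energy. So both extremes are poles, and different ones, since otherwise the curve would be
  constant.\<close>

lemma (in sphere_metric) zero_momentum_meridian:
  assumes cg: "closed_geodesic g \<gamma> \<tau>" and E: "\<And>t. G (\<gamma> t) (velocity \<gamma> t) (velocity \<gamma> t) \<noteq> 0"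
    and P: "\<And>t. G (\<gamma> t) (velocity \<gamma> t) (rot_field (\<gamma> t)) = 0"
  shows "is_meridian g \<gamma> \<tau>"
proof -
  have geo: "geodesic g \<gamma>" and \<tau>: "\<tau> > 0" and per: "\<And>t. \<gamma> (t + \<tau>) = \<gamma> t" using cg unfolding closed_geodesic_def by auto
  interpret sphere_curve g \<gamma> "velocity \<gamma>" "velocity (velocity \<gamma>)"
    by (rule geodesic_sphere_curve[OF sphere_metric_axioms geo])
  have pole: "\<gamma> t = south \<or> \<gamma> t = north" if v3: "velocity \<gamma> t $ 3 = 0" for t
  proof (rule ccontr)
    assume "\<not> (\<gamma> t = south \<or> \<gamma> t = north)"
    then obtain k where k: "velocity \<gamma> t = k *\<^sub>R rot_field (\<gamma> t)" using tangent_level[of t] v3 by metis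
    have "G (\<gamma> t) (velocity \<gamma> t) (velocity \<gamma> t) = k * G (\<gamma> t) (velocity \<gamma> t) (rot_field (\<gamma> t))"
      by (subst (2) k) (simp add: G_linear nz)
    then show False using E P by simp
  qed
  have v0: "velocity \<gamma> t \<noteq> 0" for t using E[of t] by (auto simp: G_linear nz)
  have cont: "continuous_on {0..\<tau>} (\<lambda>t. \<gamma> t $ 3)" using cont_\<gamma>_nth by (rule continuous_on_subset) simp
  have ne: "compact {0..\<tau>}" "{0..\<tau>} \<noteq> {}" using \<tau> by auto
  \<comment> \<open>The extremes may lie at the ends of \<open>{0..\<tau>}\<close>; periodicity
    makes them extremes on full neighbourhoods of radius \<open>\<tau>\<close>.\<close>
  have ext: "\<exists>u\<in>{0..\<tau>}. \<gamma> u = \<gamma> t" if "- \<tau> \<le> t" "t \<le> 2 * \<tau>" for t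
  proof -
    consider "t < 0" | "0 \<le> t" "t \<le> \<tau>" | "\<tau> < t" by linarith
    then show ?thesis
    proof cases
      case 1 then show ?thesis using per[of t] that by (intro bexI[of _ "t + \<tau>"]) auto
    next
      case 2 then show ?thesis by auto
    next
      case 3 then show ?thesis using per[of "t - \<tau>"] that by (intro bexI[of _ "t - \<tau>"]) auto
    qed
  qed
  obtain a where a: "a \<in> {0..\<tau>}" "\<And>t. t \<in> {0..\<tau>} \<Longrightarrow> \<gamma> t $ 3 \<le> \<gamma> a $ 3"
    using continuous_attains_sup[OF ne cont] by blast
  obtain b where b: "b \<in> {0..\<tau>}" "\<And>t. t \<in> {0..\<tau>} \<Longrightarrow> \<gamma> b $ 3 \<le> \<gamma> t $ 3"
    using continuous_attains_inf[OF ne cont] by blast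
  have near: "- \<tau> \<le> t \<and> t \<le> 2 * \<tau>" if "\<bar>c - t\<bar> < \<tau>" "c \<in> {0..\<tau>}" for c t using that by auto
  have "velocity \<gamma> a $ 3 = 0"
  proof (rule DERIV_local_max[OF vel_nth[of 3 a] \<tau>], intro allI impI)
    fix t assume "\<bar>a - t\<bar> < \<tau>"
    then obtain u where "u \<in> {0..\<tau>}" "\<gamma> u = \<gamma> t" using ext near[OF _ a(1)] by blast
    then show "\<gamma> t $ 3 \<le> \<gamma> a $ 3" using a(2)[of u] by simp
  qed
  then have pa: "\<gamma> a = south \<or> \<gamma> a = north" by (rule pole)
  have "velocity \<gamma> b $ 3 = 0"
  proof (rule DERIV_local_min[OF vel_nth[of 3 b] \<tau>], intro allI impI)
    fix t assume "\<bar>b - t\<bar> < \<tau>"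
    then obtain u where "u \<in> {0..\<tau>}" "\<gamma> u = \<gamma> t" using ext near[OF _ b(1)] by blast
    then show "\<gamma> b $ 3 \<le> \<gamma> t $ 3" using b(2)[of u] by simp
  qed
  then have pb: "\<gamma> b = south \<or> \<gamma> b = north" by (rule pole)
  have "\<gamma> a \<noteq> \<gamma> b"
  proof
    assume e: "\<gamma> a = \<gamma> b"
    have const: "\<gamma> t $ 3 = \<gamma> a $ 3" if "t \<in> {0..\<tau>}" for t using a(2)[OF that] b(2)[OF that] e by simp
    have "\<gamma> t = \<gamma> a" if "t \<in> {0..\<tau>}" for t
    proof -
      have "(\<gamma> t $ 3)^2 = 1" using const[OF that] pa by auto
      then have "(\<gamma> t $ 1)^2 + (\<gamma> t $ 2)^2 = 0" using on_S2[of t] unfolding S2_nth by simp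
      then show ?thesis using const[OF that] pa by (auto simp: vec3_eq sum_power2_eq_zero_iff)
    qed
    moreover have "\<tau>/2 \<in> {0<..<\<tau>}" using \<tau> by simp
    ultimately have "(\<gamma> has_vector_derivative 0) (at (\<tau>/2))"
      by (intro has_vector_derivative_transform_within_open[OF has_vector_derivative_const[of "\<gamma> a"] open_greaterThanLessThan[of 0 \<tau>]]) auto
    then have "velocity \<gamma> (\<tau>/2) = 0" by (rule vector_derivative_at)
    with v0 show False by blast
  qed
  then have "south \<in> range \<gamma> \<and> north \<in> range \<gamma>" using pa pb by (metis rangeI)
  then show ?thesis using cg unfolding is_meridian_def by blast
qed

section \<open>From closed geodesics to oscillations\<close>

context rotation_metric
begin

lemma rr_eq_R: "\<phi> \<in> {0<..<pi} \<Longrightarrow> rr \<phi> \<ge> p.R \<Longrightarrow> \<phi> = pi/2"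
proof (rule ccontr)
  assume \<phi>: "\<phi> \<in> {0<..<pi}" "rr \<phi> \<ge> p.R" "\<phi> \<noteq> pi/2"
  show False
  proof (cases "\<phi> < pi/2")
    case True
    then show ?thesis using p.r_less[of \<phi> "pi/2"] \<phi> by (simp add: p.R_def)
  next
    case False
    then show ?thesis using p.r_less[of "pi - \<phi>" "pi/2"] \<phi> by (simp add: p.R_def rr_sym)
  qed
qed

lemma rr_ge_imp_lat:
  assumes h: "h \<in> {0<..<p.R}" and \<phi>: "\<phi> \<in> {0<..<pi}" and ge: "rr \<phi> \<ge> h"
  shows "\<bar>\<phi> - pi/2\<bar> \<le> p.amp h"
proof (cases "\<phi> \<le> pi/2")
  case True
  then have "p.iota h \<le> \<phi>" using p.r_le_iff[of "p.iota h" \<phi>] p.iota_h[OF h] \<phi> ge by auto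
  then show ?thesis using True by (simp add: p.amp_def)
next
  case False
  then have "p.iota h \<le> pi - \<phi>" using p.r_le_iff[of "p.iota h" "pi - \<phi>"] p.iota_h[OF h] \<phi> ge by (auto simp: rr_sym)
  then show ?thesis using False by (simp add: p.amp_def)
qed

text \<open>The phase is not obtained from a differential equation but read off: sine and cosine of
  the phase are explicit functions of the latitude and its velocity, and energy conservation places
  them on the unit circle.\<close>

lemma geodesic_oscillation:
  assumes cg: "closed_geodesic g \<gamma> \<tau>" and nm: "\<not> is_meridian g \<gamma> \<tau>"
    and ne: "\<exists>t. \<gamma> t \<notin> equator g"
  obtains h e sg \<theta>0 \<alpha> where "oscillation g h e sg \<theta>0 \<alpha> \<gamma>" "\<And>t. g (\<gamma> t) (velocity \<gamma> t) (velocity \<gamma> t) = e^2"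
proof -
  have geo: "geodesic g \<gamma>" and \<tau>: "\<tau> > 0"
    and minimal: "\<And>s. 0 < s \<Longrightarrow> s < \<tau> \<Longrightarrow> \<exists>t. \<gamma> (t + s) \<noteq> \<gamma> t"
    using cg unfolding closed_geodesic_def by auto
  interpret sphere_curve g \<gamma> "velocity \<gamma>" "velocity (velocity \<gamma>)"
    by (rule geodesic_sphere_curve[OF sphere_metric_axioms geo])
  let ?v = "\<lambda>t. velocity \<gamma> t"
  have xi0: "xi t e = 0" for t e using geo geodesic_iff by blast
  define E where "E = G (\<gamma> 0) (?v 0) (?v 0)"
  define P where "P = G (\<gamma> 0) (?v 0) (rot_field (\<gamma> 0))"
  have E: "G (\<gamma> t) (?v t) (?v t) = E" for t
  proof -
    have "((\<lambda>s. G (\<gamma> s) (?v s) (?v s)) has_real_derivative 0) (at t)" for t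
      using energy_deriv[of t] by (simp add: xi0)
    from constant_if_deriv_zero[OF this, of t 0] show ?thesis by (simp only: E_def)
  qed
  have P: "G (\<gamma> t) (?v t) (rot_field (\<gamma> t)) = P" for t
  proof -
    have "((\<lambda>s. G (\<gamma> s) (?v s) (rot_field (\<gamma> s))) has_real_derivative 0) (at t)" for t
      using momentum_deriv[of t] by (simp add: xi0)
    from constant_if_deriv_zero[OF this, of t 0] show ?thesis by (simp only: P_def)
  qed
  \<comment> \<open>With zero energy the curve is constant, and then half of \<open>\<tau>\<close>
    would already be a period.\<close>
  have Epos: "E > 0"
  proof (rule ccontr)
    assume "\<not> E > 0"
    then have "?v t = 0" for t using G_pos[OF on_S2 vel_tangent, of t] E[of t] by auto
    then have "(\<gamma> has_vector_derivative 0) (at t)" for t using vel[of t] by simp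
    then have "\<gamma> t = \<gamma> 0" for t
      using has_vector_derivative_zero_constant[of UNIV \<gamma>] by (metis UNIV_I convex_UNIV)
    then have "\<gamma> (t + \<tau>/2) = \<gamma> t" for t by metis
    then show False using minimal[of "\<tau>/2"] \<tau> by auto
  qed
  have P0: "P \<noteq> 0"
    using zero_momentum_meridian[OF cg] E P Epos nm by auto
  have np: "\<gamma> t \<noteq> south" "\<gamma> t \<noteq> north" for t
  proof -
    have "rot_field south = 0" "rot_field north = 0" by (simp_all add: vec3_eq)
    then show "\<gamma> t \<noteq> south" "\<gamma> t \<noteq> north" using P[of t] P0 G_zero2[OF nz, of t] by auto
  qed
  obtain \<phi> \<theta> \<phi>' \<theta>' where \<phi>: "\<And>t. \<phi> t \<in> {0<..<pi}" and \<gamma>: "\<And>t. \<gamma> t = rot (\<theta> t) (mer (\<phi> t))"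
    and d\<phi>: "\<And>t. (\<phi> has_real_derivative \<phi>' t) (at t)" and d\<theta>: "\<And>t. (\<theta> has_real_derivative \<theta>' t) (at t)"
    and c\<phi>': "continuous_on UNIV \<phi>'"
    using polar_coordinates[OF np] by blast
  have v: "?v t = \<phi>' t *\<^sub>R rot (\<theta> t) (mer' (\<phi> t)) + \<theta>' t *\<^sub>R rot (\<theta> t) (rot_field (mer (\<phi> t)))" for t
  proof -
    have "\<gamma> = (\<lambda>t. rot (\<theta> t) (mer (\<phi> t)))" using \<gamma> by (rule ext)
    then show ?thesis using vector_derivative_at[OF polar_velocity[OF d\<phi> d\<theta>]] by simp
  qed
  have \<theta>': "\<theta>' t = P / (rr (\<phi> t))^2 - bf (\<phi> t) / (sin (\<phi> t) * cf (\<phi> t)) * \<phi>' t" for t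
    using coordinate_energy_momentum(1)[OF \<phi>[of t], of "\<theta>' t" "\<theta> t" "\<phi>' t"] P[of t] unfolding v unfolding \<gamma> by simp
  have EE: "kap (\<phi> t) * (\<phi>' t)^2 + P^2 / (rr (\<phi> t))^2 = E" for t
    using coordinate_energy_momentum(2)[OF \<phi>[of t], of "\<phi>' t" "\<theta> t" "\<theta>' t"] P[of t] E[of t] unfolding v unfolding \<gamma> by simp
  have rp: "rr (\<phi> t) > 0" for t by (rule rr_pos[OF \<phi>])
  define e where "e = sqrt E"
  have e: "e > 0" "e^2 = E" using Epos by (simp_all add: e_def)
  define h where "h = \<bar>P\<bar> / e"
  define sg where "sg = sgn P"
  have sg: "\<bar>sg\<bar> = 1" "sg * h * e = P" using P0 e(1) by (simp_all add: sg_def h_def sgn_if)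
  have hP: "h^2 * E = P^2" using e Epos by (simp add: h_def power_divide)
  have h0: "h > 0" using P0 e by (simp add: h_def)
  have hr: "h \<le> rr (\<phi> t)" for t
  proof (rule power2_le_imp_le)
    have "0 \<le> kap (\<phi> t) * (\<phi>' t)^2" using kap_pos[of "\<phi> t"] by simp
    then have "P^2 / (rr (\<phi> t))^2 \<le> E" using EE[of t] by linarith
    then have "h^2 * E \<le> E * (rr (\<phi> t))^2" using rp[of t] by (simp add: hP divide_le_eq)
    then show "h^2 \<le> (rr (\<phi> t))^2" using Epos by simp
    show "0 \<le> rr (\<phi> t)" using rp[of t] by simp
  qed
  \<comment> \<open>As \<open>h\<close> bounds the radius from below along the curve,
    \<open>h\<close> at least \<open>p.R\<close> would confine the curve to the equator.\<close>
  have hR: "h < p.R"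
  proof (rule ccontr)
    assume "\<not> h < p.R"
    then have "p.R \<le> rr (\<phi> t)" for t using hr[of t] by simp
    then have eq: "\<phi> t = pi/2" for t by (rule rr_eq_R[OF \<phi>])
    have "\<gamma> t $ 3 = 0" for t unfolding \<gamma> eq[of t] by simp
    then have "\<gamma> t \<in> equator g" for t unfolding equator_eq using on_S2[of t] by simp
    then show False using ne by blast
  qed
  have h: "h \<in> {0<..<p.R}" using h0 hR by simp
  define a where "a = p.amp h"
  have a: "a > 0" unfolding a_def by (rule p.amp_pos[OF h])
  \<comment> \<open>The future sine of the phase. Since \<open>q h\<close> depends on the sine only,
    \<open>qu\<close> below is already \<open>q h\<close> at the phase, although it is evaluated at
    the arcsine.\<close>
  define u where "u = (\<lambda>t. (\<phi> t - pi/2) / a)"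
  have ub: "-1 \<le> u t" "u t \<le> 1" for t
    using rr_ge_imp_lat[OF h \<phi> hr, of t] a unfolding a_def[symmetric] by (auto simp: u_def field_simps abs_le_iff)
  have \<phi>u: "\<phi> t = pi/2 + a * u t" for t using a by (simp add: u_def)
  have c\<phi>: "continuous_on UNIV \<phi>" using d\<phi> by (meson DERIV_continuous_on has_field_derivative_at_within)
  have cu: "continuous_on UNIV u" unfolding u_def using a by (intro continuous_intros c\<phi>) simp
  have sasu: "sin (arcsin (u t)) = u t" for t using ub[of t] by simp
  define qu where "qu = (\<lambda>t. p.q h (arcsin (u t)))"
  have qu: "qu t > 0" for t unfolding qu_def by (rule p.q_pos[OF h])
  have cqu: "continuous_on UNIV qu" unfolding qu_def
    by (intro continuous_on_compose2[OF p.cont_q[OF h, of UNIV]] continuous_on_arcsin cu) (use ub in auto)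
  have \<phi>N: "(\<phi>' t)^2 = E * p.N h (\<phi> t)" for t
  proof -
    have "kap (\<phi> t) = (ss (\<phi> t))^2" using kap_pos[of "\<phi> t"] by (simp add: ss_def)
    moreover have "kap (\<phi> t) * (\<phi>' t)^2 = E * (1 - h^2 / (rr (\<phi> t))^2)"
      using EE[of t] hP by (simp add: algebra_simps)
    ultimately show ?thesis using kap_pos[of "\<phi> t"] by (simp add: p.N_def field_simps)
  qed
  \<comment> \<open>The future cosine: \<open>\<phi> = pi/2 + a * sin \<alpha>\<close> and
    \<open>\<alpha>' = e / q\<close> would give
    \<open>\<phi>' = a * cos \<alpha> * e / q\<close>.\<close>
  define cc where "cc = (\<lambda>t. \<phi>' t * qu t / (a * e))"
  have ccc: "continuous_on UNIV cc" unfolding cc_def using a e by (intro continuous_intros c\<phi>' cqu) simp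
  have circ: "(cc t)^2 + (u t)^2 = 1" for t
  proof -
    have "(a * cos (arcsin (u t)))^2 = (qu t)^2 * p.N h (\<phi> t)"
      using p.q_eq[OF h, of "arcsin (u t)"] unfolding qu_def a_def \<phi>u sasu .
    then have 1: "a^2 * (1 - (u t)^2) = (qu t)^2 * p.N h (\<phi> t)"
      by (simp add: power_mult_distrib cos_squared_eq sasu)
    have "(cc t)^2 = (\<phi>' t)^2 * (qu t)^2 / (a^2 * E)" unfolding cc_def e(2)[symmetric] by (simp add: power_mult_distrib power_divide)
    also have "\<dots> = (E * (a^2 * (1 - (u t)^2))) / (a^2 * E)" unfolding \<phi>N 1 by (simp add: ac_simps)
    also have "\<dots> = 1 - (u t)^2" using a Epos by simp
    finally show ?thesis by simp
  qed
  obtain \<alpha> where \<alpha>: "continuous_on UNIV \<alpha>" "\<And>t. cos (\<alpha> t) = cc t" "\<And>t. sin (\<alpha> t) = u t"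
    using angle_lift[OF ccc cu circ] by blast
  have q\<alpha>: "p.q h (\<alpha> t) = qu t" for t unfolding qu_def p.q_def \<alpha>(3) sasu ..
  have \<phi>'c: "\<phi>' t * qu t = cos (\<alpha> t) * (a * e)" for t
    using a e unfolding \<alpha>(2) cc_def by simp
  have c\<alpha>: "isCont \<alpha> t" for t using \<alpha>(1) by (simp add: continuous_on_eq_continuous_at)
  have du: "((\<lambda>t. sin (\<alpha> t)) has_real_derivative \<phi>' t / a) (at t)" for t
    unfolding \<alpha>(3) u_def using DERIV_cdivide[OF DERIV_diff[OF d\<phi> DERIV_const]] by simp
  have reg: "(\<alpha> has_real_derivative e / p.q h (\<alpha> t)) (at t)" if c0: "cos (\<alpha> t) \<noteq> 0" for t
  proof -
    have "(\<alpha> has_real_derivative (\<phi>' t / a) / cos (\<alpha> t)) (at t)"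
      by (rule derivative_of_lift[where F = sin, OF c\<alpha> du DERIV_sin c0])
    moreover have "(\<phi>' t / a) / cos (\<alpha> t) = e / p.q h (\<alpha> t)"
      using \<phi>'c[of t] c0 a qu[of t] unfolding q\<alpha> by (simp add: field_simps)
    ultimately show ?thesis by simp
  qed
  \<comment> \<open>The momentum along the rotation-invariant direction \<open>axis 3 1\<close> has nonzero derivative at a turning
    time, but depends only on the latitude at such times; hence turning times are isolated.\<close>
  have isolated: "\<forall>\<^sub>F t in at t0. cos (\<alpha> t) \<noteq> 0" if c0: "cos (\<alpha> t0) = 0" for t0
  proof -
    define pz where "pz = (\<lambda>t. G (\<gamma> t) (?v t) (axis 3 1))"
    have turn: "?v t = (P / h^2) *\<^sub>R rot_field (\<gamma> t)" "rr (\<phi> t) = h" if "cos (\<alpha> t) = 0" for t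
    proof -
      have z: "\<phi>' t = 0" using \<phi>'c[of t] that qu[of t] by simp
      then have "h^2 * E / (rr (\<phi> t))^2 = E"
        using EE[of t] unfolding hP[symmetric] by simp
      then have "h^2 * E = E * (rr (\<phi> t))^2" using rp[of t] by (simp add: divide_eq_eq)
      then have "(rr (\<phi> t))^2 = h^2" using Epos by simp
      then show r: "rr (\<phi> t) = h" using rp[of t] h0 by (simp add: power2_eq_iff_nonneg)
      show "?v t = (P / h^2) *\<^sub>R rot_field (\<gamma> t)"
        unfolding v unfolding \<gamma> \<theta>' z r by (simp add: rot_rot_field)
    qed
    have pz_turn: "pz t = P / h^2 * G (mer (\<phi> t)) (rot_field (mer (\<phi> t))) (axis 3 1)" if "cos (\<alpha> t) = 0" for t
      unfolding pz_def turn(1)[OF that] unfolding \<gamma> by (rule axis3_form_rot[OF mer_nz])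
    have "(pz has_real_derivative DG (\<gamma> t0) (?v t0) (axis 3 1) (velocity \<gamma> t0) + G (\<gamma> t0) (velocity (velocity \<gamma>) t0) (axis 3 1)) (at t0)"
      unfolding pz_def by (rule momentum_form_deriv)
    moreover have "DG (\<gamma> t0) (?v t0) (axis 3 1) (velocity \<gamma> t0) + G (\<gamma> t0) (velocity (velocity \<gamma>) t0) (axis 3 1) =
        1/2 * DG (\<gamma> t0) (?v t0) (?v t0) (axis 3 1)"
      using xi0[of t0 "axis 3 1"] unfolding xi_def by simp
    moreover have "DG (\<gamma> t0) (?v t0) (?v t0) (axis 3 1) \<noteq> 0"
    proof -
      have ne2: "\<phi> t0 \<noteq> pi/2" using turn(2)[OF c0] hR by (metis less_irrefl p.R_def)
      have "deriv rr (\<phi> t0) \<noteq> 0" using critical_imp_equator[OF \<phi>] ne2 by blast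
      moreover have "sin (\<phi> t0) > 0" using \<phi>[of t0] by (intro sin_gt_zero) auto
      ultimately have "2 * (P / h^2)^2 * (sin (\<phi> t0))^2 * sqrt (cf (\<phi> t0)) * deriv rr (\<phi> t0) \<noteq> 0"
        using P0 h0 cf_pos[of "\<phi> t0"] by simp
      then show ?thesis unfolding turn(1)[OF c0] unfolding \<gamma> DG_axis3 .
    qed
    ultimately obtain d where d: "(pz has_real_derivative d) (at t0)" "d \<noteq> 0" by auto
    have "((\<lambda>t. (pz t - pz t0) / (t - t0)) \<longlongrightarrow> d) (at t0)" using d(1) by (simp add: has_field_derivative_iff)
    then have ev1: "\<forall>\<^sub>F t in at t0. (pz t - pz t0) / (t - t0) \<noteq> 0" using d(2) by (rule tendsto_imp_eventually_ne)
    have "isCont \<phi> t0" using c\<phi> by (simp add: continuous_on_eq_continuous_at)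
    then have "((\<lambda>t. \<phi> t) \<longlongrightarrow> \<phi> t0) (at t0)" by (simp add: isCont_def)
    \<comment> \<open>The two turning latitudes \<open>pi/2 - a\<close> and \<open>pi/2 + a\<close>
      lie exactly \<open>2 * a\<close> apart, so a turning time this close in latitude has the same
      turning latitude.\<close>
    then have ev2: "\<forall>\<^sub>F t in at t0. dist (\<phi> t) (\<phi> t0) < 2 * a"
      by (rule tendstoD) (use a in simp)
    show ?thesis using ev1 ev2
    proof eventually_elim
      case (elim t)
      show ?case
      proof
        assume c: "cos (\<alpha> t) = 0"
        have "sin (\<alpha> t) = 1 \<or> sin (\<alpha> t) = -1" "sin (\<alpha> t0) = 1 \<or> sin (\<alpha> t0) = -1"
          using c c0 sin_cos_squared_add[of "\<alpha> t"] sin_cos_squared_add[of "\<alpha> t0"] by (simp_all add: power2_eq_1_iff)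
        then have "\<phi> t = \<phi> t0" using elim(2) a unfolding \<phi>u \<alpha>(3) dist_real_def by (auto simp: abs_if split: if_splits)
        then have "pz t = pz t0" using pz_turn[OF c] pz_turn[OF c0] by simp
        then show False using elim(1) by simp
      qed
    qed
  qed
  \<comment> \<open>At a turning time the sine of the phase is stationary and does not determine the
    derivative of the phase; there it arises as a limit.\<close>
  have d\<alpha>: "(\<alpha> has_real_derivative e / p.q h (\<alpha> t)) (at t)" for t
  proof (cases "cos (\<alpha> t) = 0")
    case True
    have "continuous_on UNIV (\<lambda>t. e / p.q h (\<alpha> t))"
      unfolding q\<alpha> using qu by (intro continuous_intros cqu) (auto simp: less_imp_neq[THEN not_sym])
    then have lim: "((\<lambda>t. e / p.q h (\<alpha> t)) \<longlongrightarrow> e / p.q h (\<alpha> t)) (at t)"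
      by (simp add: continuous_on_def)
    show ?thesis
      by (rule derivative_at_limit[OF c\<alpha> _ lim]) (use isolated[OF True] reg in \<open>auto elim: eventually_mono\<close>)
  qed (rule reg)
  have \<phi>\<alpha>: "\<phi> t = pi/2 + p.amp h * sin (\<alpha> t)" for t unfolding \<alpha>(3) by (simp only: \<phi>u a_def)
  \<comment> \<open>The constant of integration of the longitude: \<open>\<theta>\<close> and the
    formula have the same derivative by momentum conservation.\<close>
  define \<theta>0 where "\<theta>0 = \<theta> 0 - sg * p.eta h (\<alpha> 0) - beta (\<phi> 0)"
  have "\<theta> t - sg * p.eta h (\<alpha> t) - beta (\<phi> t) = \<theta>0" for t
  proof -
    have "((\<lambda>t. \<theta> t - sg * p.eta h (\<alpha> t) - beta (\<phi> t)) has_real_derivative 0) (at t)" for t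
    proof -
      have "((\<lambda>t. \<theta> t - sg * p.eta h (\<alpha> t) - beta (\<phi> t)) has_real_derivative
        \<theta>' t - sg * (h * p.q h (\<alpha> t) / (rr (pi/2 + p.amp h * sin (\<alpha> t)))^2 * (e / p.q h (\<alpha> t))) - - bf (\<phi> t) / (sin (\<phi> t) * cf (\<phi> t)) * \<phi>' t) (at t)"
        by (intro DERIV_diff DERIV_cmult d\<theta> DERIV_chain2[where f = beta, OF d_beta[OF \<phi>] d\<phi>]
            DERIV_chain2[where f = "p.eta h", OF p.d_eta[OF h] d\<alpha>])
      moreover have "sg * (h * p.q h (\<alpha> t) / (rr (pi/2 + p.amp h * sin (\<alpha> t)))^2 * (e / p.q h (\<alpha> t))) = P / (rr (\<phi> t))^2"
        unfolding \<phi>\<alpha>[symmetric] sg(2)[symmetric] using p.q_pos[OF h, of "\<alpha> t"] by simp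
      ultimately show ?thesis by (simp add: \<theta>')
    qed
    from constant_if_deriv_zero[OF this, of t 0] show ?thesis by (simp only: \<theta>0_def)
  qed
  then have \<theta>eq: "\<theta> t = sg * p.eta h (\<alpha> t) + beta (pi/2 + p.amp h * sin (\<alpha> t)) + \<theta>0" for t
    unfolding \<phi>\<alpha>[symmetric] by (simp add: algebra_simps)
  have "oscillation g h e sg \<theta>0 \<alpha> \<gamma>"
  proof unfold_locales
    show "\<gamma> t = rot (sg * p.eta h (\<alpha> t) + beta (pi/2 + p.amp h * sin (\<alpha> t)) + \<theta>0) (mer (pi/2 + p.amp h * sin (\<alpha> t)))" for t
      using \<gamma>[of t] unfolding \<theta>eq[of t] \<phi>\<alpha>[of t] .
  qed (rule h e(1) sg(1) d\<alpha>)+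
  moreover have "g (\<gamma> t) (velocity \<gamma> t) (velocity \<gamma> t) = e^2" for t
    using E[of t] G_eq[OF on_S2 vel_tangent vel_tangent, of t] e(2) by simp
  ultimately show ?thesis using that by blast
qed

end

section \<open>From oscillations to geodesics\<close>

lemma DERIV_mult_zero:
  fixes F H :: "real \<Rightarrow> real"
  assumes F: "(F has_real_derivative d) (at x)" "F x = 0" and H: "isCont H x"
  shows "((\<lambda>t. F t * H t) has_real_derivative d * H x) (at x)"
proof -
  have "((\<lambda>t. (F t - F x) / (t - x) * H t) \<longlongrightarrow> d * H x) (at x)"
    using F(1) H by (intro tendsto_mult) (auto simp: has_field_derivative_iff isCont_def)
  then show ?thesis using F(2) by (simp add: has_field_derivative_iff)
qed

context profile
begin

lemma N_arg_pos: "h \<in> {0<..<R} \<Longrightarrow> cos x \<noteq> 0 \<Longrightarrow> N h (pi/2 + amp h * sin x) > 0"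
proof -
  assume h: "h \<in> {0<..<R}" and c: "cos x \<noteq> 0"
  have "0 < (amp h * cos x)^2" using amp_pos[OF h] c by simp
  then show ?thesis unfolding q_eq[OF h] by (simp add: zero_less_mult_iff)
qed

text \<open>Away from turning phases \<open>q_eq\<close> can be solved as
  \<open>q h x = amp h * \<bar>cos x\<bar> / sqrt (N h \<phi>)\<close>, a quotient of differentiable
  functions where the cosine keeps its sign.\<close>

lemma q_differentiable:
  assumes h: "h \<in> {0<..<R}" and c: "cos x \<noteq> 0"
  shows "q h differentiable (at x)"
proof -
  define k where "k = amp h * sgn (cos x)"
  define U where "U = {y. 0 < sgn (cos x) * cos y}"
  have U: "open U" unfolding U_def by (intro open_Collect_less continuous_intros)
  have xU: "x \<in> U" using c by (simp add: U_def sgn_mult_self_eq sgn_if)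
  have arg: "pi/2 + amp h * sin y \<in> {0<..<pi}" for y using arg_bounds'[OF h, of y] iota_h[OF h] by auto
  have eq: "k * cos y / sqrt (N h (pi/2 + amp h * sin y)) = q h y" if y: "y \<in> U" for y
  proof -
    have cy: "cos y \<noteq> 0" using y by (auto simp: U_def)
    have Np: "N h (pi/2 + amp h * sin y) > 0" by (rule N_arg_pos[OF h cy])
    have "0 < k * cos y" using y amp_pos[OF h] by (simp add: U_def k_def mult.assoc)
    moreover have "(k * cos y)^2 = (q h y)^2 * N h (pi/2 + amp h * sin y)"
      using q_eq[OF h, of y] c by (simp add: k_def power_mult_distrib sgn_if)
    ultimately have "k * cos y = sqrt ((q h y)^2 * N h (pi/2 + amp h * sin y))"
      by (metis less_imp_le real_sqrt_unique)
    also have "\<dots> = q h y * sqrt (N h (pi/2 + amp h * sin y))" using q_pos[OF h, of y] by (simp add: real_sqrt_mult)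
    finally show ?thesis using Np by simp
  qed
  have dA: "((\<lambda>y. pi/2 + amp h * sin y) has_real_derivative 0 + amp h * cos x) (at x)"
    by (intro DERIV_add DERIV_const DERIV_cmult DERIV_sin)
  note dN = DERIV_chain2[where f = "N h", OF d_N[OF h arg] dA]
  note dS = DERIV_chain2[where f = sqrt, OF DERIV_real_sqrt[OF N_arg_pos[OF h c]] dN]
  have "sqrt (N h (pi/2 + amp h * sin x)) \<noteq> 0" using N_arg_pos[OF h c] by simp
  note dQ = DERIV_divide[OF DERIV_cmult[OF DERIV_cos] dS this]
  show ?thesis
    unfolding real_differentiable_def
    by (rule exI, rule has_field_derivative_transform_within_open[OF dQ U xU eq])
qed

end

context sphere_metric
begin

lemma DG_continuous: "continuous_on (- {0}) (\<lambda>x. DG x v w (axis i 1))"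
proof -
  have "axis i (1::real) \<in> (Basis :: (real^3) set)" by (auto simp: Basis_vec_def)
  then show ?thesis using G_smooth[of "Suc 0" v w] unfolding DG_def by simp
qed

lemma DG_along_continuous:
  assumes X: "continuous_on UNIV X" "\<And>t. X t \<noteq> 0" and V: "\<And>i. continuous_on UNIV (\<lambda>t. V t $ i)"
  shows "continuous_on UNIV (\<lambda>t. DG (X t) (V t) (V t) (axis k 1))"
proof -
  have "continuous_on UNIV (\<lambda>t. DG (X t) v w (axis k 1))" for v w
    by (rule continuous_on_compose2[OF DG_continuous X(1)]) (use X(2) in auto)
  then have "continuous_on UNIV (\<lambda>t. \<Sum>i\<in>UNIV. \<Sum>j\<in>UNIV. V t $ i * V t $ j * DG (X t) (axis i 1) (axis j 1) (axis k 1))"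
    by (intro continuous_intros V)
  then show ?thesis unfolding DG_expansion[OF X(2), symmetric] .
qed

end

context oscillation
begin

definition vv where "vv t = latd t *\<^sub>R rot (lon t) (mer' (lat t)) + lond t *\<^sub>R rot (lon t) (rot_field (mer (lat t)))"

lemma d_\<gamma>: "(\<gamma> has_vector_derivative vv t) (at t)"
proof -
  have "\<gamma> = (\<lambda>t. rot (lon t) (mer (lat t)))" using \<gamma>_coords by (rule ext)
  then show ?thesis unfolding vv_def using polar_velocity[OF d_lat d_lon] by simp
qed

lemma latd_differentiable: "latd differentiable (at t)"
proof (cases "cos (\<alpha> t) = 0")
  case True
  \<comment> \<open>At a turning time only continuity of \<open>q h\<close> is at hand, but it
    multiplies a factor that vanishes there, so the product is still differentiable.\<close>
  have "((\<lambda>t. p.amp h * cos (\<alpha> t)) has_real_derivative p.amp h * (- sin (\<alpha> t) * (e / p.q h (\<alpha> t)))) (at t)"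
    by (intro DERIV_cmult DERIV_chain2[where f = cos, OF DERIV_cos d_\<alpha>])
  moreover have "isCont (\<lambda>t. e / p.q h (\<alpha> t)) t"
  proof -
    have "continuous_on UNIV (\<lambda>t. e / p.q h (\<alpha> t))"
      using p.q_pos[OF h] by (intro continuous_intros continuous_on_compose2[OF p.cont_q[OF h, of UNIV] cont_\<alpha>]) (auto simp: less_imp_neq[THEN not_sym])
    then show ?thesis by (simp add: continuous_on_eq_continuous_at)
  qed
  ultimately have "((\<lambda>t. p.amp h * cos (\<alpha> t) * (e / p.q h (\<alpha> t))) has_real_derivative
     p.amp h * (- sin (\<alpha> t) * (e / p.q h (\<alpha> t))) * (e / p.q h (\<alpha> t))) (at t)"
    using True by (intro DERIV_mult_zero) auto
  then show ?thesis unfolding real_differentiable_def latd_def[abs_def] mult.assoc by (rule exI)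
next
  case False
  obtain d where "(p.q h has_real_derivative d) (at (\<alpha> t))"
    using p.q_differentiable[OF h False] real_differentiable_def by blast
  then have dq: "((\<lambda>t. p.q h (\<alpha> t)) has_real_derivative d * (e / p.q h (\<alpha> t))) (at t)"
    by (rule DERIV_chain2[where f = "p.q h", OF _ d_\<alpha>])
  have "p.q h (\<alpha> t) \<noteq> 0" using p.q_pos[OF h, of "\<alpha> t"] by simp
  note DERIV_cmult[OF DERIV_mult[OF DERIV_chain2[where f = cos, OF DERIV_cos d_\<alpha>] DERIV_divide[OF DERIV_const[of e] dq this]]]
  then show ?thesis unfolding real_differentiable_def latd_def[abs_def] by (rule exI)
qed

lemma C1_lat_differentiable: "C1 f \<Longrightarrow> (\<lambda>t. f (lat t)) differentiable (at t)"
  unfolding real_differentiable_def by (rule exI, rule DERIV_chain2[where f = f, OF C1_deriv(1) d_lat])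

lemma lond_differentiable: "lond differentiable (at t)"
proof -
  have nz: "(rr (lat t))^2 \<noteq> 0" "sin (lat t) * cf (lat t) \<noteq> 0"
    using rr_lat_pos[of t] sin_lat_pos[of t] cf_pos[of "lat t"] by simp_all
  show ?thesis unfolding lond_def[abs_def]
    by (intro differentiable_add differentiable_mult differentiable_const differentiable_divide differentiable_power
        differentiable_minus latd_differentiable C1_lat_differentiable C1_bf C1_sin C2_imp_C1[OF C2_cf] C2_imp_C1[OF C2_rr] nz)
qed

lemma vv_nth:
  "vv t $ 1 = latd t * (cos (lon t) * cos (lat t)) - lond t * (sin (lon t) * sin (lat t))"
  "vv t $ 2 = latd t * (sin (lon t) * cos (lat t)) + lond t * (cos (lon t) * sin (lat t))"
  "vv t $ 3 = latd t * sin (lat t)"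
  by (simp_all add: vv_def)

lemma vv_differentiable: "\<exists>d. (vv has_vector_derivative d) (at t)"
proof -
  have trig: "(\<lambda>t. sin (lat t)) differentiable (at t)" "(\<lambda>t. cos (lat t)) differentiable (at t)"
    "(\<lambda>t. sin (lon t)) differentiable (at t)" "(\<lambda>t. cos (lon t)) differentiable (at t)"
    unfolding real_differentiable_def
    using DERIV_chain2[where f = sin, OF DERIV_sin d_lat] DERIV_chain2[where f = cos, OF DERIV_cos d_lat]
      DERIV_chain2[where f = sin, OF DERIV_sin d_lon] DERIV_chain2[where f = cos, OF DERIV_cos d_lon] by blast+
  have "(\<lambda>t. vv t $ 1) differentiable (at t)" "(\<lambda>t. vv t $ 2) differentiable (at t)" "(\<lambda>t. vv t $ 3) differentiable (at t)"
    unfolding vv_nth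
    by (intro differentiable_add differentiable_diff differentiable_mult latd_differentiable lond_differentiable trig)+
  then obtain d1 d2 d3 where "((\<lambda>t. vv t $ 1) has_real_derivative d1) (at t)" "((\<lambda>t. vv t $ 2) has_real_derivative d2) (at t)"
    "((\<lambda>t. vv t $ 3) has_real_derivative d3) (at t)"
    unfolding real_differentiable_def by blast
  then have "(vv has_vector_derivative vector [d1, d2, d3]) (at t)"
    by (intro has_vector_derivative_vec3) (simp_all add: vector_3)
  then show ?thesis by blast
qed

sublocale sc: sphere_curve g \<gamma> vv "\<lambda>t. velocity vv t"
proof unfold_locales
  show "\<gamma> t \<in> S2" for t unfolding \<gamma>_coords using mer_S2[of "lat t"] rot_norm[of "lon t" "mer (lat t)"] by simp
  show "(\<gamma> has_vector_derivative vv t) (at t)" for t by (rule d_\<gamma>)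
  show "(vv has_vector_derivative velocity vv t) (at t)" for t
    using vv_differentiable[of t] vector_derivative_at by metis
qed

lemma momentum: "G (\<gamma> t) (vv t) (rot_field (\<gamma> t)) = sg * h * e"
proof -
  have "lond t = G (\<gamma> t) (vv t) (rot_field (\<gamma> t)) / (rr (lat t))^2 - bf (lat t) / (sin (lat t) * cf (lat t)) * latd t"
    using coordinate_energy_momentum(1)[OF lat_bounds, of "lond t" "lon t" t "latd t"] unfolding vv_def \<gamma>_coords .
  then have "G (\<gamma> t) (vv t) (rot_field (\<gamma> t)) / (rr (lat t))^2 = sg * (h / (rr (lat t))^2 * e)"
    unfolding lond_def by linarith
  then show ?thesis using rr_lat_pos[of t] by (auto simp: divide_simps mult_ac)
qed

lemma energy: "G (\<gamma> t) (vv t) (vv t) = e^2"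
proof -
  have "kap (lat t) * (latd t)^2 + (sg * h * e)^2 / (rr (lat t))^2 = G (\<gamma> t) (vv t) (vv t)"
    using coordinate_energy_momentum(2)[OF lat_bounds, of t "latd t" "lon t" "lond t"] momentum[of t] unfolding vv_def \<gamma>_coords by simp
  moreover have "kap (lat t) * (latd t)^2 = e^2 * (1 - h^2 / (rr (lat t))^2)"
  proof -
    have "(latd t)^2 = (p.amp h * cos (\<alpha> t))^2 * (e / p.q h (\<alpha> t))^2" unfolding latd_def by (simp only: power_mult_distrib mult.assoc)
    also have "\<dots> = p.N h (lat t) * e^2"
      unfolding p.q_eq[OF h] lat_def using p.q_pos[OF h, of "\<alpha> t"] by (simp add: power_divide)
    finally have "(latd t)^2 = p.N h (lat t) * e^2" .
    moreover have "kap (lat t) = (ss (lat t))^2" using kap_pos[of "lat t"] by (simp add: ss_def)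
    ultimately show ?thesis using ss_pos[of "lat t"] by (simp add: p.N_def)
  qed
  moreover have "sg^2 = 1" using sg by (metis power2_abs one_power2)
  then have "(sg * h * e)^2 = h^2 * e^2" by (simp add: power_mult_distrib)
  ultimately have "G (\<gamma> t) (vv t) (vv t) = e^2 * (1 - h^2 / (rr (lat t))^2) + h^2 * e^2 / (rr (lat t))^2" by metis
  then show ?thesis by (simp add: algebra_simps)
qed

lemma not_pole: "\<gamma> t \<noteq> south" "\<gamma> t \<noteq> north"
proof -
  have "(cos (lat t))^2 \<noteq> 1" using sin_lat_pos[of t] by (simp add: cos_squared_eq)
  then have "- cos (lat t) \<noteq> 1" "- cos (lat t) \<noteq> -1" by (auto simp: power2_eq_1_iff minus_equation_iff)
  then show "\<gamma> t \<noteq> south" "\<gamma> t \<noteq> north" unfolding \<gamma>_coords by (auto simp: vec3_eq)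
qed

text \<open>Constant momentum kills \<open>xi\<close> on the rotation field and constant energy
  kills it on the velocity. Off the turning times the velocity has a nonzero component along the
  axis, in the decomposition of \<open>xi_decompose\<close>, so the remaining equation
  follows.\<close>

lemma geodesic: "geodesic g \<gamma>"
proof -
  have p0: "sc.xi t (rot_field (\<gamma> t)) = 0" for t
  proof -
    have "(\<lambda>s. G (\<gamma> s) (vv s) (rot_field (\<gamma> s))) = (\<lambda>s. sg * h * e)" using momentum by (rule ext)
    then show ?thesis using sc.momentum_deriv[of t] DERIV_unique[OF _ DERIV_const] by metis
  qed
  have v0: "sc.xi t (vv t) = 0" for t
  proof -
    have "(\<lambda>s. G (\<gamma> s) (vv s) (vv s)) = (\<lambda>s. e^2)" using energy by (rule ext)
    then have "2 * sc.xi t (vv t) = 0" using sc.energy_deriv[of t] DERIV_unique[OF _ DERIV_const] by metis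
    then show ?thesis by simp
  qed
  have reg: "sc.xi t (axis 3 1) = 0" if c: "cos (\<alpha> t) \<noteq> 0" for t
  proof -
    have l: "latd t \<noteq> 0" using c p.amp_pos[OF h] p.q_pos[OF h, of "\<alpha> t"] e by (simp add: latd_def)
    have s: "sin (lat t) > 0" by (rule sin_lat_pos)
    have \<gamma>n: "\<gamma> t $ 1 = cos (lon t) * sin (lat t)" "\<gamma> t $ 2 = sin (lon t) * sin (lat t)" "\<gamma> t $ 3 = - cos (lat t)"
      unfolding \<gamma>_coords by simp_all
    have n: "(\<gamma> t $ 1)^2 + (\<gamma> t $ 2)^2 = (sin (lat t))^2"
    proof -
      have "(\<gamma> t $ 1)^2 + (\<gamma> t $ 2)^2 = ((cos (lon t))^2 + (sin (lon t))^2) * (sin (lat t))^2"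
        unfolding \<gamma>n by (simp only: power_mult_distrib distrib_right)
      then show ?thesis by simp
    qed
    have m: "vv t $ 1 * \<gamma> t $ 1 + vv t $ 2 * \<gamma> t $ 2 = latd t * sin (lat t) * cos (lat t)"
    proof -
      have "vv t $ 1 * \<gamma> t $ 1 + vv t $ 2 * \<gamma> t $ 2 = ((cos (lon t))^2 + (sin (lon t))^2) * (latd t * sin (lat t) * cos (lat t))"
        unfolding \<gamma>n vv_nth by (simp only: power2_eq_square) (simp only: algebra_simps)
      then show ?thesis by simp
    qed
    have "vv t $ 3 - (vv t $ 1 * \<gamma> t $ 1 + vv t $ 2 * \<gamma> t $ 2) / ((\<gamma> t $ 1)^2 + (\<gamma> t $ 2)^2) * \<gamma> t $ 3
      = latd t * ((sin (lat t))^2 + (cos (lat t))^2) / sin (lat t)"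
      unfolding n m unfolding \<gamma>n vv_nth using s
      by (simp only: divide_simps power2_eq_square) (simp add: distrib_left mult_ac)
    then have coef: "vv t $ 3 - (vv t $ 1 * \<gamma> t $ 1 + vv t $ 2 * \<gamma> t $ 2) / ((\<gamma> t $ 1)^2 + (\<gamma> t $ 2)^2) * \<gamma> t $ 3 = latd t / sin (lat t)"
      by simp
    have "0 = latd t / sin (lat t) * sc.xi t (axis 3 1)"
      using sc.xi_decompose[OF not_pole, of t "vv t"] v0[of t] p0[of t] unfolding coef by simp
    then show ?thesis using l s by simp
  qed
  have z: "sc.xi t (axis 3 1) = 0" for t
  proof (cases "cos (\<alpha> t) = 0")
    case True
    \<comment> \<open>The equation along the axis states that \<open>f\<close> has the derivative
      \<open>k\<close>. It holds near the turning time, turning times being isolated as simple zeros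
      of \<open>cos (\<alpha> t)\<close>, and passes to the limit by continuity of
      \<open>k\<close>.\<close>
    define f where "f = (\<lambda>t. G (\<gamma> t) (vv t) (axis 3 1))"
    define k where "k = (\<lambda>t. 1/2 * DG (\<gamma> t) (vv t) (vv t) (axis 3 1))"
    have df: "(f has_real_derivative DG (\<gamma> t) (vv t) (axis 3 1) (vv t) + G (\<gamma> t) (velocity vv t) (axis 3 1)) (at t)" for t
      unfolding f_def by (rule sc.momentum_form_deriv)
    have dr: "(f has_real_derivative k u) (at u)" if "cos (\<alpha> u) \<noteq> 0" for u
    proof -
      have "DG (\<gamma> u) (vv u) (axis 3 1) (vv u) + G (\<gamma> u) (velocity vv u) (axis 3 1) = k u"
        using reg[OF that] unfolding sc.xi_def k_def by simp
      then show ?thesis using df[of u] by (simp only:)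
    qed
    have dc: "((\<lambda>t. cos (\<alpha> t)) has_real_derivative - sin (\<alpha> t) * (e / p.q h (\<alpha> t))) (at t)"
      by (rule DERIV_chain2[where f = cos, OF DERIV_cos d_\<alpha>])
    have s1: "sin (\<alpha> t) \<noteq> 0" using True sin_cos_squared_add[of "\<alpha> t"] by auto
    have "((\<lambda>u. (cos (\<alpha> u) - cos (\<alpha> t)) / (u - t)) \<longlongrightarrow> - sin (\<alpha> t) * (e / p.q h (\<alpha> t))) (at t)"
      using dc by (simp add: has_field_derivative_iff)
    moreover have "- sin (\<alpha> t) * (e / p.q h (\<alpha> t)) \<noteq> 0" using s1 e p.q_pos[OF h, of "\<alpha> t"] by simp
    ultimately have "\<forall>\<^sub>F u in at t. (cos (\<alpha> u) - cos (\<alpha> t)) / (u - t) \<noteq> 0" by (rule tendsto_imp_eventually_ne)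
    then have "\<forall>\<^sub>F u in at t. cos (\<alpha> u) \<noteq> 0" by eventually_elim (use True in auto)
    then have ev: "\<forall>\<^sub>F u in at t. (f has_real_derivative k u) (at u)" by eventually_elim (rule dr)
    have c\<gamma>: "continuous_on UNIV \<gamma>"
      using d_\<gamma> by (meson continuous_at_imp_continuous_on has_vector_derivative_continuous)
    have "continuous_on UNIV (\<lambda>t. DG (\<gamma> t) (vv t) (vv t) (axis 3 1))"
      by (rule DG_along_continuous[OF c\<gamma> sc.nz sc.cont_v_nth])
    then have "continuous_on UNIV k" unfolding k_def by (intro continuous_intros)
    then have "(k \<longlongrightarrow> k t) (at t)" by (simp add: continuous_on_def)
    then have "(f has_real_derivative k t) (at t)"
      by (rule derivative_at_limit[OF DERIV_isCont[OF df] ev])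
    from DERIV_unique[OF this df] show ?thesis unfolding sc.xi_def k_def by simp
  qed (rule reg)
  show ?thesis unfolding sc.geodesic_iff using sc.xi_decompose[OF not_pole] p0 z by simp
qed

end


section \<open>Length sets in terms of the period integrals\<close>

context rotation_metric
begin

text \<open>The phase is the inverse of the elapsed time \<open>tq h\<close>. Speed 1 and longitude
  constant 0 suffice, one geodesic for every \<open>h\<close> being enough to realize its
  length.\<close>

lemma oscillation_exists:
  assumes h: "h \<in> {0<..<p.R}"
  obtains \<alpha> \<gamma> where "oscillation g h 1 1 0 \<alpha> \<gamma>"
proof -
  define \<alpha> where "\<alpha> = (\<lambda>t. SOME x. p.tq h x = t)"
  have tq: "p.tq h (\<alpha> t) = t" for t unfolding \<alpha>_def by (rule someI_ex[OF p.tq_surj[OF h]])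
  have \<alpha>: "\<alpha> (p.tq h x) = x" for x using tq[of "p.tq h x"] p.tq_inj[OF h] by blast
  have "isCont \<alpha> (p.tq h x)" for x
    by (rule isCont_inverse_function[of 1 x \<alpha> "p.tq h", OF _ \<alpha> DERIV_isCont[OF p.d_tq[OF h]]]) simp
  then have cont: "isCont \<alpha> t" for t using tq by metis
  have d: "(\<alpha> has_real_derivative 1 / p.q h (\<alpha> t)) (at t)" for t
  proof -
    have "p.q h (\<alpha> t) \<noteq> 0" using p.q_pos[OF h, of "\<alpha> t"] by simp
    then have "(\<alpha> has_real_derivative inverse (p.q h (\<alpha> t))) (at t)"
      by (intro DERIV_inverse_function[of "p.tq h" _ _ _ "t - 1" "t + 1"] p.d_tq[OF h] cont tq) auto
    then show ?thesis by (simp add: inverse_eq_divide)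
  qed
  have "oscillation g h 1 1 0 \<alpha> (\<lambda>t. rot (1 * p.eta h (\<alpha> t) + beta (pi/2 + p.amp h * sin (\<alpha> t)) + 0) (mer (pi/2 + p.amp h * sin (\<alpha> t))))"
    by unfold_locales (use h d in auto)
  then show ?thesis using that by blast
qed

lemma curve_length_const_speed:
  assumes "\<And>t. g (\<gamma> t) (velocity \<gamma> t) (velocity \<gamma> t) = e^2" "e \<ge> 0" "\<tau> \<ge> 0"
  shows "curve_length g \<gamma> \<tau> = e * \<tau>"
  unfolding curve_length_def assms(1) using assms(2,3) by simp

text \<open>A closed oscillation with \<open>k\<close> phase turns crosses the equator
  \<open>2 * k\<close> times and winds \<open>k * Theta h / (2 * pi)\<close> times, so its type
  fixes \<open>k = q\<close> and the equation for \<open>h\<close>; its length is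
  \<open>q * T h\<close> at any speed.\<close>

theorem length_set_eq:
  assumes pq: "p \<ge> (1::nat)" "q \<ge> (1::nat)" "coprime p q"
  shows "length_set g p q = {q * p.T h | h. h \<in> {0<..<p.R} \<and> q * p.Theta h = 2 * pi * p}"
proof (intro equalityI subsetI)
  fix l assume "l \<in> length_set g p q"
  then obtain \<gamma> \<tau> where l: "l = curve_length g \<gamma> \<tau>" and ty: "of_type g p q \<gamma> \<tau>" unfolding length_set_def by blast
  have cg: "closed_geodesic g \<gamma> \<tau>" and nm: "\<not> is_meridian g \<gamma> \<tau>"
    and wn: "norm (winding_number (shadow \<gamma> \<tau>) 0) = real p"
    and cr: "card {t\<in>{0..<\<tau>}. \<gamma> t \<in> equator g} = 2 * q"
    using ty unfolding of_type_def by auto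
  have \<tau>: "\<tau> > 0" and per: "\<And>t. \<gamma> (t + \<tau>) = \<gamma> t" using cg unfolding closed_geodesic_def by auto
  \<comment> \<open>Inside the equator every parameter would count as a crossing, and the
    cardinality of an infinite set is 0, not \<open>2 * q\<close>.\<close>
  have "\<exists>t. \<gamma> t \<notin> equator g"
  proof (rule ccontr)
    assume "\<not> (\<exists>t. \<gamma> t \<notin> equator g)"
    then have "{t\<in>{0..<\<tau>}. \<gamma> t \<in> equator g} = {0..<\<tau>}" by auto
    moreover have "infinite {0..<\<tau>}" using \<tau> by (simp add: infinite_Ico)
    ultimately show False using cr pq(2) by simp
  qed
  then obtain h e sg \<theta>0 \<alpha> where osc: "oscillation g h e sg \<theta>0 \<alpha> \<gamma>" and sp: "\<And>t. g (\<gamma> t) (velocity \<gamma> t) (velocity \<gamma> t) = e^2"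
    using geodesic_oscillation[OF cg nm] by blast
  interpret o: oscillation g h e sg \<theta>0 \<alpha> \<gamma> by (rule osc)
  obtain k :: nat and m :: int where k: "k \<ge> 1" "\<tau> = real k * p.T h / e" "real k * p.Theta h = 2 * pi * of_int m"
    using o.period_only_if[OF per \<tau>] by blast
  have kq: "k = q" using o.crossings[OF k(1,2)] cr by simp
  have "real k * p.Theta h / (2 * pi) = real p" using o.winding[OF k(2)] wn by simp
  then have "q * p.Theta h = 2 * pi * p" unfolding kq by (simp add: field_simps)
  moreover have "l = q * p.T h"
    unfolding l using curve_length_const_speed[OF sp, of \<tau>] o.e \<tau> k(2) kq by simp
  ultimately show "l \<in> {q * p.T h | h. h \<in> {0<..<p.R} \<and> q * p.Theta h = 2 * pi * p}" using o.h by blast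
next
  fix l assume "l \<in> {q * p.T h | h. h \<in> {0<..<p.R} \<and> q * p.Theta h = 2 * pi * p}"
  then obtain h where h: "h \<in> {0<..<p.R}" "q * p.Theta h = 2 * pi * p" "l = q * p.T h" by blast
  obtain \<alpha> \<gamma> where osc: "oscillation g h 1 1 0 \<alpha> \<gamma>" using oscillation_exists[OF h(1)] by blast
  interpret o: oscillation g h 1 1 0 \<alpha> \<gamma> by (rule osc)
  define \<tau> where "\<tau> = real q * p.T h / 1"
  have Tp: "p.T h > 0" by (rule p.T_pos[OF h(1)])
  have \<tau>: "\<tau> > 0" using Tp pq(2) by (simp add: \<tau>_def)
  have per: "\<gamma> (t + \<tau>) = \<gamma> t" for t
    using o.period_if[of "int q" "int p" t] h(2) by (simp add: \<tau>_def)
  have cg: "closed_geodesic g \<gamma> \<tau>"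
    unfolding closed_geodesic_def
  proof (intro conjI allI impI o.geodesic \<tau> per)
    fix s assume s: "0 < s \<and> s < \<tau>"
    show "\<exists>t. \<gamma> (t + s) \<noteq> \<gamma> t"
    proof (rule ccontr)
      assume "\<not> (\<exists>t. \<gamma> (t + s) \<noteq> \<gamma> t)"
      then have ps: "\<And>t. \<gamma> (t + s) = \<gamma> t" by blast
      have s0: "s > 0" using s by simp
      obtain k :: nat and m :: int where k: "k \<ge> 1" "s = real k * p.T h / 1" "real k * p.Theta h = 2 * pi * of_int m"
        using o.period_only_if[OF ps s0] by blast
      have "real k < real q" using s k(2) Tp by (simp add: \<tau>_def)
      \<comment> \<open>A shorter period with \<open>k\<close> turns would make
        \<open>k * p / q\<close> an integer; coprimality gives \<open>q dvd k\<close>, which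
        contradicts \<open>k < q\<close>. So \<open>\<tau>\<close> is the minimal period.\<close>
      have "real q * (2 * pi * of_int m) = real k * (2 * pi * real p)"
        unfolding k(3)[symmetric] h(2)[symmetric] by simp
      then have "real_of_int (int q * m) = real_of_int (int k * int p)" by simp
      then have "int q * m = int k * int p" by (simp only: of_int_eq_iff)
      then have "int q dvd int k * int p" by (metis dvd_triv_left)
      then have "q dvd k * p" by (metis int_dvd_int_iff of_nat_mult)
      then have "q dvd k" using pq(3) by (simp add: coprime_dvd_mult_left_iff coprime_commute)
      then have "q \<le> k" using k(1) by (intro dvd_imp_le) auto
      then show False using \<open>real k < real q\<close> by simp
    qed
  qed
  have "of_type g p q \<gamma> \<tau>"
    unfolding of_type_def
  proof (intro conjI cg)
    \<comment> \<open>At this phase the curve is at its northern turning point, off the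
      equator.\<close>
    obtain t where "\<alpha> t = pi/2" using o.\<alpha>_surj by blast
    then have "o.lat t = pi/2 + p.amp h" unfolding o.lat_def by (simp only: sin_pi_half mult_1_right)
    moreover have "o.lat t \<in> {0<..<pi}" by (rule o.lat_bounds)
    ultimately have "\<gamma> t $ 3 \<noteq> 0" unfolding o.\<gamma>_coords using p.amp_pos[OF h(1)] sin_gt_zero[of "p.amp h"] by (simp add: cos_add)
    then have "\<gamma> t \<notin> equator g" unfolding equator_eq by simp
    then show "range \<gamma> \<noteq> equator g" by blast
    show "\<not> is_meridian g \<gamma> \<tau>" unfolding is_meridian_def using o.not_pole by (metis rangeE)
    show "norm (winding_number (shadow \<gamma> \<tau>) 0) = real p"
      using o.winding[OF \<tau>_def] h(2) by simp
    show "card {t \<in> {0..<\<tau>}. \<gamma> t \<in> equator g} = 2 * q" by (rule o.crossings[OF pq(2) \<tau>_def])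
  qed
  moreover have "g (\<gamma> t) (velocity \<gamma> t) (velocity \<gamma> t) = 1^2" for t
    using o.energy[of t] G_eq[OF o.sc.on_S2 o.sc.vel_tangent o.sc.vel_tangent, of t] by (simp add: o.sc.velocity_eq)
  then have "curve_length g \<gamma> \<tau> = l"
    using curve_length_const_speed[of \<gamma> 1 \<tau>] \<tau> by (simp add: h(3) \<tau>_def)
  ultimately show "l \<in> length_set g p q" unfolding length_set_def by blast
qed

end

section \<open>Equator length and profile\<close>

context rotation_metric
begin

text \<open>The equator length is defined by a unique value, so all parametrizations must be
  compared. Constant momentum makes each of them a uniform rotation of some speed \<open>K\<close>,
  whose minimal period is one full turn.\<close>

lemma equator_closed_geodesic_length:
  assumes cg: "closed_geodesic g \<gamma> \<tau>" and eq: "range \<gamma> = equator g"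
  shows "curve_length g \<gamma> \<tau> = 2 * pi * p.R"
proof -
  have geo: "geodesic g \<gamma>" and \<tau>: "\<tau> > 0" and per: "\<And>t. \<gamma> (t + \<tau>) = \<gamma> t"
    and minimal: "\<And>s. 0 < s \<Longrightarrow> s < \<tau> \<Longrightarrow> \<exists>t. \<gamma> (t + s) \<noteq> \<gamma> t"
    using cg unfolding closed_geodesic_def by auto
  interpret sphere_curve g \<gamma> "velocity \<gamma>" "velocity (velocity \<gamma>)"
    by (rule geodesic_sphere_curve[OF sphere_metric_axioms geo])
  have z: "\<gamma> t $ 3 = 0" for t using eq rangeI[of \<gamma> t] unfolding equator_eq by auto
  have v3: "velocity \<gamma> t $ 3 = 0" for t
  proof -
    have "((\<lambda>s. \<gamma> s $ 3) has_real_derivative 0) (at t)" by (simp add: z)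
    from DERIV_unique[OF vel_nth this] show ?thesis .
  qed
  have np: "\<gamma> t \<noteq> south" "\<gamma> t \<noteq> north" for t using z[of t] by (auto simp: vec3_eq)
  have "\<exists>k. velocity \<gamma> t = k *\<^sub>R rot_field (\<gamma> t)" for t using tangent_level[OF np v3] by metis
  then obtain k where k: "\<And>t. velocity \<gamma> t = k t *\<^sub>R rot_field (\<gamma> t)" by metis
  have GR: "G (\<gamma> t) (rot_field (\<gamma> t)) (rot_field (\<gamma> t)) = p.R^2" for t
  proof -
    have "pi/2 \<in> {0<..<pi}" by simp
    have "equator g = range (\<lambda>t. rot t (mer (pi/2)))"
      unfolding equator_def using unique_equator parallel_equator(2)[OF \<open>pi/2 \<in> {0<..<pi}\<close> deriv_rr_equator] by (intro the1_equality)
    then obtain s where s: "\<gamma> t = rot s (mer (pi/2))" using eq rangeI[of \<gamma> t] by auto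
    show ?thesis unfolding s rot_rot_field G_rot[OF mer_nz] rr_sq[symmetric] p.R_def ..
  qed
  have xi0: "xi t e = 0" for t e using geo geodesic_iff by blast
  have R: "p.R > 0" unfolding p.R_def by (rule rr_pos) simp
  have "((\<lambda>s. G (\<gamma> s) (velocity \<gamma> s) (rot_field (\<gamma> s))) has_real_derivative 0) (at t)" for t
    using momentum_deriv[of t] by (simp add: xi0)
  from constant_if_deriv_zero[OF this] have "G (\<gamma> t) (velocity \<gamma> t) (rot_field (\<gamma> t)) = G (\<gamma> 0) (velocity \<gamma> 0) (rot_field (\<gamma> 0))" for t .
  then have "k t * p.R^2 = k 0 * p.R^2" for t unfolding k by (simp add: G_linear nz GR)
  then have "k t = k 0" for t using R by simp
  then have vk: "velocity \<gamma> t = k 0 *\<^sub>R rot_field (\<gamma> t)" for t using k by metis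
  define K where "K = k 0"
  have \<gamma>t: "\<gamma> t = rot (K * t) (\<gamma> 0)" for t
  proof -
    have d: "((\<lambda>t. \<gamma> t $ 1) has_real_derivative - (K * \<gamma> t $ 2)) (at t)" "((\<lambda>t. \<gamma> t $ 2) has_real_derivative K * \<gamma> t $ 1) (at t)" for t
      using vel_nth[of 1 t] vel_nth[of 2 t] by (simp_all add: vk K_def)
    have "((\<lambda>t. cos (- (K * t)) * \<gamma> t $ 1 - sin (- (K * t)) * \<gamma> t $ 2) has_real_derivative 0) (at t)"
      "((\<lambda>t. sin (- (K * t)) * \<gamma> t $ 1 + cos (- (K * t)) * \<gamma> t $ 2) has_real_derivative 0) (at t)" for t
      by (auto intro!: derivative_eq_intros d simp: algebra_simps)
    from constant_if_deriv_zero[OF this(1), of t 0] constant_if_deriv_zero[OF this(2), of t 0]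
    have "rot (- (K * t)) (\<gamma> t) = \<gamma> 0" using z[of t] z[of 0] by (simp add: vec3_eq)
    then have "rot (K * t) (rot (- (K * t)) (\<gamma> t)) = rot (K * t) (\<gamma> 0)" by (rule arg_cong)
    then show ?thesis by (simp add: rot_rot)
  qed
  have ne: "\<gamma> 0 $ 1 \<noteq> 0 \<or> \<gamma> 0 $ 2 \<noteq> 0" using on_S2[of 0] z[of 0] unfolding S2_nth by auto
  have K: "K \<noteq> 0"
  proof
    assume "K = 0"
    then have "\<gamma> t = \<gamma> 0" for t using \<gamma>t[of t] by simp
    then have "\<gamma> (t + \<tau>/2) = \<gamma> t" for t by metis
    then show False using minimal[of "\<tau>/2"] \<tau> by auto
  qed
  have "rot (K * \<tau>) (\<gamma> 0) = rot 0 (\<gamma> 0)" using \<gamma>t[of \<tau>] per[of 0] by simp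
  then obtain n :: int where n: "K * \<tau> = 2 * pi * n" unfolding rot_eq_iff_2pi[OF ne] by auto
  then have "n \<noteq> 0" using K \<tau> by auto
  then have "1 \<le> \<bar>real_of_int n\<bar>" by linarith
  \<comment> \<open>Closing up takes at least one full turn; that it takes no more follows below
    from the minimality of \<open>\<tau>\<close>.\<close>
  then have "2 * pi * 1 \<le> 2 * pi * \<bar>real_of_int n\<bar>" by (intro mult_left_mono) auto
  also have "\<dots> = \<bar>K * \<tau>\<bar>" unfolding n by (simp add: abs_mult)
  also have "\<dots> = \<bar>K\<bar> * \<tau>" using \<tau> by (simp add: abs_mult)
  finally have ge: "2 * pi \<le> \<bar>K\<bar> * \<tau>" by simp
  have "\<gamma> (t + 2 * pi / \<bar>K\<bar>) = \<gamma> t" for t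
  proof -
    have "K * (t + 2 * pi / \<bar>K\<bar>) - K * t = 2 * pi * of_int (if K > 0 then 1 else -1)"
      using K by (cases "K > 0") (simp_all add: distrib_left right_diff_distrib)
    then show ?thesis unfolding \<gamma>t[of "t + _"] \<gamma>t[of t] rot_eq_iff_2pi[OF ne] by blast
  qed
  then have "\<not> 2 * pi / \<bar>K\<bar> < \<tau>" using minimal[of "2 * pi / \<bar>K\<bar>"] K by auto
  then have le: "\<bar>K\<bar> * \<tau> \<le> 2 * pi" using K by (simp add: field_simps)
  have "g (\<gamma> t) (velocity \<gamma> t) (velocity \<gamma> t) = (\<bar>K\<bar> * p.R)^2" for t
  proof -
    have "g (\<gamma> t) (velocity \<gamma> t) (velocity \<gamma> t) = G (\<gamma> t) (velocity \<gamma> t) (velocity \<gamma> t)"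
      by (rule G_eq[OF on_S2 vel_tangent vel_tangent, symmetric])
    also have "\<dots> = K * (K * p.R^2)" unfolding vk K_def[symmetric] by (simp add: G_linear nz GR)
    finally show ?thesis by (simp add: power_mult_distrib power2_eq_square)
  qed
  then have "curve_length g \<gamma> \<tau> = \<bar>K\<bar> * p.R * \<tau>"
    using R \<tau> by (intro curve_length_const_speed) auto
  then show ?thesis using ge le by simp
qed

lemma equator_length_eq: "equator_length g = 2 * pi * p.R"
proof -
  have "pi/2 \<in> {0<..<pi}" by simp
  note e = parallel_equator[OF this deriv_rr_equator]
  have "equator g = range (\<lambda>t. rot t (mer (pi/2)))"
    unfolding equator_def using unique_equator e(2) by (intro the1_equality)
  then show ?thesis
    unfolding equator_length_def
    using e(1) equator_closed_geodesic_length by (intro the_equality) metis+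
qed

text \<open>\<open>antider ss\<close> is the arc length along the twisted meridian, measured from
  the south pole; this is its inverse.\<close>

definition lat_of :: "real \<Rightarrow> real" where "lat_of \<sigma> = (SOME x. antider ss x = \<sigma>)"

lemma d_antider_ss: "(antider ss has_real_derivative ss x) (at x)" and antider_ss_0: "antider ss 0 = 0"
  using antider[OF C1_continuous[OF C1_ss]] by blast+

lemma antider_ss_less: "x < y \<Longrightarrow> antider ss x < antider ss y"
  using DERIV_pos_imp_increasing[of x y "antider ss"] d_antider_ss ss_pos by blast

lemma lat_of_antider: "lat_of (antider ss x) = x"
proof -
  have "antider ss (lat_of (antider ss x)) = antider ss x"
    unfolding lat_of_def by (rule someI) (rule refl)
  then show ?thesis using antider_ss_less[of "lat_of (antider ss x)" x] antider_ss_less[of x "lat_of (antider ss x)"]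
    by linarith
qed

lemma antider_ss_onto:
  assumes "\<sigma> \<in> {0..antider ss pi}"
  obtains x where "x \<in> {0..pi}" "\<sigma> = antider ss x"
proof -
  have "continuous_on {0..pi} (antider ss)"
    using d_antider_ss by (meson DERIV_continuous_on has_field_derivative_at_within)
  then obtain x where "0 \<le> x" "x \<le> pi" "antider ss x = \<sigma>"
    using IVT'[of "antider ss" 0 \<sigma> pi] assms antider_ss_0 by auto
  then show ?thesis using that[of x] by auto
qed

lemma isCont_lat_of: "isCont lat_of (antider ss x)"
  by (rule isCont_inverse_function[of 1 x lat_of "antider ss", OF _ lat_of_antider DERIV_isCont[OF d_antider_ss]]) simp

lemma d_lat_of: "(lat_of has_real_derivative 1 / ss x) (at (antider ss x))"
proof -
  have inj: "antider ss (lat_of y) = y" if y: "antider ss (x - 1) < y" "y < antider ss (x + 1)" for y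
  proof -
    have "continuous_on {x - 1..x + 1} (antider ss)"
      using d_antider_ss by (meson DERIV_continuous_on has_field_derivative_at_within)
    then obtain u where "antider ss u = y"
      using IVT'[of "antider ss" "x - 1" y "x + 1"] y by auto
    then show ?thesis using lat_of_antider by metis
  qed
  have d: "(antider ss has_real_derivative ss x) (at (lat_of (antider ss x)))"
    unfolding lat_of_antider by (rule d_antider_ss)
  have "ss x \<noteq> 0" using ss_pos[of x] by simp
  then have "(lat_of has_real_derivative inverse (ss x)) (at (antider ss x))"
    by (rule DERIV_inverse_function[where f = "antider ss", OF d _ antider_ss_less[of "x - 1" x] antider_ss_less[of x "x + 1"] inj isCont_lat_of]) auto
  then show ?thesis by (simp add: inverse_eq_divide)
qed

text \<open>The twisted meridian in arc length is the curve asked for: the slope of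
  \<open>beta\<close> makes it orthogonal to the rotation field, and its speed in the polar angle is
  \<open>ss\<close>.\<close>

theorem is_profile_rr: "is_profile g (antider ss pi) (\<lambda>\<sigma>. rr (lat_of \<sigma>))"
proof -
  define c where "c = (\<lambda>\<sigma>. rot (beta (lat_of \<sigma>)) (mer (lat_of \<sigma>)))"
  have pole: "rot \<beta> (mer x) = mer x" if "x = 0 \<or> x = pi" for \<beta> x using that by (auto simp: vec3_eq)
  have inner: "\<exists>x\<in>{0<..<pi}. \<sigma> = antider ss x" if \<sigma>: "\<sigma> \<in> {0<..<antider ss pi}" for \<sigma>
  proof -
    obtain x where x: "x \<in> {0..pi}" "\<sigma> = antider ss x" using antider_ss_onto[of \<sigma>] \<sigma> by auto
    then have "x \<noteq> 0" "x \<noteq> pi" using \<sigma> antider_ss_0 by auto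
    then show ?thesis using x by (intro bexI[of _ x]) auto
  qed
  have vel: "(c has_vector_derivative
      (1 / ss x) *\<^sub>R rot (beta x) (mer' x) + (- bf x / (sin x * cf x) * (1 / ss x)) *\<^sub>R rot (beta x) (rot_field (mer x))) (at (antider ss x))"
    if x: "x \<in> {0<..<pi}" for x
  proof -
    have "(beta has_real_derivative - bf x / (sin x * cf x)) (at (lat_of (antider ss x)))"
      unfolding lat_of_antider by (rule d_beta[OF x])
    from polar_velocity[OF d_lat_of DERIV_chain2[where f = beta, OF this d_lat_of]]
    show ?thesis unfolding c_def lat_of_antider .
  qed
  have cont: "continuous_on {0..antider ss pi} c"
    unfolding continuous_on_def
  proof
    fix \<sigma> assume "\<sigma> \<in> {0..antider ss pi}"
    then obtain x where x: "x \<in> {0..pi}" "\<sigma> = antider ss x" by (rule antider_ss_onto)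
    show "(c \<longlongrightarrow> c \<sigma>) (at \<sigma> within {0..antider ss pi})"
    proof (cases "x = 0 \<or> x = pi")
      \<comment> \<open>Nothing is known about \<open>beta\<close> at or near the poles, where it
        may diverge. Rotations fix the poles and preserve distances, so the twist does not affect
        the distance to the pole.\<close>
      case True
      have cs: "c \<sigma> = mer x" unfolding c_def x(2) lat_of_antider by (rule pole[OF True])
      have "isCont mer x" using mer_deriv(1) has_vector_derivative_continuous by blast
      then have "isCont (\<lambda>s. mer (lat_of s)) \<sigma>"
        unfolding x(2) by (intro isCont_o2[OF isCont_lat_of]) (simp add: lat_of_antider)
      then have "((\<lambda>s. mer (lat_of s)) \<longlongrightarrow> mer x) (at \<sigma>)"
        unfolding isCont_def by (simp add: x(2) lat_of_antider)
      then have "((\<lambda>s. dist (mer (lat_of s)) (mer x)) \<longlongrightarrow> 0) (at \<sigma>)" by (simp only: tendsto_dist_iff[symmetric])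
      moreover have "dist (mer (lat_of s)) (mer x) = dist (c s) (c \<sigma>)" for s
      proof -
        have "c s - c \<sigma> = rot (beta (lat_of s)) (mer (lat_of s) - mer x)"
          unfolding rot_diff pole[OF True] cs by (simp add: c_def)
        then show ?thesis by (simp only: dist_norm rot_norm)
      qed
      ultimately have "(c \<longlongrightarrow> c \<sigma>) (at \<sigma>)" by (simp add: tendsto_dist_iff[of c])
      then show ?thesis by (rule tendsto_within_subset) simp
    next
      case False
      then have "isCont c \<sigma>" using vel[of x] x has_vector_derivative_continuous by auto
      then show ?thesis unfolding isCont_def by (rule tendsto_within_subset) simp
    qed
  qed
  have interior: "c \<sigma> \<in> S2 - {south, north} \<and> c differentiable (at \<sigma>) \<and>
     g (c \<sigma>) (velocity c \<sigma>) (velocity c \<sigma>) = 1 \<and> g (c \<sigma>) (velocity c \<sigma>) (rot_field (c \<sigma>)) = 0"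
    if \<sigma>: "\<sigma> \<in> {0<..<antider ss pi}" for \<sigma>
  proof -
    obtain x where x: "x \<in> {0<..<pi}" "\<sigma> = antider ss x" using inner[OF \<sigma>] by blast
    define u where "u = (1 / ss x) *\<^sub>R rot (beta x) (mer' x) + (- bf x / (sin x * cf x) * (1 / ss x)) *\<^sub>R rot (beta x) (rot_field (mer x))"
    have cx: "c \<sigma> = rot (beta x) (mer x)" by (simp add: c_def x(2) lat_of_antider)
    have d: "(c has_vector_derivative u) (at \<sigma>)" unfolding u_def x(2) by (rule vel[OF x(1)])
    have S: "c \<sigma> \<in> S2" unfolding cx S2_iff rot_norm using mer_S2 by simp
    have "u = rot (beta x) ((1 / ss x) *\<^sub>R mer' x + (- bf x / (sin x * cf x) * (1 / ss x)) *\<^sub>R rot_field (mer x))"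
      by (simp only: u_def rot_add rot_scale)
    moreover have "(1 / ss x) *\<^sub>R mer' x + (- bf x / (sin x * cf x) * (1 / ss x)) *\<^sub>R rot_field (mer x) \<in> tangent (mer x)"
      using mer'_tangent[of x] rot_field_tangent[of "mer x"] unfolding tangent_iff by (simp only: inner_add_left inner_scaleR_left mult_zero_right add_0_left)
    ultimately have t: "u \<in> tangent (c \<sigma>)" unfolding cx by (simp only: rot_tangent)
    note coord = coordinate_energy_momentum[OF x(1), where k = "1 / ss x" and l = "- bf x / (sin x * cf x) * (1 / ss x)" and \<theta> = "beta x", folded u_def cx]
    have "(rr x)^2 \<noteq> 0" using rr_pos[OF x(1)] by simp
    then have P: "G (c \<sigma>) u (rot_field (c \<sigma>)) = 0" using coord(1) by simp
    have "kap x = (ss x)^2" using kap_pos[of x] by (simp add: ss_def)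
    then have E: "G (c \<sigma>) u u = 1" using coord(2) P ss_pos[of x] by (simp add: power_divide)
    have "(cos x)^2 \<noteq> 1" using sin_gt_zero[of x] x(1) by (simp add: cos_squared_eq)
    then have "- cos x \<noteq> 1" "- cos x \<noteq> -1" by (auto simp: power2_eq_1_iff minus_equation_iff)
    then have "c \<sigma> \<noteq> south" "c \<sigma> \<noteq> north" unfolding cx by (auto simp: vec3_eq)
    then show ?thesis
      unfolding vector_derivative_at[OF d] G_eq[OF S t t, symmetric] G_eq[OF S t rot_field_tangent, symmetric]
      using S P E d differentiableI_vector by auto
  qed
  have radius: "rr (lat_of \<sigma>) = sqrt (g (c \<sigma>) (rot_field (c \<sigma>)) (rot_field (c \<sigma>)))" if \<sigma>: "\<sigma> \<in> {0..antider ss pi}" for \<sigma>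
  proof -
    obtain x where x: "x \<in> {0..pi}" "\<sigma> = antider ss x" using antider_ss_onto[OF \<sigma>] by blast
    have cx: "c \<sigma> = rot (beta x) (mer x)" by (simp add: c_def x(2) lat_of_antider)
    have S: "c \<sigma> \<in> S2" unfolding cx S2_iff rot_norm using mer_S2 by simp
    have "rr x \<ge> 0" unfolding rr_def using x(1) sin_ge_zero[of x] cf_pos[of x] by simp
    moreover have "G (c \<sigma>) (rot_field (c \<sigma>)) (rot_field (c \<sigma>)) = (rr x)^2"
      unfolding cx rot_rot_field G_rot[OF mer_nz] rr_sq ..
    ultimately show ?thesis
      unfolding G_eq[OF S rot_field_tangent rot_field_tangent, symmetric] by (simp add: x(2) lat_of_antider)
  qed
  have "c 0 = south" "c (antider ss pi) = north"
    using lat_of_antider[of 0] lat_of_antider[of pi] by (simp_all add: antider_ss_0 c_def vec3_eq)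
  moreover have "antider ss pi > 0" using antider_ss_less[of 0 pi] antider_ss_0 by simp
  ultimately show ?thesis unfolding is_profile_def using cont interior radius by blast
qed

end

lemma is_profile_cong:
  assumes "is_profile g m r" "\<And>\<sigma>. \<sigma> \<in> {0..m} \<Longrightarrow> r' \<sigma> = r \<sigma>"
  shows "is_profile g m r'"
  using assms unfolding is_profile_def by simp

theorem corollaryC:
  fixes g\<^sub>1 g\<^sub>2 :: tensor
  assumes "g\<^sub>1 \<in> unique_equator_metrics" and "g\<^sub>2 \<in> unique_equator_metrics"
    and "Z2_symmetric g\<^sub>1" and "Z2_symmetric g\<^sub>2"
    and "isospectral g\<^sub>1 g\<^sub>2"
  shows "\<exists>m r. is_profile g\<^sub>1 m r \<and> is_profile g\<^sub>2 m r"
proof -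
  have metric: "rotation_metric g" if "g \<in> unique_equator_metrics" "Z2_symmetric g" for g
  proof -
    have "riemannian_metric g" "S1_invariant g" "\<exists>!C. is_equator g C"
      using that(1) unfolding unique_equator_metrics_def by (simp_all only: mem_Collect_eq)
    then show ?thesis
      using that(2) by (simp only: rotation_metric_def rotation_metric_axioms_def sphere_metric_def simp_thms)
  qed
  interpret g1: rotation_metric g\<^sub>1 by (rule metric[OF assms(1,3)])
  interpret g2: rotation_metric g\<^sub>2 by (rule metric[OF assms(2,4)])
  have R: "g1.p.R = g2.p.R"
    using assms(5) unfolding isospectral_def g1.equator_length_eq g2.equator_length_eq by simp
  have spec: "length_set g\<^sub>1 p q = length_set g\<^sub>2 p q" if "p \<ge> 1" "q \<ge> 1" "coprime p q" for p q
    using assms(5) that unfolding isospectral_def by blast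
  have "{q * g1.p.T h | h. h \<in> {0<..<g1.p.R} \<and> q * g1.p.Theta h = 2 * pi * p} =
      {q * g2.p.T h | h. h \<in> {0<..<g2.p.R} \<and> q * g2.p.Theta h = 2 * pi * p}"
    if "p \<ge> (1::nat)" "q \<ge> (1::nat)" "coprime p q" for p q
    using spec[OF that] unfolding g1.length_set_eq[OF that] g2.length_set_eq[OF that] .
  from profile_determined_by_front[OF g1.p.profile_axioms g2.p.profile_axioms R this]
  have w: "g1.p.w h = g2.p.w h" if "h \<in> {0<..<g1.p.R}" for h using that by blast
  have unique: "antider g1.ss pi = antider g2.ss pi"
    "\<And>x y. x \<in> {0..pi} \<Longrightarrow> y \<in> {0..pi} \<Longrightarrow> antider g1.ss x = antider g2.ss y \<Longrightarrow> g1.rr x = g2.rr y"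
    by (rule profile_radius_unique[OF g1.p.profile_axioms g2.p.profile_axioms R w
      g1.d_antider_ss g1.antider_ss_0 g2.d_antider_ss g2.antider_ss_0]; assumption)+
  define m where "m = antider g1.ss pi"
  have m: "antider g2.ss pi = m" unfolding m_def by (rule unique(1)[symmetric])
  \<comment> \<open>The polar angles at the arc length \<open>\<sigma>\<close> may differ between
    the two metrics, as the metrics themselves need not coincide as tensors; only the radii
    agree.\<close>
  have "g1.rr (g1.lat_of \<sigma>) = g2.rr (g2.lat_of \<sigma>)" if \<sigma>: "\<sigma> \<in> {0..m}" for \<sigma>
  proof -
    obtain x where x: "x \<in> {0..pi}" "\<sigma> = antider g1.ss x" using g1.antider_ss_onto[of \<sigma>] \<sigma> m_def by blast
    obtain y where y: "y \<in> {0..pi}" "\<sigma> = antider g2.ss y" using g2.antider_ss_onto[of \<sigma>] \<sigma> m by blast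
    have "g1.lat_of \<sigma> = x" "g2.lat_of \<sigma> = y"
      using g1.lat_of_antider[of x] g2.lat_of_antider[of y] x(2) y(2) by simp_all
    then show ?thesis using unique(2)[OF x(1) y(1)] x(2) y(2) by simp
  qed
  with g2.is_profile_rr have "is_profile g\<^sub>2 m (\<lambda>\<sigma>. g1.rr (g1.lat_of \<sigma>))"
    unfolding m by (rule is_profile_cong)
  with g1.is_profile_rr show ?thesis unfolding m_def by blast
qed

end
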